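(* Let $M>0$. Suppose $L\in C^1[0,M]$ satisfies $L(0)=0$, $L(m)\ge 0$ and $L'(m)\ge 0$ for $0\le m\le M$, and $L(am)\ge a^{4/3}L(m)$ for all $0<a\le 1$, $0\le m\le M$. Suppose the pressure function satisfies $p\in C^1[0,+\infty)$, $\int_0^1 \frac{p(\rho)}{\rho^2}d\rho<+\infty$, $\lim_{\rho\to\infty}\frac{p(\rho)}{\rho^{\gamma}}=K$, $p(\rho)\ge 0$, and $p'(\rho)>0$ for $\rho>0$, where $0<K<+\infty$ and $\gamma\ge 4/3$ are constants. Assume that (1) $\inf_{\rho\in W_M}F(\rho)<0$, and (2) there are positive constants $C_1,C_2$ such that for all $\rho\in W_M$, $$\int \Big[A(\rho(x))+\frac12\frac{\rho(x)L(m_\rho(r(x)))}{r(x)^2}\Big]dx\le C_1F(\rho)+C_2 .$$ Then the following hold. (a) If $\{\rho^i\}\subset W_M$ is a minimizing sequence for $F$ in $W_M$, then there exist a sequence of vertical shifts $a_i\mathbf e_3$ ($a_i\in\mathbb R$, $\mathbf e_3=(0,0,1)$), a subsequence of $\{\rho^i\}$ (still labeled $\{\rho^i\}$), and a function $\tilde\rho\in W_M$ such that, with $T\rho^i(x):=\rho^i(x+a_i\mathbf e_3)$, for any $\epsilon>0$ there exists $R>0$ with $$\int_{|x|\ge R}T\rho^i(x)\,dx\le\epsilon,\qquad i\in\mathbb N,$$ and $T\rho^i\rightharpoonup\tilde\rho$ weakly in $L^\gamma(\mathbb R^3)$ as $i\to\infty$. Moreover, (b) $\nabla B(T\rho^i)\to\nabla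 B\tilde\rho$ strongly in $L^2(\mathbb R^3)$ as $i\to\infty$; and (c) $\tilde\rho$ is a minimizer of $F$ in $W_M$.
   Context: Here $\int=\int_{\mathbb R^3}$, and for $x=(x_1,x_2,x_3)\in\mathbb R^3$, $r(x)=\sqrt{x_1^2+x_2^2}$. A function on $\mathbb R^3$ is axisymmetric if it depends only on $(r(x),x_3)$. Define $Bf(x)=\int\frac{f(y)}{|x-y|}dy$. For axisymmetric $\rho$, $m_\rho(r)=\int_{\{r(x)<r\}}\rho(x)\,dx$ is the mass in the cylinder of radius $r$ about the $x_3$-axis. For a pressure function $p$, $A(\rho)=\rho\int_0^\rho\frac{p(s)}{s^2}ds$. $L$ is the (prescribed) square of the angular momentum per unit mass. For $M>0$, $$W_M=\Big\{\rho:\mathbb R^3\to\mathbb R:\ \rho\text{ axisymmetric},\ \rho\ge0\text{ a.e.},\ \int\rho\,dx=M,\ \int\Big(A(\rho(x))+\frac{\rho(x)L(m_\rho(r(x)))}{r(x)^2}+\rho(x)B\rho(x)\Big)dx<+\infty\Big\},$$ and the energy functional is $$F(\rho)=\int\Big[A(\rho(x))+\frac12\frac{\rho(x)L(m_\rho(r(x)))}{r(x)^2}-\frac12\rho(x)B\rho(x)\Big]dx,\qquad \rho\in W_M.$$ A minimizing sequence is a sequence $\{\rho^i\}\subset W_M$ with $F(\rho^i)\to\inf_{W_M}F$. *)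

theory Defs
  imports "HOL-Analysis.Analysis"
begin

definition cyl_radius :: "real^3 \<Rightarrow> real" where
  "cyl_radius x = sqrt ((x$1)\<^sup>2 + (x$2)\<^sup>2)"

definition axisymmetric :: "(real^3 \<Rightarrow> real) \<Rightarrow> bool" where
  "axisymmetric f \<longleftrightarrow> (\<exists>g. \<forall>x. f x = g (cyl_radius x) (x$3))"

text \<open>For integrable \<open>f\<close> the integral below converges absolutely for almost every \<open>x\<close>, so the
  value 0 that the Bochner integral takes at the remaining points never matters under an
  integral sign.\<close>

definition potential :: "(real^3 \<Rightarrow> real) \<Rightarrow> real^3 \<Rightarrow> real" where
  "potential f x = (LINT y|lebesgue. f y / norm (x - y))"

definition cyl_mass :: "(real^3 \<Rightarrow> real) \<Rightarrow> real \<Rightarrow> real" where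
  "cyl_mass \<rho> r = (LINT x:{x. cyl_radius x < r}|lebesgue. \<rho> x)"

text \<open>The internal energy density \<open>A\<close>.\<close>

definition internal_energy :: "(real \<Rightarrow> real) \<Rightarrow> real \<Rightarrow> real" where
  "internal_energy p \<rho> = \<rho> * (LINT s:{0..\<rho>}|lebesgue. p s / s\<^sup>2)"

definition rotation_density ::
    "(real \<Rightarrow> real) \<Rightarrow> (real^3 \<Rightarrow> real) \<Rightarrow> real^3 \<Rightarrow> real" where
  "rotation_density L \<rho> x = \<rho> x * L (cyl_mass \<rho> (cyl_radius x)) / (cyl_radius x)\<^sup>2"

text \<open>The admissible class \<open>W\<^sub>M\<close>. The integrand in the last condition is nonnegative almost
  everywhere (for \<open>p\<close>, \<open>L\<close> nonnegative), so finiteness of its integral is integrability.\<close>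

definition admissible ::
    "(real \<Rightarrow> real) \<Rightarrow> (real \<Rightarrow> real) \<Rightarrow> real \<Rightarrow> (real^3 \<Rightarrow> real) set" where
  "admissible p L M = {\<rho>. axisymmetric \<rho> \<and> (AE x in lebesgue. 0 \<le> \<rho> x) \<and>
     integrable lebesgue \<rho> \<and> (LINT x|lebesgue. \<rho> x) = M \<and>
     integrable lebesgue
       (\<lambda>x. internal_energy p (\<rho> x) + rotation_density L \<rho> x + \<rho> x * potential \<rho> x)}"

definition energy :: "(real \<Rightarrow> real) \<Rightarrow> (real \<Rightarrow> real) \<Rightarrow> (real^3 \<Rightarrow> real) \<Rightarrow> real" where
  "energy p L \<rho> = (LINT x|lebesgue.
     internal_energy p (\<rho> x) + 1/2 * rotation_density L \<rho> x - 1/2 * (\<rho> x * potential \<rho> x))"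

text \<open>The infimum is extended real, so that no boundedness or nonemptiness is presupposed.\<close>

definition inf_energy :: "(real \<Rightarrow> real) \<Rightarrow> (real \<Rightarrow> real) \<Rightarrow> real \<Rightarrow> ereal" where
  "inf_energy p L M = (INF \<rho>\<in>admissible p L M. ereal (energy p L \<rho>))"

definition minimizing_sequence ::
    "(real \<Rightarrow> real) \<Rightarrow> (real \<Rightarrow> real) \<Rightarrow> real \<Rightarrow> (nat \<Rightarrow> real^3 \<Rightarrow> real) \<Rightarrow> bool" where
  "minimizing_sequence p L M \<rho> \<longleftrightarrow> (\<forall>i. \<rho> i \<in> admissible p L M) \<and>
     (\<lambda>i. ereal (energy p L (\<rho> i))) \<longlonglongrightarrow> inf_energy p L M"

definition energy_minimizer ::
    "(real \<Rightarrow> real) \<Rightarrow> (real \<Rightarrow> real) \<Rightarrow> real \<Rightarrow> (real^3 \<Rightarrow> real) \<Rightarrow> bool" where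
  "energy_minimizer p L M \<rho> \<longleftrightarrow> \<rho> \<in> admissible p L M \<and>
     (\<forall>\<sigma>\<in>admissible p L M. energy p L \<rho> \<le> energy p L \<sigma>)"

definition vshift :: "real \<Rightarrow> (real^3 \<Rightarrow> real) \<Rightarrow> real^3 \<Rightarrow> real" where
  "vshift a f x = f (x + a *\<^sub>R axis 3 1)"

definition in_Lp :: "real \<Rightarrow> (real^3 \<Rightarrow> 'b::euclidean_space) \<Rightarrow> bool" where
  "in_Lp q f \<longleftrightarrow> f \<in> borel_measurable lebesgue \<and> integrable lebesgue (\<lambda>x. norm (f x) powr q)"

text \<open>Weak convergence in \<open>L\<^sup>q\<close> for \<open>1 < q < \<infinity>\<close>, by pairing with the conjugate space.\<close>

definition weakly_converges_Lp ::
    "real \<Rightarrow> (nat \<Rightarrow> real^3 \<Rightarrow> real) \<Rightarrow> (real^3 \<Rightarrow> real) \<Rightarrow> bool" where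
  "weakly_converges_Lp q f g \<longleftrightarrow> (\<forall>i. in_Lp q (f i)) \<and> in_Lp q g \<and>
     (\<forall>h. in_Lp (q / (q - 1)) h \<longrightarrow>
        (\<lambda>i. LINT x|lebesgue. f i x * h x) \<longlonglongrightarrow> (LINT x|lebesgue. g x * h x))"

definition strongly_converges_L2 ::
    "(nat \<Rightarrow> real^3 \<Rightarrow> real^3) \<Rightarrow> (real^3 \<Rightarrow> real^3) \<Rightarrow> bool" where
  "strongly_converges_L2 f g \<longleftrightarrow> (\<forall>i. in_Lp 2 (f i)) \<and> in_Lp 2 g \<and>
     (\<lambda>i. LINT x|lebesgue. (norm (f i x - g x))\<^sup>2) \<longlonglongrightarrow> 0"

definition locally_integrable :: "(real^3 \<Rightarrow> 'b::euclidean_space) \<Rightarrow> bool" where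
  "locally_integrable f \<longleftrightarrow> (\<forall>K. compact K \<longrightarrow> set_integrable lebesgue K f)"

text \<open>\<open>G\<close> is the weak (distributional) gradient of \<open>u\<close>, with compactly supported \<open>C\<^sup>1\<close> test
  functions. It is unique up to null sets. Potentials of admissible densities need not be
  classically differentiable.\<close>

definition weak_gradient :: "(real^3 \<Rightarrow> real) \<Rightarrow> (real^3 \<Rightarrow> real^3) \<Rightarrow> bool" where
  "weak_gradient u G \<longleftrightarrow> locally_integrable u \<and> locally_integrable G \<and>
     (\<forall>\<phi> D. (\<forall>x. GDERIV \<phi> x :> D x) \<longrightarrow> continuous_on UNIV D \<longrightarrow>
        compact (closure {x. \<phi> x \<noteq> 0}) \<longrightarrow>
        (LINT x|lebesgue. u x *\<^sub>R D x) = - (LINT x|lebesgue. \<phi> x *\<^sub>R G x))"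

end

theory Submission
  imports Defs "HOL-Library.Diagonal_Subsequence"
begin

text \<open>A minimizing sequence has uniformly positive mutual energy, so by axial symmetry some ball of fixed
  radius centred on the axis carries a fixed amount of its mass; this fixes the vertical shifts. If the weak
  limit lost mass, cutting the densities along two distant spheres would give
  \<open>I \<ge> I (t\<^bsup>5/3\<^esup> + (1 - t)\<^bsup>5/3\<^esup>)\<close> for the infimum \<open>I < 0\<close> and some \<open>0 < t < 1\<close>, because scaling a
  density of mass \<open>t M\<close> up to mass \<open>M\<close> shows that its energy is at least \<open>t\<^bsup>5/3\<^esup> I\<close>; the hypothesis on
  \<open>L\<close> is exactly what this scaling needs. Hence the shifted sequence is tight. The weak limit is realised
  as an almost everywhere limit of iterated midpoints, which preserves axial symmetry exactly and lets
  convexity of \<open>A\<close> and Fatou's lemma give lower semicontinuity. Rotational and potential energy pass to the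
  limit by tightness, and \<open>\<integral>\<nabla>Bf \<cdot> \<nabla>Bg\<close> is a constant multiple of the mutual energy of \<open>f\<close> and \<open>g\<close>
  by homogeneity and rotation invariance, which turns convergence of mutual energies into strong
  convergence of the gradients.\<close>

section \<open>Invariance of Lebesgue measure and integrability of power kernels\<close>

text \<open>The exponent 4/3 ties the estimates together. In dimension three the square of the
  kernel 1/|x-y| is locally integrable, so an arithmetic-geometric mean inequality bounds the part
  of the mutual energy coming from pairs closer than \<delta> by sqrt \<delta> times a polynomial in
  the integrals of the 4/3 powers. Coercivity bounds the internal energy along the sequence, and
  \<gamma> \<ge> 4/3 turns that into a bound for those integrals. Every question about gravitational
  energy thereby reduces to a bounded kernel, where tightness and weak convergence suffice. The
  exponent 5/3 comes from dilations: stretching by b multiplies the mass by b^3, the mutual energy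
  by b^5, and the other energies by at most b^5 when b \<ge> 1. The class W_M asks for axial
  symmetry at every point, whereas a weak limit is determined only up to null sets; hence the effort
  spent on an explicit representative. Nonnegativity, required only almost everywhere, is handled by
  passing to positive parts.\<close>

lemma sigma_finite_lebesgue: "sigma_finite_measure (lebesgue :: 'a::euclidean_space measure)"
proof
  obtain A :: "'a set set" where A: "countable A" "A \<subseteq> sets lborel" "\<Union>A = space lborel"
    "\<forall>a\<in>A. emeasure lborel a \<noteq> \<infinity>"
    using lborel.sigma_finite_countable by blast
  then show "\<exists>A::'a set set. countable A \<and> A \<subseteq> sets lebesgue \<and> \<Union>A = space lebesgue \<and> (\<forall>a\<in>A. emeasure lebesgue a \<noteq> \<infinity>)"
    by (intro exI[of _ A]) (auto simp: subset_eq)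
qed

interpretation lebesgue: sigma_finite_measure "lebesgue :: 'a::euclidean_space measure"
  by (rule sigma_finite_lebesgue)

interpretation lebesgue2: pair_sigma_finite "lebesgue :: (real^3) measure" "lebesgue :: (real^3) measure" ..

text \<open>The product of two completions is not complete, so measurability on it is obtained by
  composing Lebesgue measurable functions with the projections, and Borel kernels with the
  difference of the projections.\<close>

abbreviation lebesgue2 :: "((real^3) \<times> (real^3)) measure" where
  "lebesgue2 \<equiv> lebesgue \<Otimes>\<^sub>M lebesgue"

lemma ident_borel_measurable_lebesgue [measurable (raw)]: "(\<lambda>x. x) \<in> borel_measurable lebesgue"
  using id_borel_measurable_lebesgue by (simp add: id_def)

lemma sets_lebesgue_ball [measurable]: "ball (a::'a::euclidean_space) r \<in> sets lebesgue"
  by simp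

lemma fst_borel_measurable_lebesgue [measurable]: "fst \<in> borel_measurable (lebesgue \<Otimes>\<^sub>M N)"
  by (rule measurable_compose[OF measurable_fst ident_borel_measurable_lebesgue])

lemma snd_borel_measurable_lebesgue [measurable]: "snd \<in> borel_measurable (N \<Otimes>\<^sub>M lebesgue)"
  by (rule measurable_compose[OF measurable_snd ident_borel_measurable_lebesgue])

lemma indicator_ball_diff_measurable [measurable]:
  "(\<lambda>z::(real^3) \<times> (real^3). indicator (ball 0 r) (fst z - snd z) :: real) \<in> borel_measurable (lebesgue \<Otimes>\<^sub>M lebesgue)"
  by (rule measurable_compose[where g = "indicator (ball 0 r)" and N = borel]) (auto intro!: borel_measurable_indicator)

lemma integrable_AE_bound:
  fixes f :: "'a \<Rightarrow> 'b::{banach, second_countable_topology}" and g :: "'a \<Rightarrow> real"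
  assumes "integrable M g" "f \<in> borel_measurable M" "AE x in M. norm (f x) \<le> g x"
  shows "integrable M f"
proof (rule Bochner_Integration.integrable_bound[OF assms(1,2)])
  show "AE x in M. norm (f x) \<le> norm (g x)"
    using assms(3) by eventually_elim (simp add: order_trans[OF _ abs_ge_self])
qed

lemma translation_lebesgue_eq: "(\<lambda>x::'a::euclidean_space. a + (\<Sum>j\<in>Basis. (c * (x \<bullet> j)) *\<^sub>R j)) = (\<lambda>x. c *\<^sub>R x + a)"
  unfolding scaleR_scaleR[symmetric] scaleR_sum_right[symmetric]
  by (auto simp add: euclidean_representation ac_simps)

text \<open>Densities are merely Lebesgue measurable, so composing them with a dilation or
  translation requires a map that is measurable from the completion to the completion.\<close>

lemma affine_measurable_lebesgue:
  fixes a :: "'a::euclidean_space"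
  assumes "c \<noteq> 0"
  shows "(\<lambda>x. c *\<^sub>R x + a) \<in> lebesgue \<rightarrow>\<^sub>M lebesgue"
  using lebesgue_affine_measurable[of "\<lambda>_. c" a] assms by (simp add: translation_lebesgue_eq)

lemma integral_lebesgue_affine:
  fixes f :: "real^3 \<Rightarrow> 'b::{banach, second_countable_topology}"
  assumes "c > 0" and [measurable]: "f \<in> borel_measurable lebesgue"
  shows "integrable lebesgue (\<lambda>x. f (c *\<^sub>R x + a)) \<longleftrightarrow> integrable lebesgue f"
    and "(LINT x|lebesgue. f (c *\<^sub>R x + a)) = (LINT x|lebesgue. f x) /\<^sub>R c ^ 3"
proof -
  have m[measurable]: "(\<lambda>x::real^3. c *\<^sub>R x + a) \<in> lebesgue \<rightarrow>\<^sub>M lebesgue"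
    by (rule affine_measurable_lebesgue) (use assms(1) in auto)
  have prod: "(\<Prod>j\<in>(Basis::(real^3) set). ennreal \<bar>c\<bar>) = ennreal (c ^ 3)"
    using assms(1) by (simp add: ennreal_power)
  have eq: "lebesgue = density (distr lebesgue lebesgue (\<lambda>x::real^3. c *\<^sub>R x + a)) (\<lambda>_. ennreal (c ^ 3))"
    using lebesgue_affine_euclidean[of "\<lambda>_. c" a] assms(1)
    unfolding translation_lebesgue_eq prod_ennreal[OF abs_ge_zero] prod by simp
  have "integrable lebesgue f \<longleftrightarrow> integrable (distr lebesgue lebesgue (\<lambda>x::real^3. c *\<^sub>R x + a)) (\<lambda>x. (c ^ 3) *\<^sub>R f x)"
    by (subst eq, subst integrable_density) (use assms in auto)
  also have "\<dots> \<longleftrightarrow> integrable lebesgue (\<lambda>x. (c ^ 3) *\<^sub>R f (c *\<^sub>R x + a))"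
    by (subst integrable_distr_eq) auto
  also have "\<dots> \<longleftrightarrow> integrable lebesgue (\<lambda>x. f (c *\<^sub>R x + a))"
    using assms(1) integrable_scaleR_right[of "inverse (c ^ 3)" lebesgue "\<lambda>x. (c ^ 3) *\<^sub>R f (c *\<^sub>R x + a)"]
    by auto
  finally show "integrable lebesgue (\<lambda>x. f (c *\<^sub>R x + a)) \<longleftrightarrow> integrable lebesgue f" by simp
  have "(LINT x|lebesgue. f x) = (LINT x|distr lebesgue lebesgue (\<lambda>x::real^3. c *\<^sub>R x + a). (c ^ 3) *\<^sub>R f x)"
    by (subst eq, subst integral_density) (use assms in auto)
  also have "\<dots> = (c ^ 3) *\<^sub>R (LINT x|lebesgue. f (c *\<^sub>R x + a))"
    using assms by (subst integral_distr) auto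
  finally show "(LINT x|lebesgue. f (c *\<^sub>R x + a)) = (LINT x|lebesgue. f x) /\<^sub>R c ^ 3"
    using assms by simp
qed

lemmas integral_lebesgue_translation = integral_lebesgue_affine[where c = 1, simplified]

lemma translation_measurable_lebesgue [measurable]: "(\<lambda>x::'a::euclidean_space. x + a) \<in> lebesgue \<rightarrow>\<^sub>M lebesgue"
  using affine_measurable_lebesgue[of 1 a] by simp

text \<open>Similarities pull null sets back to null sets; this carries almost everywhere equality
  of two densities over to their shifts.\<close>

lemma AE_lebesgue_affine:
  fixes P :: "real^3 \<Rightarrow> bool"
  assumes "c \<noteq> 0" "AE x in lebesgue. P x"
  shows "AE x in lebesgue. P (c *\<^sub>R x + a)"
proof -
  have m[measurable]: "(\<lambda>x::real^3. c *\<^sub>R x + a) \<in> lebesgue \<rightarrow>\<^sub>M lebesgue"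
    by (rule affine_measurable_lebesgue) (use assms(1) in auto)
  have prod: "(\<Prod>j\<in>(Basis::(real^3) set). ennreal \<bar>c\<bar>) = ennreal (\<bar>c\<bar> ^ 3)"
    using assms(1) by (simp add: ennreal_power)
  have eq: "lebesgue = density (distr lebesgue lebesgue (\<lambda>x::real^3. c *\<^sub>R x + a)) (\<lambda>_. ennreal (\<bar>c\<bar> ^ 3))"
    using lebesgue_affine_euclidean[of "\<lambda>_. c" a] assms(1)
    unfolding translation_lebesgue_eq prod_ennreal[OF abs_ge_zero] prod by simp
  obtain N where N: "N \<in> null_sets lebesgue" "{x. \<not> P x} \<subseteq> N"
    using assms(2) unfolding eventually_ae_filter by auto
  have "AE x in density (distr lebesgue lebesgue (\<lambda>x::real^3. c *\<^sub>R x + a)) (\<lambda>_. ennreal (\<bar>c\<bar> ^ 3)). x \<notin> N"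
    using N(1) eq by (metis AE_not_in)
  then have "AE x in distr lebesgue lebesgue (\<lambda>x::real^3. c *\<^sub>R x + a). x \<notin> N"
    using assms(1) by (subst (asm) AE_density) (auto simp: ennreal_eq_0_iff)
  then have "AE x in lebesgue. c *\<^sub>R x + a \<notin> N"
    by (rule AE_distrD[OF m])
  then show ?thesis by eventually_elim (use N in auto)
qed

text \<open>Preimages under \<open>T\<close> are images under its inverse. Invariance of the measure
  of such images is applied to sets of finite measure, and exhaustion by the balls
  \<open>ball 0 n\<close> carries it to every Lebesgue set.\<close>

lemma orthogonal_measurable_lebesgue:
  fixes T :: "real^3 \<Rightarrow> real^3"
  assumes "orthogonal_transformation T"
  shows "T \<in> lebesgue \<rightarrow>\<^sub>M lebesgue" "distr lebesgue lebesgue T = lebesgue"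
proof -
  define S where "S = inv T"
  have S: "orthogonal_transformation S" "S \<circ> T = id" "T \<circ> S = id"
    using assms orthogonal_transformation_inv[OF assms] orthogonal_transformation_inj[OF assms]
      orthogonal_transformation_surj[OF assms] by (auto simp: S_def fun_eq_iff surj_f_inv_f)
  have ST: "S (T x) = x" "T (S x) = x" for x
    using S(2,3) by (metis comp_apply id_apply)+
  have vim: "T -` A = S ` A" for A
    using ST bij_vimage_eq_inv_image[OF orthogonal_transformation_bij[OF assms]] by (simp add: S_def)
  have mball: "T -` (B \<inter> ball 0 n) \<in> lmeasurable \<and> measure lebesgue (T -` (B \<inter> ball 0 n)) = measure lebesgue (B \<inter> ball 0 n)"
    if "B \<in> sets lebesgue" for B n
  proof -
    have "ball 0 n \<inter> B \<in> lmeasurable"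
      using that by (intro fmeasurable_Int_fmeasurable) auto
    then have "B \<inter> ball 0 n \<in> lmeasurable" by (simp add: Int_commute)
    then show ?thesis using measurable_orthogonal_image[OF S(1)] measure_orthogonal_image[OF S(1)] unfolding vim by blast
  qed
  have un: "(\<Union>n::nat. B \<inter> ball 0 (real n)) = B" for B :: "(real^3) set"
    by (auto simp: reals_Archimedean2)
  have sets: "T -` B \<in> sets lebesgue" if "B \<in> sets lebesgue" for B
  proof -
    have "(\<Union>n::nat. T -` (B \<inter> ball 0 (real n))) \<in> sets lebesgue"
      using mball[OF that] by (intro sets.countable_UN) (auto simp: fmeasurable_def)
    also have "(\<Union>n::nat. T -` (B \<inter> ball 0 (real n))) = T -` B" using un[of B] by blast
    finally show ?thesis .
  qed
  show m: "T \<in> lebesgue \<rightarrow>\<^sub>M lebesgue"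
    by (rule measurableI) (use sets in auto)
  show "distr lebesgue lebesgue T = lebesgue"
  proof (rule measure_eqI)
    fix B assume "B \<in> sets (distr lebesgue lebesgue T)"
    then have B: "B \<in> sets lebesgue" by simp
    have inc: "incseq (\<lambda>n. T -` (B \<inter> ball 0 (real n)))" "incseq (\<lambda>n. B \<inter> ball 0 (real n))"
      by (auto simp: incseq_def)
    have e: "emeasure lebesgue (T -` (B \<inter> ball 0 (real n))) = emeasure lebesgue (B \<inter> ball 0 (real n))" for n
    proof -
      have "ball 0 (real n) \<inter> B \<in> lmeasurable" using B by (intro fmeasurable_Int_fmeasurable) auto
      then show ?thesis using mball[OF B, of "real n"] by (simp add: Int_commute emeasure_eq_measure2)
    qed
    have "emeasure lebesgue (T -` B) = emeasure lebesgue (\<Union>n. T -` (B \<inter> ball 0 (real n)))"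
      using arg_cong[OF un[of B], of "\<lambda>X. emeasure lebesgue (T -` X)"] by (simp only: vimage_UN)
    also have "\<dots> = (SUP n. emeasure lebesgue (T -` (B \<inter> ball 0 (real n))))"
      using mball[OF B] inc by (intro SUP_emeasure_incseq[symmetric]) (auto simp: fmeasurable_def)
    also have "\<dots> = (SUP n. emeasure lebesgue (B \<inter> ball 0 (real n)))" using e by simp
    also have "\<dots> = emeasure lebesgue (\<Union>n. B \<inter> ball 0 (real n))"
      using B inc by (intro SUP_emeasure_incseq) auto
    finally have "emeasure lebesgue (T -` B) = emeasure lebesgue B" using un by simp
    then show "emeasure (distr lebesgue lebesgue T) B = emeasure lebesgue B"
      using B m by (simp add: emeasure_distr)
  qed auto
qed

lemma integral_lebesgue_orthogonal:
  fixes T :: "real^3 \<Rightarrow> real^3" and f :: "real^3 \<Rightarrow> 'b::{banach, second_countable_topology}"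
  assumes "orthogonal_transformation T" and [measurable]: "f \<in> borel_measurable lebesgue"
  shows "integrable lebesgue (\<lambda>x. f (T x)) \<longleftrightarrow> integrable lebesgue f"
    and "(LINT x|lebesgue. f (T x)) = (LINT x|lebesgue. f x)"
proof -
  note T = orthogonal_measurable_lebesgue[OF assms(1)]
  show "integrable lebesgue (\<lambda>x. f (T x)) \<longleftrightarrow> integrable lebesgue f"
    using integrable_distr_eq[OF T(1) assms(2)] T(2) by simp
  show "(LINT x|lebesgue. f (T x)) = (LINT x|lebesgue. f x)"
    using integral_distr[OF T(1) assms(2)] T(2) by simp
qed

text \<open>Stands in for polar coordinates: \<open>f\<close> lies below a series of constants
  \<open>a k\<close> on balls of radius \<open>r k\<close>, and the volume of each ball is a
  constant times \<open>r k ^ 3\<close>.\<close>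

lemma nn_integral_dyadic_bound:
  fixes f :: "real^3 \<Rightarrow> real"
  assumes f: "\<And>x. f x \<noteq> 0 \<Longrightarrow> \<exists>k. norm x < r k \<and> f x \<le> a k"
    and nn: "\<And>k. 0 \<le> a k" "\<And>k. 0 \<le> r k"
    and s: "summable (\<lambda>k. a k * r k ^ 3)"
  shows "(\<integral>\<^sup>+x. ennreal (f x) \<partial>lebesgue) < \<infinity>"
proof -
  let ?v = "unit_ball_vol 3"
  have e: "emeasure lebesgue (ball (0::real^3) (r k)) = ennreal (?v * r k ^ 3)" for k
    using emeasure_ball[of "r k" "0::real^3"] nn by simp
  have "(\<integral>\<^sup>+x. ennreal (f x) \<partial>lebesgue) \<le> (\<integral>\<^sup>+x. (\<Sum>k. ennreal (a k) * indicator (ball (0::real^3) (r k)) x) \<partial>lebesgue)"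
  proof (rule nn_integral_mono)
    fix x :: "real^3"
    show "ennreal (f x) \<le> (\<Sum>k. ennreal (a k) * indicator (ball 0 (r k)) x)"
    proof (cases "f x = 0")
      case False
      then obtain k where k: "norm x < r k" "f x \<le> a k" using f by blast
      have "ennreal (f x) \<le> (\<Sum>j\<in>{k}. ennreal (a j) * indicator (ball 0 (r j)) x)"
        using k by (auto simp: ennreal_leI)
      also have "\<dots> \<le> (\<Sum>k. ennreal (a k) * indicator (ball 0 (r k)) x)"
        by (intro sum_le_suminf) auto
      finally show ?thesis .
    qed simp
  qed
  also have "\<dots> = (\<Sum>k. \<integral>\<^sup>+x. ennreal (a k) * indicator (ball (0::real^3) (r k)) x \<partial>lebesgue)"
    by (rule nn_integral_suminf) measurable
  also have "\<dots> = (\<Sum>k. ennreal (?v * (a k * r k ^ 3)))"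
    by (intro suminf_cong) (use nn e in \<open>auto simp: nn_integral_cmult ennreal_mult[symmetric] ac_simps\<close>)
  also have "\<dots> = ennreal (\<Sum>k. ?v * (a k * r k ^ 3))"
    by (rule suminf_ennreal2) (use nn s in \<open>auto intro!: summable_mult\<close>)
  also have "\<dots> < \<infinity>" by simp
  finally show ?thesis .
qed

lemma integrable_inverse_square_ball:
  "integrable lebesgue (\<lambda>x::real^3. indicator (ball 0 1) x / (norm x)\<^sup>2)"
proof (rule integrableI_nonneg)
  show "(\<lambda>x::real^3. indicator (ball 0 1) x / (norm x)\<^sup>2) \<in> borel_measurable lebesgue" by measurable
  show "(\<integral>\<^sup>+x. ennreal (indicator (ball 0 1) (x::real^3) / (norm x)\<^sup>2) \<partial>lebesgue) < \<infinity>"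
  \<comment> \<open>On the shell 2^-(k+1) \<le> |x| < 2^-k the kernel is at most 4^(k+1), and
    4^(k+1) 8^-k is geometric with ratio 1/2.\<close>
  proof (rule nn_integral_dyadic_bound[where a = "\<lambda>k. 4 ^ Suc k" and r = "\<lambda>k. (1/2) ^ k"])
    fix x :: "real^3"
    assume "indicator (ball 0 1) x / (norm x)\<^sup>2 \<noteq> (0::real)"
    then have x: "norm x < 1" "x \<noteq> 0" by (auto split: split_indicator_asm simp: indicator_def)
    define k where "k = (LEAST k. (1/2) ^ Suc k \<le> norm x)"
    obtain n where n: "(1/2) ^ n < norm x" using real_arch_pow_inv[of "norm x" "1/2"] x by auto
    have "(1/2::real) ^ Suc n \<le> (1/2) ^ n" by (rule power_decreasing) auto
    then have "(1/2) ^ Suc n \<le> norm x" using n by linarith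
    then have k1: "(1/2) ^ Suc k \<le> norm x" unfolding k_def by (rule LeastI)
    have k2: "norm x < (1/2) ^ k"
    proof (cases k)
      case (Suc j)
      then have "\<not> (1/2) ^ Suc j \<le> norm x"
        using not_less_Least[of j "\<lambda>k. (1/2) ^ Suc k \<le> norm x"] unfolding k_def[symmetric] by simp
      then show ?thesis using Suc by simp
    qed (use x in simp)
    have "((1/2) ^ Suc k)\<^sup>2 \<le> (norm x)\<^sup>2" using k1 by (intro power_mono) auto
    then have "1 / (norm x)\<^sup>2 \<le> 1 / ((1/2) ^ Suc k)\<^sup>2" using x by (intro divide_left_mono) auto
    also have "1 / ((1/2) ^ n)\<^sup>2 = (4::real) ^ n" for n
      by (induction n) (auto simp: power_mult_distrib power2_eq_square)
    finally show "\<exists>k. norm x < (1 / 2) ^ k \<and> indicator (ball 0 1) x / (norm x)\<^sup>2 \<le> (4::real) ^ Suc k"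
      using k2 x by (intro exI[of _ k]) auto
  next
    have "(\<lambda>k. 4 ^ Suc k * ((1 / 2) ^ k) ^ 3) = (\<lambda>k. 4 * (1/2::real) ^ k)"
    proof
      fix k show "4 ^ Suc k * ((1 / 2) ^ k) ^ 3 = 4 * (1/2::real) ^ k"
        by (induction k) (auto simp: power_mult_distrib power_divide field_simps)
    qed
    then show "summable (\<lambda>k. 4 ^ Suc k * ((1 / 2::real) ^ k) ^ 3)" by (simp add: summable_mult)
  qed auto
qed auto

lemma integrable_inverse_fourth_exterior:
  "integrable lebesgue (\<lambda>x::real^3. indicator (- ball 0 1) x / (norm x) ^ 4)"
proof (rule integrableI_nonneg)
  show "(\<lambda>x::real^3. indicator (- ball 0 1) x / (norm x) ^ 4) \<in> borel_measurable lebesgue" by measurable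
  show "(\<integral>\<^sup>+x. ennreal (indicator (- ball 0 1) (x::real^3) / (norm x) ^ 4) \<partial>lebesgue) < \<infinity>"
  \<comment> \<open>The shells are now 2^k \<le> |x| < 2^(k+1), with the bound 16^-k against volumes
    of order 8^k; the ratio is again 1/2.\<close>
  proof (rule nn_integral_dyadic_bound[where a = "\<lambda>k. (1/16) ^ k" and r = "\<lambda>k. 2 ^ Suc k"])
    fix x :: "real^3"
    assume "indicator (- ball 0 1) x / (norm x) ^ 4 \<noteq> (0::real)"
    then have x: "norm x \<ge> 1" by (auto split: split_indicator_asm simp: indicator_def)
    define k where "k = (LEAST k. norm x < 2 ^ Suc k)"
    obtain n where "norm x < 2 ^ n" using real_arch_pow[of 2 "norm x"] by auto
    also have "(2::real) ^ n \<le> 2 ^ Suc n" by simp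
    finally have k1: "norm x < 2 ^ Suc k" unfolding k_def by (rule LeastI)
    have k2: "2 ^ k \<le> norm x"
    proof (cases k)
      case (Suc j)
      then have "\<not> norm x < 2 ^ Suc j"
        using not_less_Least[of j "\<lambda>k. norm x < 2 ^ Suc k"] unfolding k_def[symmetric] by simp
      then show ?thesis using Suc by simp
    qed (use x in simp)
    have "(2 ^ k) ^ 4 \<le> (norm x) ^ 4" using k2 by (intro power_mono) auto
    then have "1 / (norm x) ^ 4 \<le> 1 / (2 ^ k) ^ 4" using x by (intro divide_left_mono) (auto simp: zero_less_mult_iff)
    also have "1 / (2 ^ n) ^ 4 = (1/16::real) ^ n" for n
      by (induction n) (auto simp: power_mult_distrib)
    finally show "\<exists>k. norm x < 2 ^ Suc k \<and> indicator (- ball 0 1) x / (norm x) ^ 4 \<le> (1/16::real) ^ k"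
      using k1 x by (intro exI[of _ k]) auto
  next
    have "(\<lambda>k. (1/16) ^ k * (2 ^ Suc k) ^ 3) = (\<lambda>k. 8 * (1/2::real) ^ k)"
    proof
      fix k show "(1/16) ^ k * (2 ^ Suc k) ^ 3 = 8 * (1/2::real) ^ k"
        by (induction k) (auto simp: power_mult_distrib power_divide field_simps)
    qed
    then show "summable (\<lambda>k. (1/16::real) ^ k * (2 ^ Suc k) ^ 3)" by (simp add: summable_mult)
  qed auto
qed auto

text \<open>In polar coordinates the value is 4 pi.\<close>

definition near_const :: real where
  "near_const = (LINT x|lebesgue. indicator (ball 0 1) (x::real^3) / (norm x)\<^sup>2)"

lemma near_const_nonneg: "0 \<le> near_const"
  unfolding near_const_def by (intro integral_nonneg_AE) auto

text \<open>Dilating by \<delta> multiplies the volume by \<delta>^3 and the kernel by \<delta>^-2.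
  The remaining power of \<delta> is the source of all smallness of near interactions.\<close>

lemma inverse_square_near:
  assumes "\<delta> > 0"
  shows "integrable lebesgue (\<lambda>x::real^3. indicator (ball 0 \<delta>) (x - y) / (norm (x - y))\<^sup>2)"
    and "(LINT x|lebesgue. indicator (ball 0 \<delta>) (x - y) / (norm (x - y :: real^3))\<^sup>2) = near_const * \<delta>"
proof -
  let ?f = "\<lambda>x::real^3. indicator (ball 0 1) x / (norm x)\<^sup>2 :: real"
  have f[measurable]: "?f \<in> borel_measurable lebesgue" by measurable
  have eq: "indicator (ball 0 \<delta>) (x - y) / (norm (x - y))\<^sup>2 = (1/\<delta>\<^sup>2) *\<^sub>R ?f ((1/\<delta>) *\<^sub>R x + (- (1/\<delta>) *\<^sub>R y))" for x
  proof -
    have "(1/\<delta>) *\<^sub>R x + (- (1/\<delta>) *\<^sub>R y) = (1/\<delta>) *\<^sub>R (x - y)" by (simp add: scaleR_diff_right)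
    moreover have "norm ((1/\<delta>) *\<^sub>R (x - y)) = norm (x - y) / \<delta>" using assms by simp
    ultimately show ?thesis using assms
      by (simp only: indicator_def mem_ball dist_0_norm) (auto simp: field_simps power2_eq_square)
  qed
  have "integrable lebesgue (\<lambda>x. ?f ((1/\<delta>) *\<^sub>R x + (- (1/\<delta>) *\<^sub>R y)))"
    using integral_lebesgue_affine(1)[of "1/\<delta>" ?f "- (1/\<delta>) *\<^sub>R y"] assms integrable_inverse_square_ball by (simp only: f zero_less_divide_1_iff)
  then show "integrable lebesgue (\<lambda>x::real^3. indicator (ball 0 \<delta>) (x - y) / (norm (x - y))\<^sup>2)"
    unfolding eq by (rule integrable_scaleR_right)
  have "(LINT x|lebesgue. indicator (ball 0 \<delta>) (x - y) / (norm (x - y))\<^sup>2) =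
      (1/\<delta>\<^sup>2) *\<^sub>R (near_const /\<^sub>R (1/\<delta>) ^ 3)"
    unfolding eq near_const_def using assms
    by (subst integral_scaleR_right, subst integral_lebesgue_affine(2)) simp_all
  also have "\<dots> = near_const * \<delta>"
    using assms by (simp add: field_simps power2_eq_square power3_eq_cube)
  finally show "(LINT x|lebesgue. indicator (ball 0 \<delta>) (x - y) / (norm (x - y :: real^3))\<^sup>2) = near_const * \<delta>" .
qed

section \<open>Mutual energy of two densities\<close>

text \<open>The space is chosen for the gravitational energy: L^1 controls distant pairs, L^(4/3)
  close ones. Nonnegativity is demanded at every point so that pointwise comparisons need no
  exceptional sets.\<close>

definition star_density :: "(real^3 \<Rightarrow> real) \<Rightarrow> bool" where
  "star_density f \<longleftrightarrow> f \<in> borel_measurable lebesgue \<and> (\<forall>x. 0 \<le> f x) \<and>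
     integrable lebesgue f \<and> integrable lebesgue (\<lambda>x. f x powr (4/3))"

definition mutual_energy :: "(real^3 \<Rightarrow> real) \<Rightarrow> (real^3 \<Rightarrow> real) \<Rightarrow> real" where
  "mutual_energy f g = (LINT z|lebesgue2. f (fst z) * g (snd z) / norm (fst z - snd z))"

abbreviation "L43 f \<equiv> (LINT x|lebesgue. (f :: real^3 \<Rightarrow> real) x powr (4/3))"

text \<open>A crude majorant whose point is the factor \<open>sqrt \<delta>\<close>: on families
  with bounded 4/3 integrals, close pairs become uniformly negligible.\<close>

definition near_bound :: "real \<Rightarrow> (real^3 \<Rightarrow> real) \<Rightarrow> (real^3 \<Rightarrow> real) \<Rightarrow> real" where
  "near_bound \<delta> f g = sqrt \<delta> * (1 + near_const) * (L43 f * L43 g + L43 f + L43 g)"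

lemma star_densityD:
  assumes "star_density f"
  shows "f \<in> borel_measurable lebesgue" "0 \<le> f x" "integrable lebesgue f"
    "integrable lebesgue (\<lambda>x. f x powr (4/3))"
  using assms by (auto simp: star_density_def)

lemma star_density_le:
  assumes "star_density g" "f \<in> borel_measurable lebesgue" "\<And>x. 0 \<le> f x" "\<And>x. f x \<le> g x"
  shows "star_density f"
  unfolding star_density_def
proof (intro conjI allI)
  show "integrable lebesgue f"
    by (rule Bochner_Integration.integrable_bound[OF star_densityD(3)[OF assms(1)]])
      (use assms in \<open>auto intro!: AE_I2 order_trans[OF _ abs_ge_self]\<close>)
  show "integrable lebesgue (\<lambda>x. f x powr (4/3))"
    by (rule Bochner_Integration.integrable_bound[OF star_densityD(4)[OF assms(1)]])
      (use assms in \<open>auto intro!: powr_mono2\<close>)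
qed (use assms in auto)

text \<open>Stated for inner products because it serves twice: for products of real densities, and
  for writing the product of two gravity integrals as one double integral.\<close>

lemma integrable_inner_prod:
  fixes f g :: "real^3 \<Rightarrow> 'a::euclidean_space"
  assumes f: "integrable lebesgue f" and g: "integrable lebesgue g"
  shows "integrable lebesgue2 (\<lambda>z. f (fst z) \<bullet> g (snd z))"
    and "(LINT z|lebesgue2. f (fst z) \<bullet> g (snd z)) = (LINT x|lebesgue. f x) \<bullet> (LINT x|lebesgue. g x)"
proof -
  have [measurable]: "f \<in> borel_measurable lebesgue" "g \<in> borel_measurable lebesgue"
    using f g by auto
  have "integrable lebesgue (\<lambda>x. LINT y|lebesgue. norm (f x \<bullet> g y))"
  proof (rule Bochner_Integration.integrable_bound)
    show "integrable lebesgue (\<lambda>x. norm (f x) * (LINT y|lebesgue. norm (g y)))"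
      using f by auto
    show "AE x in lebesgue. norm (LINT y|lebesgue. norm (f x \<bullet> g y)) \<le> norm (norm (f x) * (LINT y|lebesgue. norm (g y)))"
    proof (rule AE_I2)
      fix x
      have "(LINT y|lebesgue. norm (f x \<bullet> g y)) \<le> (LINT y|lebesgue. norm (f x) * norm (g y))"
        by (rule integral_mono) (use g in \<open>auto simp: Cauchy_Schwarz_ineq2\<close>)
      then show "norm (LINT y|lebesgue. norm (f x \<bullet> g y)) \<le> norm (norm (f x) * (LINT y|lebesgue. norm (g y)))"
        by (simp add: abs_mult)
    qed
  qed measurable
  then show i: "integrable lebesgue2 (\<lambda>z. f (fst z) \<bullet> g (snd z))"
    by (intro lebesgue2.Fubini_integrable) (use g in auto)
  show "(LINT z|lebesgue2. f (fst z) \<bullet> g (snd z)) = (LINT x|lebesgue. f x) \<bullet> (LINT x|lebesgue. g x)"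
    using lebesgue2.integral_fst'[OF i] f g by simp
qed

lemmas integrable_mult_prod = integrable_inner_prod[where 'a = real, unfolded inner_real_def]

lemma integrable_near_prod:
  fixes f :: "real^3 \<Rightarrow> real"
  assumes f: "integrable lebesgue f" and "\<delta> > 0"
  shows "integrable lebesgue2 (\<lambda>z. f (fst z) * (indicator (ball 0 \<delta>) (fst z - snd z) / (norm (fst z - snd z))\<^sup>2))"
    and "(LINT z|lebesgue2. f (fst z) * (indicator (ball 0 \<delta>) (fst z - snd z) / (norm (fst z - snd z))\<^sup>2)) =
      near_const * \<delta> * (LINT x|lebesgue. f x)"
    and "integrable lebesgue2 (\<lambda>z. f (snd z) * (indicator (ball 0 \<delta>) (fst z - snd z) / (norm (fst z - snd z))\<^sup>2))"
    and "(LINT z|lebesgue2. f (snd z) * (indicator (ball 0 \<delta>) (fst z - snd z) / (norm (fst z - snd z))\<^sup>2)) =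
      near_const * \<delta> * (LINT x|lebesgue. f x)"
proof -
  have [measurable]: "f \<in> borel_measurable lebesgue" using f by auto
  let ?k = "\<lambda>w::real^3. indicator (ball 0 \<delta>) w / (norm w)\<^sup>2 :: real"
  have sym: "?k (x - y) = ?k (y - x)" for x y
    by (simp add: indicator_def norm_minus_commute)
  have k: "integrable lebesgue (\<lambda>y. ?k (x - y))" "(LINT y|lebesgue. ?k (x - y)) = near_const * \<delta>" for x
    using inverse_square_near[OF assms(2), of x] by (simp_all add: sym[of x])
  have kn: "norm (?k w) = ?k w" for w by simp
  have m: "(\<lambda>z. f (fst z) * ?k (fst z - snd z)) \<in> borel_measurable lebesgue2"
    by measurable
  have "integrable lebesgue (\<lambda>x. LINT y|lebesgue. norm (f x * ?k (x - y)))"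
    using f by (simp only: norm_mult kn integral_mult_right_zero k) auto
  then show i: "integrable lebesgue2 (\<lambda>z. f (fst z) * ?k (fst z - snd z))"
    by (intro lebesgue2.Fubini_integrable[OF m])
      (use k in \<open>auto simp flip: times_divide_eq_right intro!: AE_I2 integrable_mult_right\<close>)
  show e: "(LINT z|lebesgue2. f (fst z) * ?k (fst z - snd z)) = near_const * \<delta> * (LINT x|lebesgue. f x)"
    using lebesgue2.integral_fst'[OF i] by (simp only: fst_conv snd_conv integral_mult_right_zero k integral_mult_left_zero mult.commute)
  show "integrable lebesgue2 (\<lambda>z. f (snd z) * ?k (fst z - snd z))"
    using lebesgue2.integrable_product_swap[OF i] by (simp add: case_prod_unfold sym)
  have "(LINT z|lebesgue2. f (snd z) * ?k (fst z - snd z)) = (LINT z|lebesgue2. f (fst z) * ?k (fst z - snd z))"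
    using lebesgue2.integral_product_swap[OF borel_measurable_integrable[OF i]] by (simp add: case_prod_unfold sym)
  then show "(LINT z|lebesgue2. f (snd z) * ?k (fst z - snd z)) = near_const * \<delta> * (LINT x|lebesgue. f x)"
    using e by simp
qed

text \<open>With \<open>a = u\<^sup>3\<close>, \<open>b = v\<^sup>3\<close> this is \<open>2 X Y \<le> l X\<^sup>2 + Y\<^sup>2 / l\<close> for \<open>X = u\<^sup>2 v\<^sup>2\<close>, \<open>Y = u v k\<close>.\<close>

lemma four_thirds_amgm:
  fixes a b k l :: real
  assumes "0 \<le> a" "0 \<le> b" "0 < l"
  shows "a * b * k \<le> l / 2 * (a powr (4/3) * b powr (4/3)) + (a powr (4/3) + b powr (4/3)) * k\<^sup>2 / (4 * l)"
proof -
  define u v where uv: "u = a powr (1/3)" "v = b powr (1/3)"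
  have cube: "a = u ^ 3" "b = v ^ 3"
    using assms by (auto simp: uv powr_powr simp flip: powr_realpow' powr_numeral)
  have four: "a powr (4/3) = u ^ 4" "b powr (4/3) = v ^ 4"
    using assms by (auto simp: uv powr_powr simp flip: powr_realpow' powr_numeral)
  have "0 \<le> (l * (u\<^sup>2 * v\<^sup>2) - u * v * k)\<^sup>2 / l" using assms by simp
  also have "\<dots> = l * (u ^ 4 * v ^ 4) - 2 * (u ^ 3 * v ^ 3 * k) + (u\<^sup>2 * v\<^sup>2) * k\<^sup>2 / l"
    using assms by (simp add: power2_eq_square field_simps eval_nat_numeral)
  finally have 1: "u ^ 3 * v ^ 3 * k \<le> l / 2 * (u ^ 4 * v ^ 4) + (u\<^sup>2 * v\<^sup>2) * k\<^sup>2 / (2 * l)"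
    by (simp add: field_simps)
  have "0 \<le> (u\<^sup>2 - v\<^sup>2)\<^sup>2" by simp
  also have "\<dots> = u ^ 4 + v ^ 4 - 2 * (u\<^sup>2 * v\<^sup>2)"
    by (simp add: power2_eq_square field_simps eval_nat_numeral)
  finally have "2 * (u\<^sup>2 * v\<^sup>2) \<le> u ^ 4 + v ^ 4" by simp
  then have "2 * (u\<^sup>2 * v\<^sup>2) * (k\<^sup>2 / (4 * l)) \<le> (u ^ 4 + v ^ 4) * (k\<^sup>2 / (4 * l))"
    by (rule mult_right_mono) (use assms in auto)
  moreover have "2 * (u\<^sup>2 * v\<^sup>2) * (k\<^sup>2 / (4 * l)) = (u\<^sup>2 * v\<^sup>2) * k\<^sup>2 / (2 * l)"
    using assms by (simp add: field_simps)
  moreover have "a * b * k = u ^ 3 * v ^ 3 * k" by (simp add: cube)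
  ultimately show ?thesis using 1 unfolding four times_divide_eq_right by linarith
qed

lemma L43_nonneg: "0 \<le> L43 f"
  by (rule integral_nonneg_AE) auto

lemma near_part:
  assumes f: "star_density f" and g: "star_density g" and "\<delta> > 0"
  shows "integrable lebesgue2 (\<lambda>z. f (fst z) * g (snd z) * (indicator (ball 0 \<delta>) (fst z - snd z) / norm (fst z - snd z)))" (is "integrable _ ?q")
    and "(LINT z|lebesgue2. f (fst z) * g (snd z) * (indicator (ball 0 \<delta>) (fst z - snd z) / norm (fst z - snd z)))
      \<le> near_bound \<delta> f g"
proof -
  note [measurable] = star_densityD(1)[OF f] star_densityD(1)[OF g]
  let ?k2 = "\<lambda>w::real^3. indicator (ball 0 \<delta>) w / (norm w)\<^sup>2 :: real"
  \<comment> \<open>The weight \<open>sqrt \<delta>\<close> balances the two parts of the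
    inequality: the squared kernel integrates to a multiple of \<delta>, which divided by
    \<open>sqrt \<delta>\<close> has the order of the first summand.\<close>
  let ?h = "\<lambda>z. sqrt \<delta> / 2 * (f (fst z) powr (4/3) * g (snd z) powr (4/3)) +
     (f (fst z) powr (4/3) * ?k2 (fst z - snd z) + g (snd z) powr (4/3) * ?k2 (fst z - snd z)) / (4 * sqrt \<delta>)"
  note ifg = integrable_mult_prod[OF star_densityD(4)[OF f] star_densityD(4)[OF g]]
  note inf = integrable_near_prod[OF star_densityD(4)[OF f] assms(3)]
  note ing = integrable_near_prod[OF star_densityD(4)[OF g] assms(3)]
  have h: "integrable lebesgue2 ?h"
    using ifg(1) inf(1) ing(3) by auto
  have le: "?q z \<le> ?h z" and nn: "0 \<le> ?q z" for z
  proof -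
    have "(indicator (ball 0 \<delta>) (fst z - snd z) / norm (fst z - snd z))\<^sup>2 = ?k2 (fst z - snd z)"
      by (simp add: power_divide power2_eq_square indicator_def)
    then show "?q z \<le> ?h z"
      using four_thirds_amgm[of "f (fst z)" "g (snd z)" "sqrt \<delta>" "indicator (ball 0 \<delta>) (fst z - snd z) / norm (fst z - snd z)"]
        star_densityD(2)[OF f] star_densityD(2)[OF g] assms(3)
      by (simp only: distrib_right real_sqrt_gt_zero)
    show "0 \<le> ?q z" using star_densityD(2)[OF f] star_densityD(2)[OF g] by auto
  qed
  show i: "integrable lebesgue2 ?q"
  proof (rule Bochner_Integration.integrable_bound[OF h])
    show "AE z in lebesgue2. norm (?q z) \<le> norm (?h z)"
      using le nn by (intro AE_I2) (smt (verit) real_norm_def)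
  qed measurable
  have "integral\<^sup>L lebesgue2 ?q \<le> integral\<^sup>L lebesgue2 ?h"
    using i h le by (intro integral_mono) auto
  also have "\<dots> = sqrt \<delta> / 2 * (L43 f * L43 g) + (near_const * \<delta> * L43 f + near_const * \<delta> * L43 g) / (4 * sqrt \<delta>)"
    using ifg inf ing by (simp add: Bochner_Integration.integral_add)
  also have "\<dots> = sqrt \<delta> * (1/2 * (L43 f * L43 g) + near_const * (L43 f + L43 g) / 4)"
    using assms(3) by (simp add: field_simps) (simp add: mult.assoc[of "sqrt \<delta>" "sqrt \<delta>", symmetric] algebra_simps)
  also have "\<dots> \<le> sqrt \<delta> * ((1 + near_const) * (L43 f * L43 g + L43 f + L43 g))"
  proof (rule mult_left_mono)
    have "1/2 * (x * y) + n * (x + y) / 4 \<le> (1 + n) * (x * y + x + y)" if "0 \<le> x" "0 \<le> y" "0 \<le> n" for x y n :: real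
    proof -
      have "0 \<le> x * y" "0 \<le> n * x" "0 \<le> n * y" "0 \<le> n * (x * y)" using that by auto
      moreover have "1/2 * (x * y) \<le> x * y" "n * (x + y) / 4 \<le> n * x + n * y" using that by (auto simp: distrib_left)
      moreover have "(1 + n) * (x * y + x + y) = x * y + x + y + n * (x * y) + n * x + n * y" by (simp add: algebra_simps)
      ultimately show ?thesis using that by argo
    qed
    then show "1/2 * (L43 f * L43 g) + near_const * (L43 f + L43 g) / 4 \<le> (1 + near_const) * (L43 f * L43 g + L43 f + L43 g)"
      using L43_nonneg near_const_nonneg by blast
  qed (use assms in auto)
  finally show "integral\<^sup>L lebesgue2 ?q \<le> near_bound \<delta> f g" by (simp add: near_bound_def mult.assoc)
qed

text \<open>Within distance 1 the near estimate applies; beyond it the kernel is at most 1 and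
  integrability of the two densities is enough.\<close>

lemma integrable_mutual_energy:
  assumes f: "star_density f" and g: "star_density g"
  shows "integrable lebesgue2 (\<lambda>z. f (fst z) * g (snd z) / norm (fst z - snd z))"
proof (rule Bochner_Integration.integrable_bound)
  note [measurable] = star_densityD(1)[OF f] star_densityD(1)[OF g]
  note nn = star_densityD(2)[OF f] star_densityD(2)[OF g]
  let ?h = "\<lambda>z. f (fst z) * g (snd z) * (indicator (ball 0 1) (fst z - snd z) / norm (fst z - snd z)) + f (fst z) * g (snd z)"
  show "integrable lebesgue2 ?h"
    using near_part(1)[OF f g, of 1] integrable_mult_prod(1)[OF star_densityD(3)[OF f] star_densityD(3)[OF g]] by auto
  show "AE z in lebesgue2. norm (f (fst z) * g (snd z) / norm (fst z - snd z)) \<le> norm (?h z)"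
  proof (rule AE_I2)
    fix z
    have "f (fst z) * g (snd z) / norm (fst z - snd z) \<le> ?h z"
    proof (cases "norm (fst z - snd z) < 1")
      case False
      then have "f (fst z) * g (snd z) / norm (fst z - snd z) \<le> f (fst z) * g (snd z) / 1"
        using nn by (intro frac_le) auto
      then show ?thesis using False by simp
    qed (use nn in auto)
    moreover have "0 \<le> f (fst z) * g (snd z) / norm (fst z - snd z)" using nn by auto
    ultimately show "norm (f (fst z) * g (snd z) / norm (fst z - snd z)) \<le> norm (?h z)"
      unfolding real_norm_def by linarith
  qed
  show "(\<lambda>z. f (fst z) * g (snd z) / norm (fst z - snd z)) \<in> borel_measurable lebesgue2" by measurable
qed

lemma mutual_energy_commute:
  assumes "star_density f" "star_density g"
  shows "mutual_energy f g = mutual_energy g f"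
  unfolding mutual_energy_def
  using lebesgue2.integral_product_swap[OF borel_measurable_integrable[OF integrable_mutual_energy[OF assms]]]
  by (simp add: case_prod_unfold norm_minus_commute mult.commute)

lemma mutual_energy_nonneg:
  assumes "star_density f" "star_density g"
  shows "0 \<le> mutual_energy f g"
  unfolding mutual_energy_def using assms by (intro integral_nonneg_AE) (auto simp: star_density_def)

lemma mutual_energy_potential:
  assumes "star_density f" "star_density g"
  shows "integrable lebesgue (\<lambda>x. f x * potential g x)"
    and "(LINT x|lebesgue. f x * potential g x) = mutual_energy f g"
  using lebesgue2.integrable_fst'[OF integrable_mutual_energy[OF assms]]
    lebesgue2.integral_fst'[OF integrable_mutual_energy[OF assms]]
  by (simp_all add: potential_def mutual_energy_def flip: times_divide_eq_right)

lemma mutual_energy_add_left: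
  assumes "star_density f" "star_density g" "star_density h"
  shows "mutual_energy (\<lambda>x. f x + g x) h = mutual_energy f h + mutual_energy g h"
  unfolding mutual_energy_def
  using integrable_mutual_energy[OF assms(1,3)] integrable_mutual_energy[OF assms(2,3)]
  by (simp add: distrib_right add_divide_distrib)

lemma mutual_energy_split:
  assumes f: "star_density f" and g: "star_density g" and "0 < \<delta>"
  shows "mutual_energy f g \<le> near_bound \<delta> f g + (LINT x|lebesgue. f x) * (LINT x|lebesgue. g x) / \<delta>"
proof -
  note nn = star_densityD(2)[OF f] star_densityD(2)[OF g]
  let ?q = "\<lambda>z. f (fst z) * g (snd z) * (indicator (ball 0 \<delta>) (fst z - snd z) / norm (fst z - snd z))"
  note i = integrable_mult_prod[OF star_densityD(3)[OF f] star_densityD(3)[OF g]]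
  have "mutual_energy f g \<le> (LINT z|lebesgue2. ?q z + f (fst z) * g (snd z) / \<delta>)"
    unfolding mutual_energy_def
  proof (rule integral_mono)
    fix z
    show "f (fst z) * g (snd z) / norm (fst z - snd z) \<le> ?q z + f (fst z) * g (snd z) / \<delta>"
    proof (cases "norm (fst z - snd z) < \<delta>")
      case False
      then have "f (fst z) * g (snd z) / norm (fst z - snd z) \<le> f (fst z) * g (snd z) / \<delta>"
        using nn assms(3) by (intro frac_le) auto
      then show ?thesis using False by simp
    qed (use nn assms(3) in auto)
  qed (use integrable_mutual_energy[OF f g] near_part(1)[OF assms] i in auto)
  also have "\<dots> = integral\<^sup>L lebesgue2 ?q + (LINT x|lebesgue. f x) * (LINT x|lebesgue. g x) / \<delta>"
    using near_part(1)[OF assms] i by simp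
  finally show ?thesis using near_part(2)[OF assms] by linarith
qed

text \<open>The middle zone detects concentration: if every ball of radius \<open>R\<close> carries
  at most \<open>\<eta>\<close>, pairs at distance between \<open>\<delta>\<close> and
  \<open>R\<close> contribute at most \<open>\<eta> / \<delta>\<close> per unit of mass. Read
  backwards, a large mutual energy forces some ball to carry mass.\<close>

lemma mutual_energy_split_middle:
  assumes f: "star_density f" and g: "star_density g" and "0 < \<delta>" "0 < R"
    and \<eta>: "\<And>x. (LINT y:ball x R|lebesgue. g y) \<le> \<eta>"
  shows "mutual_energy f g \<le> near_bound \<delta> f g + (LINT x|lebesgue. f x) * \<eta> / \<delta>
    + (LINT x|lebesgue. f x) * (LINT x|lebesgue. g x) / R"
proof -
  note nn = star_densityD(2)[OF f] star_densityD(2)[OF g]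
  note [measurable] = star_densityD(1)[OF f] star_densityD(1)[OF g]
  let ?q = "\<lambda>z. f (fst z) * g (snd z) * (indicator (ball 0 \<delta>) (fst z - snd z) / norm (fst z - snd z))"
  let ?r = "\<lambda>z. f (fst z) * g (snd z) * indicator (ball 0 R) (fst z - snd z)"
  note i = integrable_mult_prod[OF star_densityD(3)[OF f] star_densityD(3)[OF g]]
  have r: "integrable lebesgue2 ?r"
    by (rule Bochner_Integration.integrable_bound[OF i(1)]) (auto simp: indicator_def)
  have "integral\<^sup>L lebesgue2 ?r = (LINT x|lebesgue. f x * (LINT y:ball x R|lebesgue. g y))"
    using lebesgue2.integral_fst'[OF r]
    by (simp add: set_lebesgue_integral_def indicator_def dist_norm ac_simps norm_minus_commute flip: integral_mult_right_zero)
  also have "\<dots> \<le> (LINT x|lebesgue. f x * \<eta>)"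
  proof (rule integral_mono)
    show "integrable lebesgue (\<lambda>x. f x * (LINT y:ball x R|lebesgue. g y))"
      using lebesgue2.integrable_fst'[OF r]
      by (simp add: set_lebesgue_integral_def indicator_def dist_norm ac_simps norm_minus_commute flip: integral_mult_right_zero)
  qed (use \<eta> nn star_densityD(3)[OF f] in \<open>auto intro: mult_left_mono\<close>)
  also have "\<dots> = (LINT x|lebesgue. f x) * \<eta>" by simp
  finally have r2: "integral\<^sup>L lebesgue2 ?r \<le> (LINT x|lebesgue. f x) * \<eta>" .
  have "mutual_energy f g \<le> (LINT z|lebesgue2. ?q z + ?r z / \<delta> + f (fst z) * g (snd z) / R)"
    unfolding mutual_energy_def
  proof (rule integral_mono)
    fix z
    let ?fg = "f (fst z) * g (snd z)"
    have fg: "0 \<le> ?fg" using nn by simp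
    consider "norm (fst z - snd z) < \<delta>" | "\<delta> \<le> norm (fst z - snd z)" "norm (fst z - snd z) < R"
      | "\<delta> \<le> norm (fst z - snd z)" "R \<le> norm (fst z - snd z)" by linarith
    then show "?fg / norm (fst z - snd z) \<le> ?q z + ?r z / \<delta> + ?fg / R"
    proof cases
      case 1
      then have "?fg / norm (fst z - snd z) = ?q z" by simp
      moreover have "0 \<le> ?r z / \<delta>" "0 \<le> ?fg / R" using fg assms by auto
      ultimately show ?thesis by linarith
    next
      case 2
      then have "?fg / norm (fst z - snd z) \<le> ?fg / \<delta>"
        using fg assms by (intro frac_le) auto
      moreover have "indicator (ball 0 R) (fst z - snd z) = (1::real)" using 2 by simp
      moreover have "0 \<le> ?q z" "0 \<le> ?fg / R" using fg assms by auto
      ultimately show ?thesis by simp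
    next
      case 3
      then have "?fg / norm (fst z - snd z) \<le> ?fg / R"
        using fg assms by (intro frac_le) auto
      moreover have "0 \<le> ?r z / \<delta>" "0 \<le> ?q z" using fg assms by auto
      ultimately show ?thesis by linarith
    qed
  qed (use integrable_mutual_energy[OF f g] near_part(1)[OF assms(1-3)] i r in auto)
  also have "\<dots> = integral\<^sup>L lebesgue2 ?q + integral\<^sup>L lebesgue2 ?r / \<delta> + (LINT x|lebesgue. f x) * (LINT x|lebesgue. g x) / R"
    using near_part(1)[OF assms(1-3)] i r by simp
  also have "\<dots> \<le> near_bound \<delta> f g + (LINT x|lebesgue. f x) * \<eta> / \<delta> + (LINT x|lebesgue. f x) * (LINT x|lebesgue. g x) / R"
    using near_part(2)[OF assms(1-3)] r2 assms by (simp add: divide_right_mono add_mono)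
  finally show ?thesis .
qed

lemma mutual_energy_separated:
  assumes f: "star_density f" and g: "star_density g" and "0 < d"
    and sep: "\<And>x y. f x \<noteq> 0 \<Longrightarrow> g y \<noteq> 0 \<Longrightarrow> d \<le> norm (x - y)"
  shows "mutual_energy f g \<le> (LINT x|lebesgue. f x) * (LINT x|lebesgue. g x) / d"
proof -
  note nn = star_densityD(2)[OF f] star_densityD(2)[OF g]
  note i = integrable_mult_prod[OF star_densityD(3)[OF f] star_densityD(3)[OF g]]
  have "mutual_energy f g \<le> (LINT z|lebesgue2. f (fst z) * g (snd z) / d)"
    unfolding mutual_energy_def
  proof (rule integral_mono)
    fix z
    show "f (fst z) * g (snd z) / norm (fst z - snd z) \<le> f (fst z) * g (snd z) / d"
    proof (cases "f (fst z) * g (snd z) = 0")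
      case False
      then have "d \<le> norm (fst z - snd z)" using sep by auto
      then show ?thesis using nn assms(3) by (intro frac_le) auto
    qed auto
  qed (use integrable_mutual_energy[OF f g] i in auto)
  then show ?thesis using i by simp
qed

section \<open>The gravitational field as a weak gradient\<close>

definition newton_kernel :: "real^3 \<Rightarrow> real^3" where
  "newton_kernel w = (1 / norm w ^ 3) *\<^sub>R w"

text \<open>The gradient of 1/|w| is -w/|w|^3, so this is the formal gradient of
  \<open>potential f\<close>. For integrable \<open>f\<close> the integral converges absolutely off
  a null set, on which the Bochner integral takes the value 0.\<close>

definition gravity :: "(real^3 \<Rightarrow> real) \<Rightarrow> real^3 \<Rightarrow> real^3" where
  "gravity f x = - (LINT y|lebesgue. f y *\<^sub>R newton_kernel (x - y))"

lemma newton_kernel_measurable [measurable]: "newton_kernel \<in> borel_measurable borel"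
  unfolding newton_kernel_def[abs_def] by measurable

lemma norm_newton_kernel: "norm (newton_kernel w) = 1 / (norm w)\<^sup>2"
  by (cases "w = 0") (auto simp: newton_kernel_def power3_eq_cube power2_eq_square)

text \<open>The similarity taking \<open>y\<close> to \<open>0\<close> and \<open>z\<close> to \<open>e\<close> scales the kernel by \<open>t\<^sup>-\<^sup>4\<close> and the volume by
  \<open>t\<^sup>3\<close>, where \<open>t = norm (y - z)\<close>.\<close>

lemma two_center_integral:
  fixes H :: "real^3 \<Rightarrow> real^3 \<Rightarrow> real"
  defines "e \<equiv> axis 1 1 :: real^3"
  assumes m: "(\<lambda>x. H x (x - e)) \<in> borel_measurable lebesgue"
    and hom: "\<And>t u v. 0 < t \<Longrightarrow> H (t *\<^sub>R u) (t *\<^sub>R v) = H u v / t ^ 4"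
    and rot: "\<And>T u v. orthogonal_transformation T \<Longrightarrow> H (T u) (T v) = H u v"
    and "y \<noteq> z"
  shows "integrable lebesgue (\<lambda>x. H (x - y) (x - z)) \<longleftrightarrow> integrable lebesgue (\<lambda>x. H x (x - e))"
    and "(LINT x|lebesgue. H (x - y) (x - z)) = (LINT x|lebesgue. H x (x - e)) / norm (y - z)"
proof -
  define t where "t = norm (z - y)"
  have t: "0 < t" using \<open>y \<noteq> z\<close> by (simp add: t_def)
  have "norm ((1/t) *\<^sub>R (z - y)) = norm e" using t by (simp add: t_def e_def)
  then obtain S where S: "orthogonal_transformation S" "S ((1/t) *\<^sub>R (z - y)) = e"
    using orthogonal_transformation_exists by blast
  have lin: "linear S" using S(1) by (rule orthogonal_transformation_linear)
  let ?f = "\<lambda>x. H x (x - e)"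
  have eq: "H (x - y) (x - z) = ?f (S ((1/t) *\<^sub>R x + (- (1/t) *\<^sub>R y))) / t ^ 4" for x
  proof -
    have 1: "(1/t) *\<^sub>R x + (- (1/t) *\<^sub>R y) = (1/t) *\<^sub>R (x - y)" by (simp add: scaleR_diff_right)
    have "S ((1/t) *\<^sub>R (x - y)) - e = S ((1/t) *\<^sub>R (x - y) - (1/t) *\<^sub>R (z - y))"
      using S(2) by (simp add: linear_diff[OF lin])
    also have "(1/t) *\<^sub>R (x - y) - (1/t) *\<^sub>R (z - y) = (1/t) *\<^sub>R (x - z)"
      by (simp flip: scaleR_diff_right)
    finally have "?f (S ((1/t) *\<^sub>R (x - y))) = H (S ((1/t) *\<^sub>R (x - y))) (S ((1/t) *\<^sub>R (x - z)))" by simp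
    also have "\<dots> = H (x - y) (x - z) * t ^ 4"
      using rot[OF S(1)] hom[of "1/t"] t by (simp add: power_divide)
    finally show ?thesis using t 1 by simp
  qed
  have [measurable]: "S \<in> lebesgue \<rightarrow>\<^sub>M lebesgue" by (rule orthogonal_measurable_lebesgue[OF S(1)])
  have mS: "(\<lambda>x. ?f (S x)) \<in> borel_measurable lebesgue"
    by (rule measurable_compose[OF _ m]) measurable
  have "integrable lebesgue (\<lambda>x. H (x - y) (x - z)) \<longleftrightarrow>
      integrable lebesgue (\<lambda>x. ?f (S ((1/t) *\<^sub>R x + (- (1/t) *\<^sub>R y))))"
    unfolding eq divide_inverse using t by (subst mult.commute, subst integrable_mult_left_iff) simp
  also have "\<dots> \<longleftrightarrow> integrable lebesgue (\<lambda>x. ?f (S x))"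
    by (rule integral_lebesgue_affine(1)[OF _ mS]) (use t in auto)
  also have "\<dots> \<longleftrightarrow> integrable lebesgue ?f"
    by (rule integral_lebesgue_orthogonal(1)[OF S(1) m])
  finally show "integrable lebesgue (\<lambda>x. H (x - y) (x - z)) \<longleftrightarrow> integrable lebesgue (\<lambda>x. H x (x - e))" .
  have "(LINT x|lebesgue. H (x - y) (x - z)) = (LINT x|lebesgue. ?f (S ((1/t) *\<^sub>R x + (- (1/t) *\<^sub>R y)))) / t ^ 4"
    unfolding eq by simp
  also have "(LINT x|lebesgue. ?f (S ((1/t) *\<^sub>R x + (- (1/t) *\<^sub>R y)))) = (LINT x|lebesgue. ?f (S x)) /\<^sub>R (1/t) ^ 3"
    by (rule integral_lebesgue_affine(2)[OF _ mS]) (use t in auto)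
  also have "(LINT x|lebesgue. ?f (S x)) = (LINT x|lebesgue. ?f x)"
    by (rule integral_lebesgue_orthogonal(2)[OF S(1) m])
  also have "(LINT x|lebesgue. ?f x) /\<^sub>R (1/t) ^ 3 / t ^ 4 = (LINT x|lebesgue. ?f x) / norm (y - z)"
    using t by (simp add: t_def norm_minus_commute power_divide field_simps eval_nat_numeral)
  finally show "(LINT x|lebesgue. H (x - y) (x - z)) = (LINT x|lebesgue. H x (x - e)) / norm (y - z)" .
qed

text \<open>The distances to the two centres add up to at least 1, so the larger one is at least
  1/2. If the nearer centre is closer than 1, the other factor is at most 4 and an inverse square
  remains; otherwise the product is below the inverse fourth power of the smaller distance.\<close>

lemma integrable_two_center_inverse_squares:
  "integrable lebesgue (\<lambda>x::real^3. 1 / ((norm x)\<^sup>2 * (norm (x - axis 1 1))\<^sup>2))"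
proof -
  let ?e = "axis 1 1 :: real^3"
  let ?B = "\<lambda>x::real^3. 4 * (indicator (ball 0 1) x / (norm x)\<^sup>2) + indicator (- ball 0 1) x / (norm x) ^ 4 :: real"
  have B: "integrable lebesgue ?B"
    using integrable_inverse_square_ball integrable_inverse_fourth_exterior
    by (intro Bochner_Integration.integrable_add integrable_mult_right)
  then have "integrable lebesgue (\<lambda>x. ?B (x + (- ?e)))"
    by (subst integral_lebesgue_translation(1)) auto
  with B have h: "integrable lebesgue (\<lambda>x. ?B x + ?B (x + (- ?e)))" by (rule Bochner_Integration.integrable_add)
  have one: "1 / ((norm x)\<^sup>2 * (norm y)\<^sup>2) \<le> ?B x" if "norm x \<le> norm y" "1 \<le> norm x + norm y" for x y :: "real^3"
  proof (cases "x = 0")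
    case False
    show ?thesis
    proof (cases "norm x < 1")
      case True
      have "(1/2)\<^sup>2 \<le> (norm y)\<^sup>2" using that by (intro power_mono) auto
      then have "1 / (norm y)\<^sup>2 \<le> 1 / (1/2)\<^sup>2" by (intro frac_le) auto
      then have "1 / (norm x)\<^sup>2 * (1 / (norm y)\<^sup>2) \<le> 1 / (norm x)\<^sup>2 * 4"
        by (intro mult_left_mono) (auto simp: power2_eq_square)
      then show ?thesis using True by simp
    next
      case F: False
      have "(norm x)\<^sup>2 * (norm x)\<^sup>2 \<le> (norm x)\<^sup>2 * (norm y)\<^sup>2"
        using that by (intro mult_left_mono power_mono) auto
      then have "1 / ((norm x)\<^sup>2 * (norm y)\<^sup>2) \<le> 1 / ((norm x)\<^sup>2 * (norm x)\<^sup>2)"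
        using False by (intro frac_le) auto
      then show ?thesis using F by (simp add: power2_eq_square eval_nat_numeral mult.assoc)
    qed
  qed simp
  have nnB: "0 \<le> ?B x" for x by auto
  show ?thesis
  proof (rule Bochner_Integration.integrable_bound[OF h])
    show "AE x in lebesgue. norm (1 / ((norm x)\<^sup>2 * (norm (x - ?e))\<^sup>2)) \<le> norm (?B x + ?B (x + (- ?e)))"
    proof (rule AE_I2)
      fix x :: "real^3"
      have "norm ?e \<le> norm x + norm (x - ?e)" using norm_triangle_ineq4[of x "x - ?e"] by simp
      then have tri: "1 \<le> norm x + norm (x - ?e)" by simp
      have "1 / ((norm x)\<^sup>2 * (norm (x - ?e))\<^sup>2) \<le> ?B x + ?B (x + (- ?e))"
      proof (cases "norm x \<le> norm (x - ?e)")
        case True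
        then show ?thesis using one[OF True tri] nnB[of "x + (- ?e)"] by linarith
      next
        case False
        then have "1 / ((norm (x - ?e))\<^sup>2 * (norm x)\<^sup>2) \<le> ?B (x + (- ?e))"
          using one[of "x - ?e" x] tri by (simp add: add.commute)
        then have "1 / ((norm x)\<^sup>2 * (norm (x - ?e))\<^sup>2) \<le> ?B (x + (- ?e))" by (simp only: mult.commute)
        then show ?thesis using nnB[of x] by linarith
      qed
      then show "norm (1 / ((norm x)\<^sup>2 * (norm (x - ?e))\<^sup>2)) \<le> norm (?B x + ?B (x + (- ?e)))"
        using nnB[of x] nnB[of "x + (- ?e)"] by auto
    qed
  qed measurable
qed

text \<open>By Poisson's equation for 1/|x| the value is 4 pi.\<close>

definition gravity_const :: real where
  "gravity_const = (LINT x|lebesgue. newton_kernel x \<bullet> newton_kernel (x - axis 1 1))"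

text \<open>The two-centre integral of absolute values supplies the majorant that justifies
  exchanging integrations in \<open>gravity_inner\<close>.\<close>

lemma integrable_inverse_squares:
  fixes y z :: "real^3"
  assumes "y \<noteq> z"
  shows "integrable lebesgue (\<lambda>x. 1 / ((norm (x - y))\<^sup>2 * (norm (x - z))\<^sup>2))"
    and "(LINT x|lebesgue. 1 / ((norm (x - y))\<^sup>2 * (norm (x - z))\<^sup>2)) =
      (LINT x|lebesgue. 1 / ((norm x)\<^sup>2 * (norm (x - axis 1 1 :: real^3))\<^sup>2)) / norm (y - z)"
  using two_center_integral[where H = "\<lambda>u v. 1 / ((norm u)\<^sup>2 * (norm v)\<^sup>2)", OF _ _ _ assms]
    integrable_two_center_inverse_squares
  by (simp_all add: orthogonal_transformation_norm power_mult_distrib eval_nat_numeral)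

lemma newton_kernel_inner_integral:
  fixes y z :: "real^3"
  assumes "y \<noteq> z"
  shows "integrable lebesgue (\<lambda>x. newton_kernel (x - y) \<bullet> newton_kernel (x - z))"
    and "(LINT x|lebesgue. newton_kernel (x - y) \<bullet> newton_kernel (x - z)) = gravity_const / norm (y - z)"
proof -
  have i: "integrable lebesgue (\<lambda>x. newton_kernel x \<bullet> newton_kernel (x - axis 1 1))"
    by (rule Bochner_Integration.integrable_bound[OF integrable_two_center_inverse_squares])
      (auto intro!: AE_I2 order_trans[OF Cauchy_Schwarz_ineq2] simp: norm_newton_kernel)
  have h: "newton_kernel (t *\<^sub>R u) \<bullet> newton_kernel (t *\<^sub>R v) = (newton_kernel u \<bullet> newton_kernel v) / t ^ 4" if "t > 0" for t u v
    using that by (simp add: newton_kernel_def power_mult_distrib eval_nat_numeral)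
  have r: "newton_kernel (T u) \<bullet> newton_kernel (T v) = newton_kernel u \<bullet> newton_kernel v"
    if "orthogonal_transformation T" for T u v
    using that by (simp add: newton_kernel_def orthogonal_transformation_norm) (simp add: orthogonal_transformation_def)
  note * = two_center_integral[where H = "\<lambda>u v. newton_kernel u \<bullet> newton_kernel v", OF borel_measurable_integrable[OF i] h r assms]
  show "integrable lebesgue (\<lambda>x. newton_kernel (x - y) \<bullet> newton_kernel (x - z))"
    and "(LINT x|lebesgue. newton_kernel (x - y) \<bullet> newton_kernel (x - z)) = gravity_const / norm (y - z)"
    using * i by (auto simp: gravity_const_def)
qed

text \<open>The two-centre formulas require distinct centres, so the diagonal has to be discarded as
  a null set.\<close>

lemma AE_lebesgue2_offdiagonal: "AE p in lebesgue2. fst p \<noteq> snd p"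
proof (rule lebesgue2.AE_pair_measure)
  have "{p \<in> space lebesgue2. fst p \<noteq> snd p} = {p \<in> space lebesgue2. norm (fst p - snd p) \<noteq> 0}" by auto
  also have "\<dots> \<in> sets lebesgue2" by measurable
  finally show "{p \<in> space lebesgue2. fst p \<noteq> snd p} \<in> sets lebesgue2" .
  show "AE x in lebesgue. AE y in lebesgue. fst (x :: real^3, y) \<noteq> snd (x, y)"
  proof (rule AE_I2)
    fix x :: "real^3"
    have "{x} \<in> null_sets lebesgue" by (simp add: null_sets_completionI)
    then have "AE y in lebesgue. y \<notin> {x}" by (rule AE_not_in)
    then show "AE y in lebesgue. fst (x, y) \<noteq> snd (x, y)" by eventually_elim auto
  qed
qed

text \<open>One majorant for both kernels: \<open>j = 1\<close> is the potential,
  \<open>j = 2\<close> the size of the field.\<close>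

lemma local_kernel_bound:
  fixes w :: "real^3"
  assumes "j = 1 \<or> j = 2"
  shows "1 / norm w ^ j \<le> 1 + indicator (ball 0 1) w / (norm w)\<^sup>2"
proof (cases "w = 0 \<or> norm w \<ge> 1")
  case True
  then show ?thesis using assms by (auto simp: divide_le_eq_1 split: split_indicator)
next
  case False
  then have "(norm w)\<^sup>2 \<le> norm w ^ j" by (intro power_decreasing) (use assms in auto)
  then have "1 / norm w ^ j \<le> 1 / (norm w)\<^sup>2" using False by (intro frac_le) auto
  then show ?thesis using False by simp
qed

lemma integrable_local_kernel:
  fixes f :: "real^3 \<Rightarrow> real"
  assumes f: "integrable lebesgue f" and j: "j = 1 \<or> j = 2"
  shows "integrable lebesgue2 (\<lambda>z. indicator (ball 0 R) (fst z) * f (snd z) / norm (fst z - snd z) ^ j)"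
proof (rule Bochner_Integration.integrable_bound)
  note [measurable] = borel_measurable_integrable[OF f]
  let ?h = "\<lambda>z. indicator (ball 0 R) (fst z) * \<bar>f (snd z)\<bar> + \<bar>f (snd z)\<bar> * (indicator (ball 0 1) (fst z - snd z) / (norm (fst z - snd z))\<^sup>2)"
  have "integrable lebesgue (indicator (ball (0::real^3) R) :: _ \<Rightarrow> real)"
    by (simp add: lmeasurable_iff_integrable[symmetric])
  then show "integrable lebesgue2 ?h"
    using f integrable_near_prod(3)[of "\<lambda>x. \<bar>f x\<bar>" 1]
    by (intro Bochner_Integration.integrable_add integrable_mult_prod(1)) auto
  show "AE z in lebesgue2. norm (indicator (ball 0 R) (fst z) * f (snd z) / norm (fst z - snd z) ^ j) \<le> norm (?h z)"
  proof (rule AE_I2)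
    fix z :: "(real^3) \<times> (real^3)"
    let ?i = "indicator (ball 0 R) (fst z) :: real" and ?n = "indicator (ball 0 1) (fst z - snd z) / (norm (fst z - snd z))\<^sup>2 :: real"
    have "norm (?i * f (snd z) / norm (fst z - snd z) ^ j) = ?i * \<bar>f (snd z)\<bar> * (1 / norm (fst z - snd z) ^ j)"
      by (simp add: abs_mult)
    also have "\<dots> \<le> ?i * \<bar>f (snd z)\<bar> * (1 + ?n)"
      by (intro mult_left_mono local_kernel_bound j) auto
    also have "\<dots> \<le> ?h z"
    proof -
      have "?i * (\<bar>f (snd z)\<bar> * ?n) \<le> 1 * (\<bar>f (snd z)\<bar> * ?n)"
        by (intro mult_right_mono) (auto split: split_indicator)
      then show ?thesis by (simp add: distrib_left mult.assoc)
    qed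
    finally show "norm (?i * f (snd z) / norm (fst z - snd z) ^ j) \<le> norm (?h z)" by simp
  qed
qed (use borel_measurable_integrable[OF f] in measurable)

text \<open>Each integer radius contributes a null set of bad points inside its ball; their
  countable union is still null.\<close>

lemma AE_integrable_gravity:
  fixes f :: "real^3 \<Rightarrow> real"
  assumes f: "integrable lebesgue f"
  shows "AE x in lebesgue. integrable lebesgue (\<lambda>y. f y *\<^sub>R newton_kernel (x - y))"
proof -
  note [measurable] = borel_measurable_integrable[OF f]
  have "AE x in lebesgue. \<forall>n::nat. integrable lebesgue (\<lambda>y. indicator (ball 0 (real n)) x * f y / norm (x - y) ^ 2)"
    using lebesgue2.AE_integrable_fst'[OF integrable_local_kernel[OF f, of 2]] by (simp add: AE_all_countable)
  then show ?thesis
  proof eventually_elim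
    case (elim x)
    obtain n where "norm x < real n" using reals_Archimedean2 by blast
    then have "integrable lebesgue (\<lambda>y. f y / norm (x - y) ^ 2)" using elim[rule_format, of n] by simp
    then show ?case
      by (rule Bochner_Integration.integrable_bound) (auto intro!: AE_I2 simp: norm_newton_kernel)
  qed
qed

lemma gravity_measurable:
  assumes [measurable]: "f \<in> borel_measurable lebesgue"
  shows "gravity f \<in> borel_measurable lebesgue"
  unfolding gravity_def[abs_def] by measurable

lemma potential_measurable:
  assumes [measurable]: "f \<in> borel_measurable lebesgue"
  shows "potential f \<in> borel_measurable lebesgue"
  unfolding potential_def[abs_def] by measurable

interpretation lebesgue3: pair_sigma_finite "lebesgue2" "lebesgue :: (real^3) measure" ..

text \<open>Both sides are iterated integrals of one function of ((y, z), x). Integrating over x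
  first gives the two-centre constant divided by |y - z|; integrating over (y, z) first factorises
  into the two fields at x.\<close>

lemma gravity_inner:
  assumes f: "star_density f" and g: "star_density g"
  shows "integrable lebesgue (\<lambda>x. gravity f x \<bullet> gravity g x)"
    and "(LINT x|lebesgue. gravity f x \<bullet> gravity g x) = gravity_const * mutual_energy f g"
proof -
  note [measurable] = star_densityD(1)[OF f] star_densityD(1)[OF g]
  note nn = star_densityD(2)[OF f] star_densityD(2)[OF g]
  define \<Phi> where "\<Phi> w = (f (fst (fst w)) *\<^sub>R newton_kernel (snd w - fst (fst w))) \<bullet>
    (g (snd (fst w)) *\<^sub>R newton_kernel (snd w - snd (fst w)))" for w :: "((real^3) \<times> (real^3)) \<times> (real^3)"
  define J where "J = (LINT x|lebesgue. 1 / ((norm x)\<^sup>2 * (norm (x - axis 1 1 :: real^3))\<^sup>2))"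
  have \<Phi>_eq: "\<Phi> (p, x) = (f (fst p) * g (snd p)) * (newton_kernel (x - fst p) \<bullet> newton_kernel (x - snd p))" for p x
    by (simp add: \<Phi>_def)
  have m[measurable]: "\<Phi> \<in> borel_measurable (lebesgue2 \<Otimes>\<^sub>M lebesgue)"
    unfolding \<Phi>_def by measurable
  have i: "integrable (lebesgue2 \<Otimes>\<^sub>M lebesgue) \<Phi>"
  proof (rule lebesgue3.Fubini_integrable[OF m])
    show "AE p in lebesgue2. integrable lebesgue (\<lambda>x. \<Phi> (p, x))"
      using AE_lebesgue2_offdiagonal
      by eventually_elim (auto simp: \<Phi>_eq newton_kernel_inner_integral)
    show "integrable lebesgue2 (\<lambda>p. LINT x|lebesgue. norm (\<Phi> (p, x)))"
    proof (rule Bochner_Integration.integrable_bound)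
      show "integrable lebesgue2 (\<lambda>p. f (fst p) * g (snd p) / norm (fst p - snd p) * J)"
        using integrable_mutual_energy[OF f g] by (rule integrable_mult_left)
      show "AE p in lebesgue2. norm (LINT x|lebesgue. norm (\<Phi> (p, x))) \<le> norm (f (fst p) * g (snd p) / norm (fst p - snd p) * J)"
        using AE_lebesgue2_offdiagonal
      proof eventually_elim
        case (elim p)
        have "(LINT x|lebesgue. norm (\<Phi> (p, x))) \<le>
            (LINT x|lebesgue. (f (fst p) * g (snd p)) * (1 / ((norm (x - fst p))\<^sup>2 * (norm (x - snd p))\<^sup>2)))"
        proof (rule integral_mono)
          show "integrable lebesgue (\<lambda>x. norm (\<Phi> (p, x)))"
            using newton_kernel_inner_integral(1)[OF elim] unfolding \<Phi>_eq by auto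
          show "integrable lebesgue (\<lambda>x. (f (fst p) * g (snd p)) * (1 / ((norm (x - fst p))\<^sup>2 * (norm (x - snd p))\<^sup>2)))"
            using integrable_inverse_squares(1)[OF elim] by (rule integrable_mult_right)
          show "norm (\<Phi> (p, x)) \<le> (f (fst p) * g (snd p)) * (1 / ((norm (x - fst p))\<^sup>2 * (norm (x - snd p))\<^sup>2))" for x
            unfolding \<Phi>_eq real_norm_def abs_mult
            using Cauchy_Schwarz_ineq2[of "newton_kernel (x - fst p)" "newton_kernel (x - snd p)"] nn
            by (intro mult_mono) (auto simp: norm_newton_kernel)
        qed
        also have "\<dots> = f (fst p) * g (snd p) / norm (fst p - snd p) * J"
          unfolding integral_mult_right_zero integrable_inverse_squares(2)[OF elim] J_def by simp
        finally have "(LINT x|lebesgue. norm (\<Phi> (p, x))) \<le> f (fst p) * g (snd p) / norm (fst p - snd p) * J" .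
        moreover have "0 \<le> (LINT x|lebesgue. norm (\<Phi> (p, x)))" by simp
        ultimately show ?case unfolding real_norm_def by linarith
      qed
    qed measurable
  qed
  have "(LINT p|lebesgue2. LINT x|lebesgue. \<Phi> (p, x)) = (LINT p|lebesgue2. gravity_const * (f (fst p) * g (snd p) / norm (fst p - snd p)))"
  proof (rule integral_cong_AE)
    show "AE p in lebesgue2. (LINT x|lebesgue. \<Phi> (p, x)) = gravity_const * (f (fst p) * g (snd p) / norm (fst p - snd p))"
      using AE_lebesgue2_offdiagonal
      by eventually_elim (simp add: \<Phi>_eq newton_kernel_inner_integral)
  qed measurable
  then have tot: "integral\<^sup>L (lebesgue2 \<Otimes>\<^sub>M lebesgue) \<Phi> = gravity_const * mutual_energy f g"
    unfolding lebesgue3.integral_fst'[OF i] by (simp only: mutual_energy_def integral_mult_right_zero)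
  have i': "integrable (lebesgue2 \<Otimes>\<^sub>M lebesgue) (\<lambda>(p, x). \<Phi> (p, x))" using i by simp
  have inner: "AE x in lebesgue. (LINT p|lebesgue2. \<Phi> (p, x)) = gravity f x \<bullet> gravity g x"
    using AE_integrable_gravity[OF star_densityD(3)[OF f]] AE_integrable_gravity[OF star_densityD(3)[OF g]]
  proof eventually_elim
    case (elim x)
    show ?case
      using integrable_inner_prod(2)[OF elim] by (simp only: \<Phi>_def fst_conv snd_conv gravity_def inner_minus_left inner_minus_right minus_minus)
  qed
  have mG: "(\<lambda>x. gravity f x \<bullet> gravity g x) \<in> borel_measurable lebesgue"
    using gravity_measurable[of f] gravity_measurable[of g] by measurable
  have mL: "(\<lambda>x. LINT p|lebesgue2. \<Phi> (p, x)) \<in> borel_measurable lebesgue"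
    using lebesgue3.integrable_snd[OF i'] by (rule borel_measurable_integrable)
  show "integrable lebesgue (\<lambda>x. gravity f x \<bullet> gravity g x)"
    using integrable_cong_AE[OF mL mG inner] lebesgue3.integrable_snd[OF i'] by simp
  show "(LINT x|lebesgue. gravity f x \<bullet> gravity g x) = gravity_const * mutual_energy f g"
    using integral_cong_AE[OF mL mG inner] lebesgue3.integral_snd[OF i'] tot by simp
qed

section \<open>Integration by parts against compactly supported test functions\<close>

lemma compactly_supported_C1:
  fixes \<phi> :: "real^3 \<Rightarrow> real"
  assumes d: "\<And>x. GDERIV \<phi> x :> D x" and c: "continuous_on UNIV D"
    and supp: "\<And>x. R \<le> norm x \<Longrightarrow> \<phi> x = 0" and "0 < R"
  shows "(\<phi> has_derivative (\<bullet>) (D x)) (at x)" "continuous_on UNIV \<phi>"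
    "\<phi> \<in> borel_measurable lebesgue" "D \<in> borel_measurable lebesgue"
    "R < norm x \<Longrightarrow> D x = 0" "\<exists>C. \<forall>x. norm (D x) \<le> C" "\<exists>C. \<forall>x. \<bar>\<phi> x\<bar> \<le> C"
proof -
  show der: "(\<phi> has_derivative (\<bullet>) (D x)) (at x)" for x
  proof -
    have "(\<bullet>) (D x) = (\<lambda>h. h \<bullet> D x)" by (rule ext) (rule inner_commute)
    then show ?thesis using d[of x] by (simp add: gderiv_def)
  qed
  show c\<phi>: "continuous_on UNIV \<phi>"
    using der has_derivative_continuous by (blast intro: continuous_at_imp_continuous_on)
  show "\<phi> \<in> borel_measurable lebesgue" "D \<in> borel_measurable lebesgue"
    by (intro measurable_completion, simp add: borel_measurable_continuous_onI c\<phi> c)+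
  \<comment> \<open>The strict inequality leaves an open neighbourhood on which the function
    vanishes identically, so that uniqueness of the derivative applies.\<close>
  show D0: "D x = 0" if "R < norm x" for x
  proof -
    have "((\<lambda>_. 0) has_derivative (\<bullet>) (D x)) (at x)"
    proof (rule has_derivative_transform_within_open[OF der])
      show "open (- cball (0::real^3) R)" by (simp add: open_Compl)
    qed (use that supp in auto)
    then have "(\<bullet>) (D x) = (\<lambda>_. 0)" using has_derivative_unique[OF _ has_derivative_const] by blast
    then have "D x \<bullet> D x = 0" by (rule fun_cong)
    then show ?thesis by simp
  qed
  have bdd: "\<exists>C. \<forall>x. norm (g x) \<le> C" if "continuous_on UNIV g" "\<And>x. R < norm x \<Longrightarrow> g x = 0"
    for g :: "real^3 \<Rightarrow> 'a::real_normed_vector"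
  proof -
    have "compact (g ` cball 0 R)" by (intro compact_continuous_image continuous_on_subset[OF that(1)]) auto
    then obtain C where C: "\<And>x. x \<in> cball 0 R \<Longrightarrow> norm (g x) \<le> C"
      using compact_imp_bounded bounded_iff by (metis image_eqI)
    have "norm (g x) \<le> \<bar>C\<bar>" for x
      using C[of x] that(2)[of x] by (cases "norm x \<le> R") auto
    then show ?thesis by blast
  qed
  show "\<exists>C. \<forall>x. norm (D x) \<le> C" by (rule bdd[OF c D0])
  show "\<exists>C. \<forall>x. \<bar>\<phi> x\<bar> \<le> C" using bdd[OF c\<phi>] supp by simp
qed

text \<open>By translation invariance every difference quotient integrates to 0. The bound on the
  gradient is a Lipschitz constant that dominates the quotients, so the limit gives a vanishing
  component in each direction \<open>v\<close>.\<close>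

lemma integral_gradient_compact_support:
  fixes \<phi> :: "real^3 \<Rightarrow> real"
  assumes d: "\<And>x. GDERIV \<phi> x :> D x" and c: "continuous_on UNIV D"
    and supp: "\<And>x. R \<le> norm x \<Longrightarrow> \<phi> x = 0" and "0 < R"
  shows "(LINT x|lebesgue. D x) = 0"
proof -
  note \<phi> = compactly_supported_C1[OF assms]
  note der = \<phi>(1) and [measurable] = \<phi>(3,4)
  obtain C where C0: "\<And>x. norm (D x) \<le> C" using \<phi>(6) by blast
  have C: "norm (D x) \<le> \<bar>C\<bar>" for x using C0[of x] by linarith
  obtain C' where C': "\<And>x. \<bar>\<phi> x\<bar> \<le> C'" using \<phi>(7) by blast
  have ib: "integrable lebesgue (\<lambda>x. indicator (ball (0::real^3) r) x * B :: real)" for r B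
    by (intro integrable_mult_left) (simp add: lmeasurable_iff_integrable[symmetric])
  have iD: "integrable lebesgue D"
    by (rule Bochner_Integration.integrable_bound[OF ib[of "R + 1" C]])
      (use C \<phi>(5) in \<open>auto intro!: AE_I2 simp: indicator_def\<close>)
  have lip: "\<bar>\<phi> (x + v) - \<phi> x\<bar> \<le> \<bar>C\<bar> * norm v" for x v
  proof -
    have "onorm ((\<bullet>) (D x)) \<le> \<bar>C\<bar>" for x
      by (rule onorm_le) (use order_trans[OF Cauchy_Schwarz_ineq2 mult_right_mono[OF C norm_ge_zero]] in auto)
    then show ?thesis
      using differentiable_bound[of UNIV \<phi> "\<lambda>x. (\<bullet>) (D x)" "\<bar>C\<bar>" "x + v" x] der by simp
  qed
  have i\<phi>: "integrable lebesgue \<phi>"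
    by (rule Bochner_Integration.integrable_bound[OF ib[of R C']])
      (use order_trans[OF C' abs_ge_self] supp in \<open>auto intro!: AE_I2 simp: indicator_def\<close>)
  have "(LINT x|lebesgue. D x) \<bullet> v = 0" for v
  proof -
    define h where "h n = 1 / real (Suc n)" for n
    have h: "0 < h n" "h n \<le> 1" for n by (auto simp: h_def)
    let ?q = "\<lambda>n x. (\<phi> (x + h n *\<^sub>R v) - \<phi> x) / h n"
    have "(\<lambda>n. LINT x|lebesgue. ?q n x) \<longlonglongrightarrow> (LINT x|lebesgue. D x \<bullet> v)"
    \<comment> \<open>The shifts have length at most |v|, so all quotients vanish outside the ball
      of radius R + |v| + 1; the extra 1 compensates for the ball being open.\<close>
    proof (rule integral_dominated_convergence[OF _ _ ib[of "R + norm v + 1" "\<bar>C\<bar> * norm v"]])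
      show "AE x in lebesgue. (\<lambda>n. ?q n x) \<longlonglongrightarrow> D x \<bullet> v"
      proof (rule AE_I2)
        fix x
        have "((\<lambda>t. \<phi> (x + t *\<^sub>R v)) has_derivative (\<lambda>t. D x \<bullet> (t *\<^sub>R v))) (at 0)"
          by (rule has_derivative_compose[where f = "\<lambda>t. x + t *\<^sub>R v" and g = \<phi>])
            (auto intro!: derivative_eq_intros der)
        then have "((\<lambda>t. \<phi> (x + t *\<^sub>R v)) has_field_derivative (D x \<bullet> v)) (at 0)"
          by (simp add: has_field_derivative_def mult_commute_abs)
        then have "((\<lambda>t. (\<phi> (x + t *\<^sub>R v) - \<phi> x) / t) \<longlongrightarrow> D x \<bullet> v) (at 0)"
          by (simp add: DERIV_def)
        moreover have "filterlim h (at 0) sequentially"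
        proof -
          have "h = (\<lambda>n. inverse (real (Suc n)))" by (simp add: h_def fun_eq_iff inverse_eq_divide)
          then have "h \<longlonglongrightarrow> 0" using LIMSEQ_inverse_real_of_nat by simp
          moreover have "h n \<noteq> 0" for n using h(1)[of n] by simp
          ultimately show ?thesis by (simp add: filterlim_at)
        qed
        ultimately show "(\<lambda>n. ?q n x) \<longlonglongrightarrow> D x \<bullet> v"
          by (rule filterlim_compose)
      qed
      show "AE x in lebesgue. norm (?q n x) \<le> indicator (ball 0 (R + norm v + 1)) x * (\<bar>C\<bar> * norm v)" for n
      proof (rule AE_I2)
        fix x
        have "\<bar>\<phi> (x + h n *\<^sub>R v) - \<phi> x\<bar> \<le> \<bar>C\<bar> * (h n * norm v)"
          using lip[of x "h n *\<^sub>R v"] h(1)[of n] by simp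
        then have b: "\<bar>?q n x\<bar> \<le> \<bar>C\<bar> * norm v" using h(1)[of n] by (simp add: field_simps)
        have "?q n x = 0" if "R + norm v + 1 \<le> norm x"
        proof -
          have "norm (h n *\<^sub>R v) \<le> norm v" using h[of n] by (simp add: mult_left_le_one_le)
          then have "R \<le> norm (x + h n *\<^sub>R v)"
            using norm_diff_ineq[of x "h n *\<^sub>R v"] that by linarith
          moreover have "R \<le> norm x" using that norm_ge_zero[of v] by linarith
          ultimately show ?thesis using supp by simp
        qed
        then show "norm (?q n x) \<le> indicator (ball 0 (R + norm v + 1)) x * (\<bar>C\<bar> * norm v)"
          using b by (cases "norm x < R + norm v + 1") auto
      qed
    qed measurable
    moreover have z: "(LINT x|lebesgue. ?q n x) = 0" for n
    proof -
      have "(LINT x|lebesgue. \<phi> (x + h n *\<^sub>R v)) = (LINT x|lebesgue. \<phi> x)"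
        "integrable lebesgue (\<lambda>x. \<phi> (x + h n *\<^sub>R v))"
        using integral_lebesgue_translation[of \<phi> "h n *\<^sub>R v"] i\<phi> by simp_all
      then show ?thesis using i\<phi> by simp
    qed
    ultimately have "(\<lambda>n::nat. 0::real) \<longlonglongrightarrow> (LINT x|lebesgue. D x \<bullet> v)" by (simp only:)
    then have "(LINT x|lebesgue. D x \<bullet> v) = 0"
      using LIMSEQ_unique[OF _ tendsto_const] by blast
    then show ?thesis using iD by simp
  qed
  then show "(LINT x|lebesgue. D x) = 0" by (metis inner_eq_zero_iff)
qed

lemma integrable_ball_kernel:
  fixes y :: "real^3"
  assumes "j = 1 \<or> j = 2"
  shows "integrable lebesgue (\<lambda>x. indicator (ball 0 R) x * (1 / norm (x - y) ^ j))"
proof (rule Bochner_Integration.integrable_bound)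
  show "integrable lebesgue (\<lambda>x. indicator (ball 0 R) x + indicator (ball 0 1) (x - y) / (norm (x - y))\<^sup>2 :: real)"
    using inverse_square_near(1)[of 1 y] by (intro Bochner_Integration.integrable_add) (auto simp: lmeasurable_iff_integrable[symmetric])
  show "AE x in lebesgue. norm (indicator (ball 0 R) x * (1 / norm (x - y) ^ j)) \<le>
      norm (indicator (ball 0 R) x + indicator (ball 0 1) (x - y) / (norm (x - y))\<^sup>2 :: real)"
    using local_kernel_bound[OF assms] by (intro AE_I2) (auto simp: indicator_def)
qed measurable

text \<open>The kernel is regularised to \<open>1 / sqrt (\<bar>x - y\<bar>\<^sup>2 + \<epsilon>\<^sup>2)\<close>, for which the identity is the
  vanishing of the integral of a gradient.\<close>

lemma newton_kernel_integration_by_parts: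
  fixes \<phi> :: "real^3 \<Rightarrow> real"
  assumes d: "\<And>x. GDERIV \<phi> x :> D x" and c: "continuous_on UNIV D"
    and supp: "\<And>x. R \<le> norm x \<Longrightarrow> \<phi> x = 0" and "0 < R"
  shows "(LINT x|lebesgue. (1 / norm (x - y)) *\<^sub>R D x) = (LINT x|lebesgue. \<phi> x *\<^sub>R newton_kernel (x - y))"
proof -
  note \<phi> = compactly_supported_C1[OF assms]
  note der = \<phi>(1) and c\<phi> = \<phi>(2) and [measurable] = \<phi>(3,4)
  obtain C1 where C1: "\<And>x. norm (D x) \<le> C1" using \<phi>(6) by blast
  obtain C2 where C2: "\<And>x. \<bar>\<phi> x\<bar> \<le> C2" using \<phi>(7) by blast
  define \<epsilon> where "\<epsilon> n = 1 / real (Suc n)" for n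
  define s where "s n x = sqrt ((x - y) \<bullet> (x - y) + (\<epsilon> n)\<^sup>2)" for n and x :: "real^3"
  have \<epsilon>: "0 < \<epsilon> n" for n by (simp add: \<epsilon>_def)
  have s_pos: "0 < s n x" for n x using \<epsilon>[of n] by (simp add: s_def add_nonneg_pos)
  have s_ge: "norm (x - y) \<le> s n x" for n x
    unfolding s_def norm_eq_sqrt_inner by simp
  have cs: "continuous_on UNIV (s n)" for n unfolding s_def by (intro continuous_intros)
  have ms[measurable]: "s n \<in> borel_measurable lebesgue" for n
    by (intro measurable_completion) (simp add: borel_measurable_continuous_onI[OF cs])
  have s_lim: "(\<lambda>n. s n x) \<longlonglongrightarrow> norm (x - y)" for x
  proof -
    have "\<epsilon> \<longlonglongrightarrow> 0" unfolding \<epsilon>_def using LIMSEQ_inverse_real_of_nat by (simp add: inverse_eq_divide)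
    then have "(\<lambda>n. s n x) \<longlonglongrightarrow> sqrt ((x - y) \<bullet> (x - y) + 0\<^sup>2)"
      unfolding s_def by (intro tendsto_intros)
    then show ?thesis by (simp add: norm_eq_sqrt_inner)
  qed
  let ?E = "\<lambda>n x. (1 / s n x) *\<^sub>R D x - (\<phi> x / s n x ^ 3) *\<^sub>R (x - y)"
  have key: "(LINT x|lebesgue. ?E n x) = 0" for n
  proof (rule integral_gradient_compact_support[OF _ _ _ \<open>0 < R\<close>])
    show "GDERIV (\<lambda>x. \<phi> x / s n x) x :> ?E n x" for x
    proof -
      have pos: "0 < (x - y) \<bullet> (x - y) + (\<epsilon> n)\<^sup>2" using \<epsilon>[of n] by (simp add: add_nonneg_pos)
      have "(s n has_derivative (\<lambda>h. (x - y) \<bullet> h / s n x)) (at x)"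
        unfolding s_def using pos
        by (auto intro!: derivative_eq_intros simp: inner_commute field_simps)
      then have "((\<lambda>x. \<phi> x / s n x) has_derivative (\<lambda>h. - \<phi> x * (inverse (s n x) * ((x - y) \<bullet> h / s n x) * inverse (s n x)) + (D x \<bullet> h) / s n x)) (at x)"
        using s_pos[of n x] by (intro has_derivative_divide der) auto
      moreover have "(\<lambda>h. - \<phi> x * (inverse (s n x) * ((x - y) \<bullet> h / s n x) * inverse (s n x)) + (D x \<bullet> h) / s n x) = (\<lambda>h. h \<bullet> ?E n x)"
      proof
        fix h
        have "h \<bullet> ?E n x = (1 / s n x) * (D x \<bullet> h) - (\<phi> x / s n x ^ 3) * ((x - y) \<bullet> h)"
          by (simp add: inner_diff_right inner_diff_left inner_commute)
        then show "- \<phi> x * (inverse (s n x) * ((x - y) \<bullet> h / s n x) * inverse (s n x)) + (D x \<bullet> h) / s n x = h \<bullet> ?E n x"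
          using s_pos[of n x] by (simp add: divide_inverse power3_eq_cube)
      qed
      ultimately show ?thesis by (simp add: gderiv_def)
    qed
    show "continuous_on UNIV (?E n)"
      using s_pos[of n] by (intro continuous_intros c c\<phi> cs) (auto simp: less_le)
  qed (simp add: supp)
  \<comment> \<open>Since \<open>s n x\<close> is at least |x - y|, the unregularised kernels, cut
    to the support, dominate for all \<open>n\<close> at once.\<close>
  have i1: "integrable lebesgue (\<lambda>x. indicator (ball 0 (R + 1)) x * (1 / norm (x - y) ^ 1) * C1)"
    and i2: "integrable lebesgue (\<lambda>x. indicator (ball 0 (R + 1)) x * (1 / norm (x - y) ^ 2) * C2)"
    by (intro integrable_mult_left integrable_ball_kernel; simp)+
  have "AE x in lebesgue. x \<noteq> y"
    using AE_not_in[of "{y}" lebesgue] by (simp add: null_sets_completionI)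
  then have ne: "AE x in lebesgue. x - y \<noteq> 0" by eventually_elim simp
  have b1: "AE x in lebesgue. norm ((1 / s n x) *\<^sub>R D x) \<le> indicator (ball 0 (R + 1)) x * (1 / norm (x - y) ^ 1) * C1" for n
    using ne
  proof eventually_elim
    case (elim x)
    show ?case
    proof (cases "norm x < R + 1")
      case True
      have "norm ((1 / s n x) *\<^sub>R D x) = 1 / s n x * norm (D x)" using s_pos[of n x] by simp
      also have "\<dots> \<le> 1 / norm (x - y) * C1"
        using s_pos[of n x] s_ge[of x n] C1[of x] elim by (intro mult_mono frac_le) auto
      finally show ?thesis using True by simp
    qed (use \<phi>(5)[of x] in auto)
  qed
  have b2: "AE x in lebesgue. norm ((\<phi> x / s n x ^ 3) *\<^sub>R (x - y)) \<le> indicator (ball 0 (R + 1)) x * (1 / norm (x - y) ^ 2) * C2" for n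
    using ne
  proof eventually_elim
    case (elim x)
    show ?case
    proof (cases "norm x < R + 1")
      case True
      have "norm ((\<phi> x / s n x ^ 3) *\<^sub>R (x - y)) = norm (x - y) / s n x ^ 3 * norm (\<phi> x)" using s_pos[of n x] by simp
      also have "\<dots> \<le> norm (x - y) / norm (x - y) ^ 3 * C2"
        using s_pos[of n x] s_ge[of x n] C2[of x] elim by (intro mult_mono frac_le power_mono) auto
      also have "norm (x - y) / norm (x - y) ^ 3 = 1 / norm (x - y) ^ 2"
        using elim by (simp add: power3_eq_cube power2_eq_square)
      finally show ?thesis using True by simp
    qed (use supp[of x] in auto)
  qed
  have e: "(LINT x|lebesgue. (1 / s n x) *\<^sub>R D x) = (LINT x|lebesgue. (\<phi> x / s n x ^ 3) *\<^sub>R (x - y))" for n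
  proof -
    have "integrable lebesgue (\<lambda>x. (1 / s n x) *\<^sub>R D x)"
      by (rule integrable_AE_bound[OF i1 _ b1]) measurable
    moreover have "integrable lebesgue (\<lambda>x. (\<phi> x / s n x ^ 3) *\<^sub>R (x - y))"
      by (rule integrable_AE_bound[OF i2 _ b2]) measurable
    ultimately show ?thesis using key[of n] by simp
  qed
  have "(\<lambda>n. LINT x|lebesgue. (1 / s n x) *\<^sub>R D x) \<longlonglongrightarrow> (LINT x|lebesgue. (1 / norm (x - y)) *\<^sub>R D x)"
  proof (rule integral_dominated_convergence[OF _ _ i1 _ b1])
    show "AE x in lebesgue. (\<lambda>n. (1 / s n x) *\<^sub>R D x) \<longlonglongrightarrow> (1 / norm (x - y)) *\<^sub>R D x"
      using ne by eventually_elim (auto intro!: tendsto_intros s_lim)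
  qed measurable
  moreover have "(\<lambda>n. LINT x|lebesgue. (\<phi> x / s n x ^ 3) *\<^sub>R (x - y)) \<longlonglongrightarrow> (LINT x|lebesgue. \<phi> x *\<^sub>R newton_kernel (x - y))"
  proof (rule integral_dominated_convergence[OF _ _ i2 _ b2])
    show "AE x in lebesgue. (\<lambda>n. (\<phi> x / s n x ^ 3) *\<^sub>R (x - y)) \<longlonglongrightarrow> \<phi> x *\<^sub>R newton_kernel (x - y)"
      using ne
    proof eventually_elim
      case (elim x)
      have "(\<lambda>n. (\<phi> x / s n x ^ 3) *\<^sub>R (x - y)) \<longlonglongrightarrow> (\<phi> x / norm (x - y) ^ 3) *\<^sub>R (x - y)"
        using elim by (intro tendsto_intros s_lim) auto
      then show ?case by (simp add: newton_kernel_def)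
    qed
  qed measurable
  ultimately show ?thesis unfolding e by (rule LIMSEQ_unique)
qed

text \<open>Holds for every \<open>f\<close>: for \<open>c\<close> other than 0 the map v -> (v .
  c)/(c . c) undoes the scaling, so both integrands are integrable or both integrals are 0 by
  default. This covers points where the potential integral diverges.\<close>

lemma integral_scaleR_left_euclidean:
  fixes c :: "'a::euclidean_space"
  shows "(LINT x|M. f x *\<^sub>R c) = (LINT x|M. f x) *\<^sub>R c"
proof (cases "c = 0")
  case False
  have "bounded_linear (\<lambda>v. (v \<bullet> c) / (c \<bullet> c))"
    using bounded_linear_compose[OF bounded_linear_divide bounded_linear_inner_left] .
  then show ?thesis
    by (intro integral_bounded_linear'[OF bounded_linear_scaleR_left, of "\<lambda>v. (v \<bullet> c) / (c \<bullet> c)"]) (use False in auto)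
qed simp

lemma locally_integrable_potential:
  assumes f: "star_density f"
  shows "locally_integrable (potential f)" "locally_integrable (gravity f)"
proof -
  note [measurable] = star_densityD(1)[OF f]
  have K: "\<exists>n::nat. K \<subseteq> ball 0 (real n)" if "compact K" for K :: "(real^3) set"
  proof -
    obtain r where r: "\<And>x. x \<in> K \<Longrightarrow> norm x \<le> r" using compact_imp_bounded[OF \<open>compact K\<close>] bounded_iff by metis
    obtain n where "r < real n" using reals_Archimedean2 by blast
    then show ?thesis using r by (intro exI[of _ n]) fastforce
  qed
  have sets: "K \<in> sets lebesgue" if "compact K" for K :: "(real^3) set"
    using lmeasurable_compact[OF that] by auto
  have ip: "integrable lebesgue (\<lambda>x. indicator (ball 0 (real n)) x * potential f x)" for n
    using lebesgue2.integrable_fst'[OF integrable_local_kernel[OF star_densityD(3)[OF f], of 1 "real n"]]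
    by (simp add: potential_def flip: times_divide_eq_right)
  show "locally_integrable (potential f)" unfolding locally_integrable_def
  proof (intro allI impI)
    fix K :: "(real^3) set" assume "compact K"
    then obtain n :: nat where n: "K \<subseteq> ball 0 (real n)" using K by blast
    have "set_integrable lebesgue (ball 0 (real n)) (potential f)"
      using ip[of n] by (simp add: set_integrable_def)
    then show "set_integrable lebesgue K (potential f)"
      by (rule set_integrable_subset) (use n sets \<open>compact K\<close> in auto)
  qed
  have ig: "integrable lebesgue (\<lambda>x. indicator (ball 0 (real n)) x *\<^sub>R gravity f x)" for n
  proof -
    have "integrable lebesgue2 (\<lambda>z. - ((indicator (ball 0 (real n)) (fst z) * f (snd z)) *\<^sub>R newton_kernel (fst z - snd z)))"
    proof (rule integrable_AE_bound[OF integrable_local_kernel[OF star_densityD(3)[OF f], of 2 "real n"]])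
      show "AE z in lebesgue2. norm (- ((indicator (ball 0 (real n)) (fst z) * f (snd z)) *\<^sub>R newton_kernel (fst z - snd z)))
          \<le> indicator (ball 0 (real n)) (fst z) * f (snd z) / norm (fst z - snd z) ^ 2"
        using star_densityD(2)[OF f] by (intro AE_I2) (simp add: norm_newton_kernel)
    qed (simp, measurable)
    from lebesgue2.integrable_fst'[OF this] show ?thesis
      by (simp add: gravity_def flip: scaleR_scaleR)
  qed
  show "locally_integrable (gravity f)" unfolding locally_integrable_def
  proof (intro allI impI)
    fix K :: "(real^3) set" assume "compact K"
    then obtain n :: nat where n: "K \<subseteq> ball 0 (real n)" using K by blast
    have "set_integrable lebesgue (ball 0 (real n)) (gravity f)"
      using ig[of n] by (simp add: set_integrable_def)
    then show "set_integrable lebesgue K (gravity f)"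
      by (rule set_integrable_subset) (use n sets \<open>compact K\<close> in auto)
  qed
qed

text \<open>For fixed y the identity is integration by parts against the kernel centred at y.
  Superposing with density \<open>f\<close> needs absolute integrability of both double integrals,
  which the compact support of the test function and local integrability of the kernels
  provide.\<close>

lemma weak_gradient_potential:
  assumes f: "star_density f"
  shows "weak_gradient (potential f) (gravity f)"
  unfolding weak_gradient_def
proof (intro conjI allI impI locally_integrable_potential[OF f])
  note [measurable] = star_densityD(1)[OF f]
  note if_ = star_densityD(3)[OF f]
  fix \<phi> :: "real^3 \<Rightarrow> real" and D
  assume d: "\<forall>x. GDERIV \<phi> x :> D x" and c: "continuous_on UNIV D" and k: "compact (closure {x. \<phi> x \<noteq> 0})"
  obtain r where r: "\<And>x. x \<in> closure {x. \<phi> x \<noteq> 0} \<Longrightarrow> norm x \<le> r"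
    using compact_imp_bounded[OF k] bounded_iff by metis
  define R where "R = \<bar>r\<bar> + 1"
  have R: "0 < R" by (simp add: R_def)
  have supp: "\<phi> x = 0" if "R \<le> norm x" for x
    using r[of x] that closure_subset[of "{x. \<phi> x \<noteq> 0}"] by (auto simp: R_def)
  note d = d[rule_format]
  note \<phi> = compactly_supported_C1[OF d c supp R]
  note m[measurable] = \<phi>(3,4)
  obtain C1 where C1: "\<And>x. norm (D x) \<le> C1" using \<phi>(6) by blast
  obtain C2 where C2: "\<And>x. \<bar>\<phi> x\<bar> \<le> C2" using \<phi>(7) by blast
  have D1: "norm (D x) \<le> indicator (ball 0 (R + 1)) x * C1" for x
    using C1[of x] \<phi>(5)[of x] by (cases "norm x < R + 1") auto
  have \<phi>1: "norm (\<phi> x) \<le> indicator (ball 0 (R + 1)) x * C2" for x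
    using C2[of x] supp[of x] by (cases "norm x < R + 1") auto
  let ?F = "\<lambda>(x, y). (f y / norm (x - y)) *\<^sub>R D x" and ?G = "\<lambda>(x, y). (f y * \<phi> x) *\<^sub>R newton_kernel (x - y)"
  have F: "integrable lebesgue2 ?F"
  proof (rule integrable_AE_bound[OF integrable_mult_left[OF integrable_local_kernel[OF if_, of 1 "R + 1"], of C1]])
    show "AE z in lebesgue2. norm (?F z) \<le> indicator (ball 0 (R + 1)) (fst z) * f (snd z) / norm (fst z - snd z) ^ 1 * C1"
    proof (rule AE_I2)
      fix z
      have "norm (?F z) = f (snd z) / norm (fst z - snd z) * norm (D (fst z))"
        using star_densityD(2)[OF f] by (simp add: case_prod_unfold)
      also have "\<dots> \<le> f (snd z) / norm (fst z - snd z) * (indicator (ball 0 (R + 1)) (fst z) * C1)"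
        by (rule mult_left_mono[OF D1]) (use star_densityD(2)[OF f] in auto)
      finally show "norm (?F z) \<le> indicator (ball 0 (R + 1)) (fst z) * f (snd z) / norm (fst z - snd z) ^ 1 * C1"
        by (simp add: mult_ac)
    qed
  qed (simp, measurable)
  have G: "integrable lebesgue2 ?G"
  proof (rule integrable_AE_bound[OF integrable_mult_left[OF integrable_local_kernel[OF if_, of 2 "R + 1"], of C2]])
    show "AE z in lebesgue2. norm (?G z) \<le> indicator (ball 0 (R + 1)) (fst z) * f (snd z) / norm (fst z - snd z) ^ 2 * C2"
    proof (rule AE_I2)
      fix z
      have "norm (?G z) = f (snd z) / norm (fst z - snd z) ^ 2 * norm (\<phi> (fst z))"
        using star_densityD(2)[OF f] by (simp add: case_prod_unfold norm_newton_kernel abs_mult)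
      also have "\<dots> \<le> f (snd z) / norm (fst z - snd z) ^ 2 * (indicator (ball 0 (R + 1)) (fst z) * C2)"
        by (rule mult_left_mono[OF \<phi>1]) (use star_densityD(2)[OF f] in auto)
      finally show "norm (?G z) \<le> indicator (ball 0 (R + 1)) (fst z) * f (snd z) / norm (fst z - snd z) ^ 2 * C2"
        by (simp add: mult_ac)
    qed
  qed (simp, measurable)
  have "(LINT x|lebesgue. potential f x *\<^sub>R D x) = (LINT x|lebesgue. LINT y|lebesgue. (f y / norm (x - y)) *\<^sub>R D x)"
    by (simp add: potential_def integral_scaleR_left_euclidean)
  also have "\<dots> = (LINT y|lebesgue. LINT x|lebesgue. (f y / norm (x - y)) *\<^sub>R D x)"
    by (rule lebesgue2.Fubini_integral[symmetric, OF F])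
  also have "\<dots> = (LINT y|lebesgue. LINT x|lebesgue. (f y * \<phi> x) *\<^sub>R newton_kernel (x - y))"
  proof (rule Bochner_Integration.integral_cong[OF refl])
    fix y
    have "(LINT x|lebesgue. (f y / norm (x - y)) *\<^sub>R D x) = f y *\<^sub>R (LINT x|lebesgue. (1 / norm (x - y)) *\<^sub>R D x)"
      by (simp flip: integral_scaleR_right)
    also have "\<dots> = f y *\<^sub>R (LINT x|lebesgue. \<phi> x *\<^sub>R newton_kernel (x - y))"
      using newton_kernel_integration_by_parts[OF d c supp R] by simp
    finally show "(LINT x|lebesgue. (f y / norm (x - y)) *\<^sub>R D x) = (LINT x|lebesgue. (f y * \<phi> x) *\<^sub>R newton_kernel (x - y))"
      by (simp flip: integral_scaleR_right)
  qed
  also have "\<dots> = (LINT x|lebesgue. LINT y|lebesgue. (f y * \<phi> x) *\<^sub>R newton_kernel (x - y))"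
    by (rule lebesgue2.Fubini_integral[OF G])
  also have "\<dots> = (LINT x|lebesgue. - (\<phi> x *\<^sub>R gravity f x))"
    by (simp add: gravity_def mult.commute flip: scaleR_scaleR)
  finally show "(LINT x|lebesgue. potential f x *\<^sub>R D x) = - (LINT x|lebesgue. \<phi> x *\<^sub>R gravity f x)" by simp
qed

section \<open>Weak compactness through midpoint hulls\<close>

text \<open>These are the convex combinations with dyadic weights of the members from index
  \<open>n\<close> on. Midpoints suffice for a Komlos-type argument, and each property of interest
  has to be checked for one midpoint only.\<close>

inductive mid_hull :: "(nat \<Rightarrow> 'a \<Rightarrow> real) \<Rightarrow> nat \<Rightarrow> ('a \<Rightarrow> real) \<Rightarrow> bool" for f n where
  base: "n \<le> k \<Longrightarrow> mid_hull f n (f k)"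
| mid: "mid_hull f n g \<Longrightarrow> mid_hull f n h \<Longrightarrow> mid_hull f n (\<lambda>x. (g x + h x) / 2)"

lemma mid_hull_mono: "mid_hull f n g \<Longrightarrow> m \<le> n \<Longrightarrow> mid_hull f m g"
  by (induction rule: mid_hull.induct) (auto intro: mid_hull.intros)

lemma liminf_le_ennreal:
  fixes C :: ennreal
  assumes "\<And>n. X n \<le> C"
  shows "liminf X \<le> C"
proof -
  have "liminf X \<le> liminf (\<lambda>_. C)" by (rule Liminf_mono) (simp add: assms)
  then show ?thesis by (simp add: Liminf_const)
qed

lemma Fatou_integral_bound:
  fixes g :: "nat \<Rightarrow> 'a \<Rightarrow> real"
  assumes i: "\<And>n. integrable M (g n)" and nn: "\<And>n. AE x in M. 0 \<le> g n x"
    and C: "\<And>n. (LINT x|M. g n x) \<le> C" and lim: "AE x in M. (\<lambda>n. g n x) \<longlonglongrightarrow> F x"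
    and m: "F \<in> borel_measurable M"
  shows "integrable M F" "(LINT x|M. F x) \<le> C"
proof -
  have nnF: "AE x in M. 0 \<le> F x"
  proof -
    have "AE x in M. \<forall>n. 0 \<le> g n x" using nn by (simp add: AE_all_countable)
    with lim show ?thesis by eventually_elim (auto intro: LIMSEQ_le_const)
  qed
  have C0: "0 \<le> C" using order_trans[OF integral_nonneg_AE[OF nn] C] .
  have "(\<integral>\<^sup>+x. ennreal (F x) \<partial>M) = (\<integral>\<^sup>+x. liminf (\<lambda>n. ennreal (g n x)) \<partial>M)"
  proof (rule nn_integral_cong_AE)
    show "AE x in M. ennreal (F x) = liminf (\<lambda>n. ennreal (g n x))"
      using lim by eventually_elim (auto intro!: lim_imp_Liminf[symmetric] tendsto_ennrealI)
  qed
  also have "\<dots> \<le> liminf (\<lambda>n. \<integral>\<^sup>+x. ennreal (g n x) \<partial>M)"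
    by (rule nn_integral_liminf) (use borel_measurable_integrable[OF i] in measurable)
  also have "\<dots> \<le> ennreal C"
  proof (rule liminf_le_ennreal)
    show "(\<integral>\<^sup>+x. ennreal (g n x) \<partial>M) \<le> ennreal C" for n
      unfolding nn_integral_eq_integral[OF i nn] using C by (rule ennreal_leI)
  qed
  finally have b: "(\<integral>\<^sup>+x. ennreal (F x) \<partial>M) \<le> ennreal C" .
  show iF: "integrable M F"
    using b nnF m by (intro integrableI_nonneg) (auto simp: le_less_trans)
  show "(LINT x|M. F x) \<le> C"
    using b C0 unfolding nn_integral_eq_integral[OF iF nnF] by simp
qed

lemma mid_hull_integral_bound:
  fixes \<Phi> :: "real \<Rightarrow> real"
  assumes \<Phi>: "\<Phi> \<in> borel_measurable borel" "\<And>t. 0 \<le> t \<Longrightarrow> 0 \<le> \<Phi> t"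
      "\<And>a b. 0 \<le> a \<Longrightarrow> 0 \<le> b \<Longrightarrow> \<Phi> ((a + b) / 2) \<le> (\<Phi> a + \<Phi> b) / 2"
    and f: "\<And>i. integrable M (f i)" "\<And>i x. 0 \<le> f i x" "\<And>i. integrable M (\<lambda>x. \<Phi> (f i x))"
      "\<And>i. n \<le> i \<Longrightarrow> (LINT x|M. \<Phi> (f i x)) \<le> B"
    and h: "mid_hull f n h"
  shows "integrable M h \<and> (\<forall>x. 0 \<le> h x) \<and> integrable M (\<lambda>x. \<Phi> (h x)) \<and> (LINT x|M. \<Phi> (h x)) \<le> B"
  using h
proof (induction rule: mid_hull.induct)
  case (mid h k)
  have ih: "integrable M h" "\<And>x. 0 \<le> h x" "integrable M (\<lambda>x. \<Phi> (h x))" "(LINT x|M. \<Phi> (h x)) \<le> B"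
    using mid.IH(1) by blast+
  have ik: "integrable M k" "\<And>x. 0 \<le> k x" "integrable M (\<lambda>x. \<Phi> (k x))" "(LINT x|M. \<Phi> (k x)) \<le> B"
    using mid.IH(2) by blast+
  note [measurable] = \<Phi>(1) borel_measurable_integrable[OF ih(1)] borel_measurable_integrable[OF ik(1)]
  have pos: "0 \<le> (h x + k x) / 2" for x using ih(2)[of x] ik(2)[of x] by auto
  have le: "\<Phi> ((h x + k x) / 2) \<le> (\<Phi> (h x) + \<Phi> (k x)) / 2" for x by (rule \<Phi>(3)[OF ih(2) ik(2)])
  have ir: "integrable M (\<lambda>x. (\<Phi> (h x) + \<Phi> (k x)) / 2)" using ih ik by auto
  have il: "integrable M (\<lambda>x. \<Phi> ((h x + k x) / 2))"
    by (rule integrable_AE_bound[OF ir]) (use le \<Phi>(2)[OF pos] in auto)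
  have "(LINT x|M. \<Phi> ((h x + k x) / 2)) \<le> (LINT x|M. (\<Phi> (h x) + \<Phi> (k x)) / 2)"
    by (rule integral_mono[OF il ir le])
  also have "\<dots> = ((LINT x|M. \<Phi> (h x)) + (LINT x|M. \<Phi> (k x))) / 2" using ih ik by simp
  finally have "(LINT x|M. \<Phi> ((h x + k x) / 2)) \<le> B" using ih ik unfolding add_divide_distrib by linarith
  moreover have "integrable M (\<lambda>x. (h x + k x) / 2)" using ih ik by auto
  ultimately show ?case using il pos by blast
qed (use f in auto)

text \<open>Lower semicontinuity in disguise: a bound valid from index \<open>N\<close> on is
  inherited by the hull of that tail through midpoint convexity, and by the limit through Fatou. It
  is used for the identity, for powers and for the internal energy.\<close>

lemma mid_hull_limit_bound:
  fixes \<Phi> :: "real \<Rightarrow> real"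
  assumes \<Phi>: "\<Phi> \<in> borel_measurable borel" "\<And>t. 0 \<le> t \<Longrightarrow> 0 \<le> \<Phi> t"
      "\<And>a b. 0 \<le> a \<Longrightarrow> 0 \<le> b \<Longrightarrow> \<Phi> ((a + b) / 2) \<le> (\<Phi> a + \<Phi> b) / 2"
      "\<And>u l. (\<And>n. 0 \<le> u n) \<Longrightarrow> u \<longlonglongrightarrow> l \<Longrightarrow> (\<lambda>n::nat. \<Phi> (u n)) \<longlonglongrightarrow> \<Phi> l"
    and f: "\<And>i. integrable M (f i)" "\<And>i x. 0 \<le> f i x" "\<And>i. integrable M (\<lambda>x. \<Phi> (f i x))"
      "\<And>i. N \<le> i \<Longrightarrow> (LINT x|M. \<Phi> (f i x)) \<le> B"
    and g: "\<And>n. mid_hull f n (g n)" and lim: "AE x in M. (\<lambda>n. g n x) \<longlonglongrightarrow> F x" and F: "F \<in> borel_measurable M"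
  shows "integrable M (\<lambda>x. \<Phi> (F x))" "(LINT x|M. \<Phi> (F x)) \<le> B"
proof -
  note hull = mid_hull_integral_bound[OF \<Phi>(1-3) f mid_hull_mono[OF g, of N "n + N" for n]]
  have l: "AE x in M. (\<lambda>n. \<Phi> (g (n + N) x)) \<longlonglongrightarrow> \<Phi> (F x)"
    using lim
  proof eventually_elim
    case (elim x)
    then show ?case using hull by (intro \<Phi>(4) LIMSEQ_ignore_initial_segment[OF elim]) auto
  qed
  have m: "(\<lambda>x. \<Phi> (F x)) \<in> borel_measurable M" by (rule measurable_compose[OF F \<Phi>(1)])
  show "integrable M (\<lambda>x. \<Phi> (F x))" "(LINT x|M. \<Phi> (F x)) \<le> B"
    by (rule Fatou_integral_bound[OF _ _ _ l m]; use hull \<Phi>(2) in auto)+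
qed

lemma liminf_top_of_tendsto:
  assumes "\<And>K::nat. eventually (\<lambda>n. real K \<le> g n) sequentially"
  shows "liminf (\<lambda>n. ennreal (g n)) = \<infinity>"
proof (rule ccontr)
  assume "liminf (\<lambda>n. ennreal (g n)) \<noteq> \<infinity>"
  then obtain K where K: "liminf (\<lambda>n. ennreal (g n)) < of_nat K"
    using ennreal_Ex_less_of_nat by (metis infinity_ennreal_def top.not_eq_extremum)
  have "ennreal (real K) \<le> liminf (\<lambda>n. ennreal (g n))"
    by (rule Liminf_bounded) (use assms[of K] in \<open>auto elim: eventually_mono intro: ennreal_leI\<close>)
  then show False using K by (simp add: ennreal_of_nat_eq_real_of_nat)
qed

text \<open>Nearly minimising \<open>\<integral>exp(-g) w\<close> over the tails of the midpoint hull makes \<open>exp(-g/2)\<close> a Cauchy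
  sequence, by the parallelogram identity for \<open>exp(-a/2)\<close> and \<open>exp(-b/2)\<close>.\<close>

lemma mid_hull_AE_convergent:
  fixes f :: "nat \<Rightarrow> 'a::euclidean_space \<Rightarrow> real"
  assumes i: "\<And>n. integrable lebesgue (f n)" and nn: "\<And>n x. 0 \<le> f n x" and C: "\<And>n. (LINT x|lebesgue. f n x) \<le> C"
  shows "\<exists>g. (\<forall>n. mid_hull f n (g n)) \<and> (AE x in lebesgue. convergent (\<lambda>n. g n x))"
proof -
  have hull: "integrable lebesgue g \<and> (\<forall>x. 0 \<le> g x) \<and> (LINT x|lebesgue. g x) \<le> C" if "mid_hull f n g" for n g
    using that by (induction rule: mid_hull.induct) (auto simp: i nn C)
  note hi = hull[THEN conjunct1] and hn = hull[THEN conjunct2, THEN conjunct1, rule_format] and hC = hull[THEN conjunct2, THEN conjunct2]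
  \<comment> \<open>A strictly positive integrable weight is needed because the space has infinite
    measure and exp(-g) alone would have no finite integral.\<close>
  obtain h :: "'a \<Rightarrow> ennreal" where h: "h \<in> borel_measurable lebesgue" "integral\<^sup>N lebesgue h \<noteq> \<infinity>" "\<And>x. 0 < h x" "\<And>x. h x < \<infinity>"
    using lebesgue.Ex_finite_integrable_function by auto
  define w where "w x = enn2real (h x)" for x
  have w0: "0 < w x" for x using h(3,4)[of x] by (simp add: w_def enn2real_positive_iff)
  have mw[measurable]: "w \<in> borel_measurable lebesgue" using h(1) by (simp add: w_def[abs_def])
  have iw: "integrable lebesgue w"
  proof (rule integrableI_nonneg)
    have "ennreal (w x) = h x" for x using h(4)[of x] by (simp add: w_def)
    then show "(\<integral>\<^sup>+x. ennreal (w x) \<partial>lebesgue) < \<infinity>" using h(2) by (simp add: top.not_eq_extremum)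
  qed (use w0 in \<open>auto simp: less_imp_le\<close>)
  define W where "W = (LINT x|lebesgue. w x)"
  have W0: "0 \<le> W" unfolding W_def using w0 by (intro integral_nonneg_AE AE_I2) (auto simp: less_imp_le)
  define J where "J g = (LINT x|lebesgue. exp (- g x) * w x)" for g :: "'a \<Rightarrow> real"
  have iJ: "integrable lebesgue (\<lambda>x. exp (- g x) * w x)" if "g \<in> borel_measurable lebesgue" "\<And>x. 0 \<le> g x" for g
    by (rule integrable_AE_bound[OF iw]) (use that w0 in \<open>auto simp: abs_mult less_imp_le mult_left_le_one_le\<close>)
  have J0: "0 \<le> J g" for g unfolding J_def using w0 by (intro integral_nonneg_AE AE_I2) (auto simp: less_imp_le)
  have JW: "J g \<le> W" if "mid_hull f n g" for n g
    unfolding J_def W_def using hi[OF that] hn[OF that] w0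
    by (intro integral_mono iJ iw) (auto simp: less_imp_le mult_left_le_one_le)
  \<comment> \<open>The infima increase as the tails shrink and stay below the integral of the
    weight, so they converge; their distance to the limit controls the Cauchy estimate.\<close>
  define j where "j n = Inf (J ` Collect (mid_hull f n))" for n
  have bdd: "bdd_below (J ` X)" for X using J0 by (auto intro!: bdd_belowI[of _ 0])
  have ne: "J ` Collect (mid_hull f n) \<noteq> {}" for n using mid_hull.base[of n n f] by auto
  have j_le: "j n \<le> J g" if "mid_hull f n g" for n g
    unfolding j_def using that by (intro cInf_lower bdd) auto
  have j_mono: "j n \<le> j m" if "n \<le> m" for n m
    unfolding j_def[of m] using mid_hull_mono[OF _ that] by (intro cInf_greatest[OF ne]) (auto intro: j_le)
  have jW: "j n \<le> W" for n
    using j_le[OF mid_hull.base[of n n]] JW[OF mid_hull.base[of n n]] by auto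
  have "convergent j"
    by (rule incseq_convergent[of j W, THEN exE]) (auto simp: incseq_def j_mono jW convergent_def)
  then obtain jl where jl: "j \<longlonglongrightarrow> jl" by (auto simp: convergent_def)
  have j_jl: "j n \<le> jl" for n
    by (rule LIMSEQ_le_const[OF jl]) (auto intro: j_mono)
  have "\<exists>g. mid_hull f n g \<and> J g < j n + 1 / real (Suc n)" for n
  proof -
    have "\<exists>y\<in>J ` Collect (mid_hull f n). y < j n + 1 / real (Suc n)"
      unfolding j_def by (rule cInf_lessD[OF ne]) simp
    then show ?thesis by auto
  qed
  then obtain g where g: "\<And>n. mid_hull f n (g n)" "\<And>n. J (g n) < j n + 1 / real (Suc n)" by metis
  have mg[measurable]: "g n \<in> borel_measurable lebesgue" for n using hi[OF g(1)] by auto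
  note g0 = hn[OF g(1)]
  define u where "u n x = exp (- g n x / 2)" for n x
  have u01: "0 < u n x" "u n x \<le> 1" for n x using g0 by (auto simp: u_def)
  have mu[measurable]: "u n \<in> borel_measurable lebesgue" for n unfolding u_def[abs_def] by measurable
  have du: "\<bar>u n x - u m x\<bar> \<le> 1" for n m x using u01[of n x] u01[of m x] by linarith
  have isq: "integrable lebesgue (\<lambda>x. (u n x - u m x)\<^sup>2 * w x)" for n m
    by (rule integrable_AE_bound[OF iw])
      (use du w0 in \<open>auto simp: abs_mult less_imp_le abs_square_le_1 intro!: mult_left_le_one_le\<close>)
  have sq: "(LINT x|lebesgue. (u n x - u m x)\<^sup>2 * w x) \<le> (jl - j n) + 2 / real (Suc n)" if "n \<le> m" for n m
  proof -
    let ?h = "\<lambda>x. (g n x + g m x) / 2"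
    have mid: "mid_hull f n ?h" by (intro mid_hull.mid g mid_hull_mono[OF g(1) that])
    have "(u n x - u m x)\<^sup>2 * w x = exp (- g n x) * w x + exp (- g m x) * w x - 2 * (exp (- ?h x) * w x)" for x
    proof -
      have "(u n x)\<^sup>2 = exp (- g n x)" "(u m x)\<^sup>2 = exp (- g m x)" "u n x * u m x = exp (- ?h x)"
        by (auto simp: u_def power2_eq_square add_divide_distrib simp flip: exp_add)
      then show ?thesis by (simp add: power2_diff algebra_simps)
    qed
    moreover have "integrable lebesgue (\<lambda>x. exp (- ?h x) * w x)" "integrable lebesgue (\<lambda>x. exp (- g k x) * w x)" for k
      using g0 by (auto intro!: iJ)
    ultimately have "(LINT x|lebesgue. (u n x - u m x)\<^sup>2 * w x) = J (g n) + J (g m) - 2 * J ?h"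
      unfolding J_def by simp
    also have "\<dots> \<le> (j n + 1 / real (Suc n)) + (j m + 1 / real (Suc m)) - 2 * j n"
      using g(2)[of n] g(2)[of m] j_le[OF mid] by linarith
    also have "1 / real (Suc m) \<le> 1 / real (Suc n)" using that by (intro frac_le) auto
    finally show ?thesis using j_jl[of m] by (simp add: add_divide_distrib)
  qed
  \<comment> \<open>Weighted L^2 smallness becomes L^1 smallness through |d| \<le> e + d^2/e, where
    the first term costs only e times the total weight.\<close>
  have d1: "(LINT x|lebesgue. norm (u n x * w x - u m x * w x)) \<le> e * W + (LINT x|lebesgue. (u n x - u m x)\<^sup>2 * w x) / e" if "0 < e" for n m e
  proof -
    have "(LINT x|lebesgue. norm (u n x * w x - u m x * w x)) \<le> (LINT x|lebesgue. e * w x + (u n x - u m x)\<^sup>2 * w x / e)"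
    proof (rule integral_mono)
      show "integrable lebesgue (\<lambda>x. norm (u n x * w x - u m x * w x))"
        by (rule integrable_AE_bound[OF iw])
          (use du w0 in \<open>auto simp: abs_mult less_imp_le mult_left_le_one_le simp flip: left_diff_distrib\<close>)
      show "norm (u n x * w x - u m x * w x) \<le> e * w x + (u n x - u m x)\<^sup>2 * w x / e" for x
      proof -
        have "e * \<bar>d\<bar> \<le> e\<^sup>2 + d\<^sup>2" for d :: real
        proof -
          have "0 \<le> (\<bar>d\<bar> - e)\<^sup>2" "0 \<le> \<bar>d\<bar> * e" using that by auto
          then show ?thesis unfolding power2_diff power2_abs by (simp add: mult.commute)
        qed
        then have "\<bar>d\<bar> \<le> e + d\<^sup>2 / e" for d :: real
          using that by (simp add: field_simps power2_eq_square)
        then have "\<bar>u n x - u m x\<bar> \<le> e + (u n x - u m x)\<^sup>2 / e" .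
        from mult_right_mono[OF this less_imp_le[OF w0[of x]]] show ?thesis
          using w0[of x] by (simp add: abs_mult distrib_right flip: left_diff_distrib)
      qed
    qed (use iw isq in auto)
    then show ?thesis using iw isq by (simp add: W_def)
  qed
  have iuw: "integrable lebesgue (\<lambda>x. u n x * w x)" for n
    by (rule integrable_AE_bound[OF iw]) (use u01 w0 in \<open>auto simp: abs_mult less_imp_le mult_left_le_one_le\<close>)
  have cauchy: "\<exists>N. \<forall>n\<ge>N. \<forall>m\<ge>N. (LINT x|lebesgue. norm (u n x * w x - u m x * w x)) < e" if "0 < e" for e
  proof -
    define d where "d = e / (2 * (W + 1))"
    have d: "0 < d" using that W0 by (auto simp: d_def)
    have dW: "d * W \<le> e / 2" using that W0 by (simp add: d_def field_simps)
    have "(\<lambda>n. (jl - j n) + 2 / real (Suc n)) \<longlonglongrightarrow> (jl - jl) + 0"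
      by (intro tendsto_intros jl LIMSEQ_Suc[OF lim_const_over_n])
    then have "eventually (\<lambda>n. (jl - j n) + 2 / real (Suc n) < d * (e / 2)) sequentially"
      by (rule order_tendstoD) (use d that in auto)
    then obtain N where N: "\<And>n. n \<ge> N \<Longrightarrow> (jl - j n) + 2 / real (Suc n) < d * (e / 2)"
      by (auto simp: eventually_sequentially)
    have *: "(LINT x|lebesgue. norm (u n x * w x - u m x * w x)) < e" if "N \<le> n" "n \<le> m" for n m
    proof -
      have "(LINT x|lebesgue. (u n x - u m x)\<^sup>2 * w x) / d < e / 2"
        using sq[OF that(2)] N[OF that(1)] d by (simp add: divide_less_eq mult.commute)
      then show ?thesis using d1[OF d, of n m] dW by linarith
    qed
    have "(LINT x|lebesgue. norm (u n x * w x - u m x * w x)) < e" if "N \<le> n" "N \<le> m" for n m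
      using *[of n m] *[of m n] that by (cases "n \<le> m") (auto simp: norm_minus_commute abs_minus_commute)
    then show ?thesis by blast
  qed
  obtain r where r: "strict_mono r" "AE x in lebesgue. Cauchy (\<lambda>i. u (r i) x * w x)"
    using cauchy_L1_AE_cauchy_subseq[of lebesgue "\<lambda>n x. u n x * w x", OF iuw cauchy] by auto
  have "(\<integral>\<^sup>+x. liminf (\<lambda>n. ennreal (g (r n) x)) \<partial>lebesgue) \<le> liminf (\<lambda>n. \<integral>\<^sup>+x. ennreal (g (r n) x) \<partial>lebesgue)"
    by (rule nn_integral_liminf) measurable
  also have "\<dots> \<le> ennreal C"
  proof (rule liminf_le_ennreal)
    show "(\<integral>\<^sup>+x. ennreal (g (r n) x) \<partial>lebesgue) \<le> ennreal C" for n
      using hi[OF g(1)] g0 hC[OF g(1)] by (subst nn_integral_eq_integral) (auto intro: ennreal_leI)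
  qed
  finally have "(\<integral>\<^sup>+x. liminf (\<lambda>n. ennreal (g (r n) x)) \<partial>lebesgue) \<noteq> \<infinity>" by (auto simp: top_unique)
  \<comment> \<open>A finite limit inferior rules out that exp(-g/2) tends to 0, so the logarithm of
    its limit may be taken.\<close>
  then have fin: "AE x in lebesgue. liminf (\<lambda>n. ennreal (g (r n) x)) \<noteq> \<infinity>"
    by (rule nn_integral_PInf_AE[rotated]) measurable
  have "AE x in lebesgue. convergent (\<lambda>n. g (r n) x)"
    using r(2) fin
  proof eventually_elim
    case (elim x)
    then obtain v where "(\<lambda>i. u (r i) x * w x) \<longlonglongrightarrow> v" by (auto simp: Cauchy_convergent_iff convergent_def)
    then have "(\<lambda>i. u (r i) x * w x / w x) \<longlonglongrightarrow> v / w x" using w0[of x] by (intro tendsto_intros) auto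
    then have v: "(\<lambda>i. u (r i) x) \<longlonglongrightarrow> v / w x" using w0[of x] by simp
    have "0 \<le> v / w x" by (rule LIMSEQ_le_const[OF v]) (auto simp: u01 less_imp_le)
    moreover have "v / w x \<noteq> 0"
    proof
      assume z: "v / w x = 0"
      have "eventually (\<lambda>n. real K \<le> g (r n) x) sequentially" for K :: nat
      proof -
        have "eventually (\<lambda>n. u (r n) x < exp (- real K / 2)) sequentially"
          by (rule order_tendstoD(2)[OF v]) (simp add: z)
        then show ?thesis by eventually_elim (simp add: u_def)
      qed
      then show False using liminf_top_of_tendsto[of "\<lambda>n. g (r n) x"] elim(2) by simp
    qed
    ultimately have "(\<lambda>i. - 2 * ln (u (r i) x)) \<longlonglongrightarrow> - 2 * ln (v / w x)"
      by (intro tendsto_intros v) auto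
    moreover have "- 2 * ln (u (r i) x) = g (r i) x" for i by (simp add: u_def)
    ultimately show ?case by (auto simp: convergent_def)
  qed
  moreover have "mid_hull f n (g (r n))" for n
    using mid_hull_mono[OF g(1)] seq_suble[OF r(1)] by blast
  ultimately show ?thesis by (intro exI[of _ "\<lambda>n. g (r n)"]) auto
qed

text \<open>Above height \<open>l\<close> the factor t^(1-\<gamma>) is at most l^(1-\<gamma>). This
  is how a bound in L^\<gamma> turns into uniform integrability.\<close>

lemma le_threshold_powr:
  fixes t \<gamma> l :: real
  assumes "0 \<le> t" "0 < l" "1 < \<gamma>"
  shows "t \<le> min t l + l powr (1 - \<gamma>) * t powr \<gamma>"
proof (cases "t \<le> l")
  case False
  have "t powr (1 - \<gamma>) \<le> l powr (1 - \<gamma>)"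
    using False assms by (intro powr_mono2') auto
  then have "t powr (1 - \<gamma>) * t powr \<gamma> \<le> l powr (1 - \<gamma>) * t powr \<gamma>" by (rule mult_right_mono) simp
  then show ?thesis using False assms by (simp flip: powr_add)
qed (use assms in auto)

text \<open>Young's inequality without sharp constants: depending on whether \<open>b\<close>
  exceeds \<open>l * a powr (\<gamma> - 1)\<close>, one of the two summands alone suffices. The free
  parameter makes the bounded L^\<gamma> term as small as desired.\<close>

lemma young_threshold:
  fixes a b l \<gamma> :: real
  assumes "0 \<le> a" "0 \<le> b" "0 < l" "1 < \<gamma>"
  shows "a * b \<le> l * a powr \<gamma> + l powr (- 1 / (\<gamma> - 1)) * b powr (\<gamma> / (\<gamma> - 1))"
proof (cases "b \<le> l * a powr (\<gamma> - 1)")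
  case True
  then have "a * b \<le> a * (l * a powr (\<gamma> - 1))" using assms by (intro mult_left_mono) auto
  also have "\<dots> = l * a powr \<gamma>" using assms by (cases "a = 0") (auto simp: powr_diff)
  finally show ?thesis using assms by (simp add: add_increasing2)
next
  case False
  have bl: "0 < b / l" using False assms by (smt (verit) divide_pos_pos mult_nonneg_nonneg powr_ge_zero)
  have "a powr (\<gamma> - 1) \<le> b / l" using False assms by (simp add: field_simps)
  then have "(a powr (\<gamma> - 1)) powr (1 / (\<gamma> - 1)) \<le> (b / l) powr (1 / (\<gamma> - 1))"
    using assms by (intro powr_mono2) auto
  then have "a \<le> (b / l) powr (1 / (\<gamma> - 1))" using assms by (simp add: powr_powr)
  then have "a * b \<le> (b / l) powr (1 / (\<gamma> - 1)) * b" using assms by (intro mult_right_mono) auto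
  also have "\<dots> = l powr (- 1 / (\<gamma> - 1)) * (b powr (1 / (\<gamma> - 1)) * b powr 1)"
    using bl assms by (simp add: powr_divide powr_minus_divide)
  also have "b powr (1 / (\<gamma> - 1)) * b powr 1 = b powr (\<gamma> / (\<gamma> - 1))"
  proof -
    have "1 / (\<gamma> - 1) + 1 = \<gamma> / (\<gamma> - 1)" using assms by (simp add: field_simps)
    then show ?thesis by (simp only: powr_add[symmetric])
  qed
  finally show ?thesis using assms by (simp add: add_increasing)
qed

lemma integral_bounded_subset_le:
  fixes f :: "'a \<Rightarrow> real"
  assumes f: "integrable M f" "integrable M (\<lambda>x. f x powr \<gamma>)" "\<And>x. 0 \<le> f x" and g: "1 < \<gamma>" and l: "0 < l"
    and E: "E \<in> fmeasurable M"
  shows "(LINT x|M. f x * indicator E x) \<le> l * measure M E + l powr (1 - \<gamma>) * (LINT x|M. f x powr \<gamma>)"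
proof -
  have E': "E \<in> sets M" "integrable M (indicator E :: _ \<Rightarrow> real)"
    using E by (auto simp: fmeasurable_def top.not_eq_extremum integrable_indicator_iff)
  have "(LINT x|M. f x * indicator E x) \<le> (LINT x|M. l * indicator E x + l powr (1 - \<gamma>) * f x powr \<gamma>)"
  proof (rule integral_mono)
    show "integrable M (\<lambda>x. f x * indicator E x)"
      using integrable_mult_indicator[OF E'(1) f(1)] by (simp add: mult.commute)
    show "integrable M (\<lambda>x. l * indicator E x + l powr (1 - \<gamma>) * f x powr \<gamma>)" using E' f by auto
    show "f x * indicator E x \<le> l * indicator E x + l powr (1 - \<gamma>) * f x powr \<gamma>" for x
      using le_threshold_powr[OF f(3) l g, of x] by (auto simp: indicator_def)
  qed
  also have "\<dots> = l * measure M E + l powr (1 - \<gamma>) * (LINT x|M. f x powr \<gamma>)"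
    using E' f sets.sets_into_space[OF E'(1)] by (simp add: Int_absorb2)
  finally show ?thesis .
qed

lemma threshold_small:
  fixes \<gamma> C e :: real
  assumes "1 < \<gamma>" "0 \<le> C" "0 < e"
  obtains l where "0 < l" "l powr (1 - \<gamma>) * C < e"
proof -
  have "((\<lambda>l. l powr (1 - \<gamma>) * C) \<longlongrightarrow> 0 * C) at_top"
    using assms by (intro tendsto_intros tendsto_neg_powr filterlim_ident) auto
  then have "eventually (\<lambda>l. l powr (1 - \<gamma>) * C < e) at_top"
    by (rule order_tendstoD) (use assms in auto)
  then have "eventually (\<lambda>l. 0 < l \<and> l powr (1 - \<gamma>) * C < e) at_top"
    using eventually_gt_at_top[of 0] by eventually_elim auto
  then show ?thesis using that by (auto simp: eventually_at_top_linorder)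
qed

text \<open>An open set containing \<open>E\<close> with little excess is a countable union of basic
  sets, finitely many of which exhaust it in measure. The finite unions form a countable family that
  is dense in measure.\<close>

lemma lebesgue_finite_union_approx:
  fixes B :: "'a::euclidean_space set set"
  assumes B: "countable B" "topological_basis B" and E: "E \<in> lmeasurable" and "0 < e"
  obtains U where "finite U" "U \<subseteq> B" "sym_diff E (\<Union>U) \<in> lmeasurable" "measure lebesgue (sym_diff E (\<Union>U)) < e"
proof -
  have Es: "E \<in> sets lebesgue" using E by auto
  obtain T where T: "open T" "E \<subseteq> T" "T - E \<in> lmeasurable" "emeasure lebesgue (T - E) < ennreal (e / 2)"
    using sets_lebesgue_outer_open[OF Es, of "e / 2"] \<open>0 < e\<close> by auto
  have T_eq: "T = E \<union> (T - E)" using T(2) by auto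
  have Tm: "T \<in> lmeasurable" by (subst T_eq) (intro fmeasurable.Un E T)
  have mTE: "measure lebesgue (T - E) < e / 2"
    using T(3,4) \<open>0 < e\<close> by (simp add: emeasure_eq_measure2 ennreal_less_iff)
  obtain B' where B': "B' \<subseteq> B" "\<Union>B' = T" using B(2) T(1) unfolding topological_basis_def by meson
  have openB: "open b" if "b \<in> B" for b using topological_basis_open[OF B(2) that] .
  show ?thesis
  proof (cases "B' = {}")
    case True
    then have "measure lebesgue (sym_diff E (\<Union>{})) < e" using T(2) B'(2) \<open>0 < e\<close> by auto
    then show ?thesis using that[of "{}"] E by auto
  next
    case False
    have "countable B'" using B(1) B'(1) countable_subset by blast
    then have rb: "range (from_nat_into B') = B'" using False by (simp add: range_from_nat_into)
    define V where "V n = \<Union>(from_nat_into B' ` {..n})" for n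
    have inc: "incseq V" unfolding V_def incseq_def by fastforce
    have VB: "from_nat_into B' ` {..n} \<subseteq> B" for n using rb B'(1) by auto
    have Vs: "V n \<in> sets lebesgue" for n
    proof -
      have "open (V n)" unfolding V_def using openB VB[of n] by (intro open_Union) auto
      then have "V n \<in> sets lborel" by simp
      then show ?thesis by (rule sets_completionI_sets)
    qed
    have UV: "(\<Union>n. V n) = T"
    proof -
      have "(\<Union>n. V n) = \<Union>(range (from_nat_into B'))" unfolding V_def by auto
      then show ?thesis using rb B'(2) by simp
    qed
    have "(\<lambda>n. measure lebesgue (V n)) \<longlonglongrightarrow> measure lebesgue (\<Union>n. V n)"
      using Tm UV by (intro Lim_measure_incseq inc) (use Vs in \<open>auto simp: fmeasurable_def top.not_eq_extremum\<close>)
    then have "eventually (\<lambda>n. measure lebesgue T - e / 2 < measure lebesgue (V n)) sequentially"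
      using \<open>0 < e\<close> UV by (intro order_tendstoD) auto
    then obtain n where n: "measure lebesgue T - e / 2 < measure lebesgue (V n)"
      by (auto simp: eventually_sequentially)
    have VT: "V n \<subseteq> T" using UV by auto
    have Vm: "V n \<in> lmeasurable" using Tm VT Vs by (rule fmeasurableI2)
    have "measure lebesgue (sym_diff E (V n)) \<le> measure lebesgue ((T - E) \<union> (T - V n))"
      using T(2,3) VT Vm Tm E by (intro measure_mono_fmeasurable) auto
    also have "\<dots> \<le> measure lebesgue (T - E) + measure lebesgue (T - V n)"
      using T(3) Tm Vm by (intro measure_Un_le) auto
    also have "measure lebesgue (T - V n) = measure lebesgue T - measure lebesgue (V n)"
      using Tm Vm VT by (simp add: measurable_measure_Diff)
    finally have "measure lebesgue (sym_diff E (V n)) < e" using n mTE by linarith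
    moreover have "sym_diff E (V n) \<in> lmeasurable"
      using E Vm by (intro fmeasurable.Un fmeasurable_Diff) auto
    ultimately show ?thesis using that[of "from_nat_into B' ` {..n}"] VB by (auto simp: V_def)
  qed
qed

text \<open>Diagonal extraction settles the countably many finite unions of basic open sets. The
  L^\<gamma> bound makes integrals over sets of small measure uniformly small, which transfers
  convergence to every set of finite measure.\<close>

lemma subsequence_convergent_on_sets:
  fixes f :: "nat \<Rightarrow> 'a::euclidean_space \<Rightarrow> real"
  assumes i: "\<And>n. integrable lebesgue (f n)" and nn: "\<And>n x. 0 \<le> f n x" and C: "\<And>n. (LINT x|lebesgue. f n x) \<le> C"
    and ig: "\<And>n. integrable lebesgue (\<lambda>x. f n x powr \<gamma>)" and Cg: "\<And>n. (LINT x|lebesgue. f n x powr \<gamma>) \<le> C"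
    and \<gamma>: "1 < \<gamma>"
  obtains s where "strict_mono s" "\<And>E. E \<in> lmeasurable \<Longrightarrow> convergent (\<lambda>i. LINT x|lebesgue. f (s i) x * indicator E x)"
proof -
  obtain B :: "'a set set" where B: "countable B" "topological_basis B"
    using ex_countable_basis by blast
  define \<U> where "\<U> = {U. U \<subseteq> B \<and> finite U}"
  have c\<U>: "countable \<U>" unfolding \<U>_def using countable_Collect_finite_subset[OF B(1)] by (simp add: conj_commute)
  have r\<U>: "range (from_nat_into \<U>) = \<U>" using c\<U> by (intro range_from_nat_into) (auto simp: \<U>_def)
  define V where "V k = \<Union>(from_nat_into \<U> k)" for k
  have UB: "from_nat_into \<U> k \<subseteq> B" for k using r\<U> by (auto simp: \<U>_def)
  have V[measurable]: "V k \<in> sets lebesgue" for k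
  proof -
    have "open (V k)" unfolding V_def using UB topological_basis_open[OF B(2)] by (intro open_Union) blast
    then have "V k \<in> sets lborel" by simp
    then show ?thesis by (rule sets_completionI_sets)
  qed
  have "0 \<le> (LINT x|lebesgue. f 0 x)" using nn by (intro integral_nonneg_AE) auto
  then have C0: "0 \<le> C" using C[of 0] by linarith
  have iE: "integrable lebesgue (\<lambda>x. f n x * indicator E x)" if "E \<in> sets lebesgue" for n E
    using integrable_mult_indicator[OF that i[of n]] by (simp add: mult.commute)
  define X where "X k n = (LINT x|lebesgue. f n x * indicator (V k) x)" for k n
  have X: "\<bar>X k n\<bar> \<le> C" for k n
  proof -
    have "0 \<le> X k n" unfolding X_def using nn by (intro integral_nonneg_AE) auto
    moreover have "X k n \<le> (LINT x|lebesgue. f n x)"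
      unfolding X_def using nn by (intro integral_mono iE i) (auto simp: indicator_def)
    ultimately show ?thesis using C[of n] by simp
  qed
  interpret subseqs "\<lambda>k s. convergent (\<lambda>i. X k (s i))"
  proof
    fix k and s :: "nat \<Rightarrow> nat"
    assume "strict_mono s"
    have "bounded (range (\<lambda>i. X k (s i)))"
      unfolding bounded_iff by (rule exI[of _ C]) (use X in auto)
    then obtain l r where "strict_mono r" "((\<lambda>i. X k (s i)) \<circ> r) \<longlonglongrightarrow> l"
      using bounded_imp_convergent_subsequence by metis
    then show "\<exists>r'. strict_mono r' \<and> convergent (\<lambda>i. X k ((s \<circ> r') i))"
      by (auto simp: comp_def convergent_def)
  qed
  have XC: "convergent (\<lambda>i. X k (diagseq i))" for k
  proof -
    \<comment> \<open>The diagonal sequence is known to be a subsequence of the extraction for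
      \<open>k\<close> from index \<open>Suc k\<close> on; convergence ignores this shift.\<close>
    have "convergent (\<lambda>i. X k ((diagseq \<circ> (+) (Suc k)) i))"
    proof (rule diagseq_holds)
      fix r s :: "nat \<Rightarrow> nat" and n
      assume "strict_mono r" "convergent (\<lambda>i. X n (s i))"
      then show "convergent (\<lambda>i. X n ((s \<circ> r) i))"
        using LIMSEQ_subseq_LIMSEQ[of "\<lambda>i. X n (s i)"] by (auto simp: convergent_def comp_def)
    qed
    then have "convergent (\<lambda>i. X k (diagseq (i + Suc k)))" by (simp add: comp_def add.commute)
    then show ?thesis by (rule convergent_ignore_initial_segment[THEN iffD1])
  qed
  show ?thesis
  proof (rule that[OF subseq_diagseq])
    fix E :: "'a set" assume E: "E \<in> lmeasurable"
    then have Es[measurable]: "E \<in> sets lebesgue" by auto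
    let ?Y = "\<lambda>n. LINT x|lebesgue. f n x * indicator E x"
    have "Cauchy (\<lambda>i. ?Y (diagseq i))"
    proof (rule metric_CauchyI)
      fix e :: real assume e: "0 < e"
      \<comment> \<open>The height comes first and brings the tall part below e/8. The symmetric
        difference is then taken with measure below e/(8 l), so that the rest costs another
        e/8.\<close>
      then obtain l where l: "0 < l" "l powr (1 - \<gamma>) * C < e / 8" using threshold_small[OF \<gamma> C0, of "e / 8"] by auto
      then obtain U where U: "finite U" "U \<subseteq> B" "sym_diff E (\<Union>U) \<in> lmeasurable" "measure lebesgue (sym_diff E (\<Union>U)) < e / (8 * l)"
        using lebesgue_finite_union_approx[OF B E, of "e / (8 * l)"] e by auto
      have "U \<in> \<U>" using U by (auto simp: \<U>_def)
      then obtain k where k: "\<Union>U = V k" using r\<U> unfolding V_def by (metis rangeE)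
      have close: "\<bar>?Y n - X k n\<bar> < e / 4" for n
      proof -
        have "\<bar>?Y n - X k n\<bar> = \<bar>LINT x|lebesgue. f n x * indicator E x - f n x * indicator (V k) x\<bar>"
          unfolding X_def using iE[OF Es, of n] iE[OF V, of n k] by simp
        also have "\<dots> \<le> (LINT x|lebesgue. \<bar>f n x * indicator E x - f n x * indicator (V k) x\<bar>)"
          using integral_norm_bound[of lebesgue "\<lambda>x. f n x * indicator E x - f n x * indicator (V k) x"] by simp
        also have "\<dots> = (LINT x|lebesgue. f n x * indicator (sym_diff E (\<Union>U)) x)"
          by (rule Bochner_Integration.integral_cong) (use nn k in \<open>auto simp: indicator_def\<close>)
        also have "\<dots> \<le> l * measure lebesgue (sym_diff E (\<Union>U)) + l powr (1 - \<gamma>) * (LINT x|lebesgue. f n x powr \<gamma>)"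
          by (rule integral_bounded_subset_le[OF i ig nn \<gamma> l(1) U(3)])
        also have "\<dots> \<le> l * (e / (8 * l)) + l powr (1 - \<gamma>) * C"
          using U(4) l Cg[of n] by (intro add_mono mult_left_mono) auto
        also have "\<dots> < e / 4" using l by (simp add: field_simps)
        finally show ?thesis .
      qed
      have "Cauchy (\<lambda>i. X k (diagseq i))" using XC[of k] by (rule convergent_Cauchy)
      then obtain N where N: "\<And>m n. N \<le> m \<Longrightarrow> N \<le> n \<Longrightarrow> dist (X k (diagseq m)) (X k (diagseq n)) < e / 4"
        using metric_CauchyD[of _ "e / 4"] e by (metis divide_pos_pos zero_less_numeral)
      have "dist (?Y (diagseq m)) (?Y (diagseq n)) < e" if "N \<le> m" "N \<le> n" for m n
        using N[OF that] close[of "diagseq m"] close[of "diagseq n"] unfolding dist_real_def by linarith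
      then show "\<exists>N. \<forall>m\<ge>N. \<forall>n\<ge>N. dist (?Y (diagseq m)) (?Y (diagseq n)) < e" by blast
    qed
    then show "convergent (\<lambda>i. ?Y (diagseq i))" by (simp add: Cauchy_convergent_iff)
  qed
qed

text \<open>Vitali's argument: on a set of finite measure the truncations at height \<open>l\<close>
  converge by domination, and the excess above \<open>l\<close> is uniformly small by the L^\<gamma>
  bound.\<close>

lemma tendsto_integral_finite_set:
  fixes g :: "nat \<Rightarrow> 'a \<Rightarrow> real"
  assumes i: "\<And>n. integrable M (g n)" and nn: "\<And>n x. 0 \<le> g n x"
    and ig: "\<And>n. integrable M (\<lambda>x. g n x powr \<gamma>)" and Cg: "\<And>n. (LINT x|M. g n x powr \<gamma>) \<le> C"
    and iF: "integrable M F" and nnF: "\<And>x. 0 \<le> F x" and iFg: "integrable M (\<lambda>x. F x powr \<gamma>)"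
    and CF: "(LINT x|M. F x powr \<gamma>) \<le> C" and \<gamma>: "1 < \<gamma>"
    and lim: "AE x in M. (\<lambda>n. g n x) \<longlonglongrightarrow> F x" and E: "E \<in> fmeasurable M"
  shows "(\<lambda>n. LINT x|M. g n x * indicator E x) \<longlonglongrightarrow> (LINT x|M. F x * indicator E x)"
proof (rule LIMSEQ_I)
  fix e :: real assume e: "0 < e"
  have Es[measurable]: "E \<in> sets M" using E by auto
  note [measurable] = borel_measurable_integrable[OF i] borel_measurable_integrable[OF iF]
  have "0 \<le> (LINT x|M. F x powr \<gamma>)" by (intro integral_nonneg_AE) auto
  then have C0: "0 \<le> C" using CF by linarith
  obtain l where l: "0 < l" "l powr (1 - \<gamma>) * C < e / 3" using threshold_small[OF \<gamma> C0, of "e / 3"] e by auto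
  let ?t = "\<lambda>h x. min (h x) l * indicator E x :: real"
  have iE: "integrable M (\<lambda>x. l * indicator E x)"
    using E by (auto simp: fmeasurable_def top.not_eq_extremum integrable_indicator_iff)
  have "(\<lambda>n. LINT x|M. ?t (g n) x) \<longlonglongrightarrow> (LINT x|M. ?t F x)"
  proof (rule integral_dominated_convergence[OF _ _ iE])
    show "AE x in M. (\<lambda>n. ?t (g n) x) \<longlonglongrightarrow> ?t F x"
      using lim by eventually_elim (intro tendsto_intros)
    show "AE x in M. norm (?t (g n) x) \<le> l * indicator E x" for n
    proof (rule AE_I2)
      fix x show "norm (?t (g n) x) \<le> l * indicator E x" using nn[of n x] l(1) by (auto simp: indicator_def min_def)
    qed
  qed measurable
  from LIMSEQ_D[OF this, of "e / 3"] e
  obtain N where N: "\<And>n. N \<le> n \<Longrightarrow> \<bar>(LINT x|M. ?t (g n) x) - (LINT x|M. ?t F x)\<bar> < e / 3"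
    by auto
  have close: "\<bar>(LINT x|M. h x * indicator E x) - (LINT x|M. ?t h x)\<bar> < e / 3"
    if h: "integrable M h" "\<And>x. 0 \<le> h x" "integrable M (\<lambda>x. h x powr \<gamma>)" "(LINT x|M. h x powr \<gamma>) \<le> C" for h
  proof -
    note [measurable] = borel_measurable_integrable[OF h(1)]
    have it: "integrable M (?t h)"
    proof (rule integrable_AE_bound[OF iE])
      show "AE x in M. norm (?t h x) \<le> l * indicator E x"
      proof (rule AE_I2)
        fix x show "norm (?t h x) \<le> l * indicator E x" using h(2)[of x] l(1) by (auto simp: indicator_def min_def)
      qed
    qed measurable
    have ih: "integrable M (\<lambda>x. h x * indicator E x)"
      using integrable_mult_indicator[OF Es h(1)] by (simp add: mult.commute)
    have "(LINT x|M. h x * indicator E x) \<le> (LINT x|M. ?t h x + l powr (1 - \<gamma>) * h x powr \<gamma>)"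
    proof (rule integral_mono)
      show "h x * indicator E x \<le> ?t h x + l powr (1 - \<gamma>) * h x powr \<gamma>" for x
        using le_threshold_powr[OF h(2) l(1) \<gamma>, of x] by (auto simp: indicator_def)
    qed (use it ih h in auto)
    also have "\<dots> = (LINT x|M. ?t h x) + l powr (1 - \<gamma>) * (LINT x|M. h x powr \<gamma>)"
      using it h by simp
    also have "\<dots> \<le> (LINT x|M. ?t h x) + l powr (1 - \<gamma>) * C"
      using h(4) by (intro add_left_mono mult_left_mono) auto
    finally have 1: "(LINT x|M. h x * indicator E x) < (LINT x|M. ?t h x) + e / 3" using l(2) by linarith
    have "(LINT x|M. ?t h x) \<le> (LINT x|M. h x * indicator E x)"
      by (rule integral_mono[OF it ih]) (auto simp: indicator_def)
    then show ?thesis using 1 by linarith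
  qed
  have "norm ((LINT x|M. g n x * indicator E x) - (LINT x|M. F x * indicator E x)) < e" if "N \<le> n" for n
    using N[OF that] close[OF i nn ig Cg, of n] close[OF iF nnF iFg CF] unfolding real_norm_def by linarith
  then show "\<exists>N. \<forall>n\<ge>N. norm ((LINT x|M. g n x * indicator E x) - (LINT x|M. F x * indicator E x)) < e" by blast
qed

text \<open>Sets of finite measure suffice as tests: simple functions follow by linearity, and
  increasing limits through Young's inequality, whose error is uniform in \<open>n\<close> because
  the \<gamma> integrals are bounded by \<open>C\<close>.\<close>

lemma weak_convergence_extend:
  fixes f :: "nat \<Rightarrow> 'a \<Rightarrow> real" and h :: "'a \<Rightarrow> real"
  assumes m: "\<And>n. f n \<in> borel_measurable M" and nn: "\<And>n x. 0 \<le> f n x"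
    and ig: "\<And>n. integrable M (\<lambda>x. f n x powr \<gamma>)" and Cg: "\<And>n. (LINT x|M. f n x powr \<gamma>) \<le> C"
    and mF: "F \<in> borel_measurable M" and nnF: "\<And>x. 0 \<le> F x" and iFg: "integrable M (\<lambda>x. F x powr \<gamma>)"
    and CF: "(LINT x|M. F x powr \<gamma>) \<le> C" and \<gamma>: "1 < \<gamma>"
    and conv: "\<And>E. E \<in> fmeasurable M \<Longrightarrow> (\<lambda>n. LINT x|M. f n x * indicator E x) \<longlonglongrightarrow> (LINT x|M. F x * indicator E x)"
    and h: "h \<in> borel_measurable M" "integrable M (\<lambda>x. \<bar>h x\<bar> powr (\<gamma> / (\<gamma> - 1)))"
  shows "(\<lambda>n. LINT x|M. f n x * h x) \<longlonglongrightarrow> (LINT x|M. F x * h x)"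
proof -
  define q where "q = \<gamma> / (\<gamma> - 1)"
  have q: "1 < q" using \<gamma> by (simp add: q_def field_simps)
  have "0 \<le> (LINT x|M. F x powr \<gamma>)" by (intro integral_nonneg_AE) auto
  then have C0: "0 \<le> C" using CF by linarith
  have prod: "integrable M (\<lambda>x. a x * b x) \<and> (LINT x|M. a x * b x) \<le> l * (LINT x|M. a x powr \<gamma>) + l powr (- 1 / (\<gamma> - 1)) * (LINT x|M. b x powr q)"
    if "a \<in> borel_measurable M" "\<And>x. 0 \<le> a x" "integrable M (\<lambda>x. a x powr \<gamma>)" "b \<in> borel_measurable M" "\<And>x. 0 \<le> b x"
      "integrable M (\<lambda>x. b x powr q)" "0 < l" for a b :: "'a \<Rightarrow> real" and l
  proof -
    note [measurable] = that(1,4)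
    have y: "a x * b x \<le> l * a x powr \<gamma> + l powr (- 1 / (\<gamma> - 1)) * b x powr q" for x
      unfolding q_def by (rule young_threshold) (use that \<gamma> in auto)
    have r: "integrable M (\<lambda>x. l * a x powr \<gamma> + l powr (- 1 / (\<gamma> - 1)) * b x powr q)" using that by auto
    have ab: "integrable M (\<lambda>x. a x * b x)"
      by (rule integrable_AE_bound[OF r]) (use y that in auto)
    show ?thesis using integral_mono[OF ab r y] ab that by simp
  qed
  \<comment> \<open>Integrability stands inside the induction formula as an implication, because the
    pieces of a test function obtain it only by comparison with the whole.\<close>
  have main: "integrable M (\<lambda>x. u x powr q) \<longrightarrow> (\<lambda>n. LINT x|M. f n x * u x) \<longlonglongrightarrow> (LINT x|M. F x * u x)"
    if "u \<in> borel_measurable M" "\<And>x. 0 \<le> u x" for u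
    using that
  proof (induction u rule: borel_measurable_induct_real)
    case (set A)
    have "(\<lambda>x. indicator A x powr q) = (indicator A :: 'a \<Rightarrow> real)" using q by (auto simp: indicator_def fun_eq_iff)
    then have "A \<in> fmeasurable M" if "integrable M (\<lambda>x. indicator A x powr q :: real)"
      using that set sets.sets_into_space[OF set] by (simp add: integrable_indicator_iff Int_absorb2 fmeasurable_def)
    then show ?case using conv by blast
  next
    case (mult u c)
    show ?case
    proof (cases "c = 0")
      case False
      show ?thesis
      proof
        assume "integrable M (\<lambda>x. (c * u x) powr q)"
        then have "integrable M (\<lambda>x. u x powr q)"
          using mult False by (simp add: powr_mult)
        then have "(\<lambda>n. c * (LINT x|M. f n x * u x)) \<longlonglongrightarrow> c * (LINT x|M. F x * u x)"
          using mult by (intro tendsto_intros) auto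
        then show "(\<lambda>n. LINT x|M. f n x * (c * u x)) \<longlonglongrightarrow> (LINT x|M. F x * (c * u x))"
          by (simp add: mult.left_commute[of _ c])
      qed
    qed simp
  next
    case (add u v)
    show ?case
    proof
      assume uv: "integrable M (\<lambda>x. (v x + u x) powr q)"
      have u: "integrable M (\<lambda>x. u x powr q)" and v: "integrable M (\<lambda>x. v x powr q)"
        using add.hyps q by (intro integrable_AE_bound[OF uv _ AE_I2]; auto intro!: powr_mono2)+
      have "(\<lambda>n. (LINT x|M. f n x * v x) + (LINT x|M. f n x * u x)) \<longlonglongrightarrow> (LINT x|M. F x * v x) + (LINT x|M. F x * u x)"
        using add.IH u v by (intro tendsto_add) auto
      moreover have "(LINT x|M. f n x * (v x + u x)) = (LINT x|M. f n x * v x) + (LINT x|M. f n x * u x)" for n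
        using prod[OF m nn ig add.hyps(1,2) u, of 1] prod[OF m nn ig add.hyps(3,4) v, of 1] by (simp add: distrib_left)
      moreover have "(LINT x|M. F x * (v x + u x)) = (LINT x|M. F x * v x) + (LINT x|M. F x * u x)"
        using prod[OF mF nnF iFg add.hyps(1,2) u, of 1] prod[OF mF nnF iFg add.hyps(3,4) v, of 1] by (simp add: distrib_left)
      ultimately show "(\<lambda>n. LINT x|M. f n x * (v x + u x)) \<longlonglongrightarrow> (LINT x|M. F x * (v x + u x))" by simp
    qed
  next
    case (seq U)
    show ?case
    proof
      assume iu: "integrable M (\<lambda>x. u x powr q)"
      note [measurable] = seq.hyps(1)
      have mu[measurable]: "u \<in> borel_measurable M"
        using borel_measurable_LIMSEQ_metric[OF seq.hyps(1) seq.hyps(4)] by simp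
      have U_le: "U k x \<le> u x" if "x \<in> space M" for k x
        using seq.hyps(3) seq.hyps(4)[OF that] by (intro incseq_le) (auto simp: incseq_def le_fun_def)
      have u0: "0 \<le> u x" if "x \<in> space M" for x using order_trans[OF seq.hyps(2) U_le[OF that]] .
      \<comment> \<open>The limit of the increasing functions is known only on
        \<open>space M\<close>; \<open>max 0\<close> keeps the remainder nonnegative everywhere, as
        the Young estimate demands.\<close>
      define D where "D k x = max 0 (u x - U k x)" for k x
      have D_eq: "D k x = u x - U k x" if "x \<in> space M" for k x using U_le[OF that] by (simp add: D_def)
      have mD[measurable]: "D k \<in> borel_measurable M" for k unfolding D_def[abs_def] by measurable
      have D_le: "D k x powr q \<le> u x powr q" if "x \<in> space M" for k x
        using D_eq[OF that] U_le[OF that] seq.hyps(2) q by (intro powr_mono2) (auto simp: D_def)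
      have iD: "integrable M (\<lambda>x. D k x powr q)" for k
        by (rule integrable_AE_bound[OF iu _ AE_I2]) (use D_le in auto)
      have iU: "integrable M (\<lambda>x. U k x powr q)" for k
        by (rule integrable_AE_bound[OF iu _ AE_I2]) (use U_le seq.hyps(2) q in \<open>auto intro!: powr_mono2\<close>)
      have D0: "(\<lambda>k. LINT x|M. D k x powr q) \<longlonglongrightarrow> (LINT x|M. 0)"
      proof (rule integral_dominated_convergence[OF _ _ iu])
        show "AE x in M. (\<lambda>k. D k x powr q) \<longlonglongrightarrow> 0"
        proof (rule AE_I2)
          fix x assume x: "x \<in> space M"
          have "(\<lambda>k. u x - U k x) \<longlonglongrightarrow> u x - u x" by (intro tendsto_intros seq.hyps(4)[OF x])
          then have "(\<lambda>k. D k x) \<longlonglongrightarrow> 0" by (simp add: D_eq[OF x])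
          then show "(\<lambda>k. D k x powr q) \<longlonglongrightarrow> 0"
            by (rule tendsto_zero_powrI[OF _ tendsto_const]) (use q in \<open>auto simp: D_def\<close>)
        qed
      qed (use D_le in \<open>auto intro!: AE_I2\<close>)
      show "(\<lambda>n. LINT x|M. f n x * u x) \<longlonglongrightarrow> (LINT x|M. F x * u x)"
      proof (rule LIMSEQ_I)
        fix e :: real assume e: "0 < e"
        \<comment> \<open>The weight is chosen first so that the term with the density costs at most
          e/6; then \<open>k\<close> brings the remainder of the test function below e/6 as well.
          Adding 1 to \<open>C\<close> avoids a zero denominator.\<close>
        define l where "l = e / (6 * (C + 1))"
        have l: "0 < l" using e C0 by (simp add: l_def)
        have lC: "l * C \<le> e / 6" using e C0 by (simp add: l_def field_simps)
        have "(\<lambda>k. l powr (- 1 / (\<gamma> - 1)) * (LINT x|M. D k x powr q)) \<longlonglongrightarrow> l powr (- 1 / (\<gamma> - 1)) * 0"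
          using D0 by (intro tendsto_intros) simp
        then have "eventually (\<lambda>k. l powr (- 1 / (\<gamma> - 1)) * (LINT x|M. D k x powr q) < e / 6) sequentially"
          by (rule order_tendstoD) (use e in auto)
        then obtain k where k: "l powr (- 1 / (\<gamma> - 1)) * (LINT x|M. D k x powr q) < e / 6"
          by (auto simp: eventually_sequentially)
        have close: "\<bar>(LINT x|M. a x * u x) - (LINT x|M. a x * U k x)\<bar> < e / 3"
          if a: "a \<in> borel_measurable M" "\<And>x. 0 \<le> a x" "integrable M (\<lambda>x. a x powr \<gamma>)" "(LINT x|M. a x powr \<gamma>) \<le> C" for a
        proof -
          note aD = prod[OF a(1-3) mD _ iD l, of k] and aU = prod[OF a(1-3) seq.hyps(1) seq.hyps(2) iU l, of k]
          have D00: "0 \<le> D k x" for x by (simp add: D_def)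
          have "(LINT x|M. a x * u x) = (LINT x|M. a x * D k x + a x * U k x)"
            by (rule Bochner_Integration.integral_cong) (auto simp: D_eq algebra_simps)
          also have "\<dots> = (LINT x|M. a x * D k x) + (LINT x|M. a x * U k x)" using aD[OF D00] aU by simp
          finally have eq: "(LINT x|M. a x * u x) - (LINT x|M. a x * U k x) = (LINT x|M. a x * D k x)" by simp
          have "0 \<le> (LINT x|M. a x * D k x)" using a(2) D00 by (intro integral_nonneg_AE) auto
          moreover have "(LINT x|M. a x * D k x) < e / 3"
          proof -
            have "l * (LINT x|M. a x powr \<gamma>) \<le> l * C" using l a(4) by (intro mult_left_mono) auto
            then show ?thesis using aD[OF D00, THEN conjunct2] lC k by linarith
          qed
          ultimately show ?thesis unfolding eq by simp
        qed
        have "(\<lambda>n. LINT x|M. f n x * U k x) \<longlonglongrightarrow> (LINT x|M. F x * U k x)" using seq.IH iU by blast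
        from LIMSEQ_D[OF this, of "e / 3"] e
        obtain N where N: "\<And>n. N \<le> n \<Longrightarrow> \<bar>(LINT x|M. f n x * U k x) - (LINT x|M. F x * U k x)\<bar> < e / 3" by auto
        have "norm ((LINT x|M. f n x * u x) - (LINT x|M. F x * u x)) < e" if "N \<le> n" for n
          using N[OF that] close[OF m nn ig Cg, of n] close[OF mF nnF iFg CF] unfolding real_norm_def by linarith
        then show "\<exists>N. \<forall>n\<ge>N. norm ((LINT x|M. f n x * u x) - (LINT x|M. F x * u x)) < e" by blast
      qed
    qed
  qed
  let ?p = "\<lambda>x. max 0 (h x)" and ?n = "\<lambda>x. max 0 (- h x)"
  note [measurable] = h(1)
  have ip: "integrable M (\<lambda>x. ?p x powr q)" and "in": "integrable M (\<lambda>x. ?n x powr q)"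
    using q by (intro integrable_AE_bound[OF h(2)[folded q_def] _ AE_I2]; auto intro!: powr_mono2)+
  have "(\<lambda>n. (LINT x|M. f n x * ?p x) - (LINT x|M. f n x * ?n x)) \<longlonglongrightarrow> (LINT x|M. F x * ?p x) - (LINT x|M. F x * ?n x)"
    using main[of ?p] main[of ?n] ip "in" by (intro tendsto_intros) auto
  moreover have "(LINT x|M. a x * ?p x) - (LINT x|M. a x * ?n x) = (LINT x|M. a x * h x)"
    if "a \<in> borel_measurable M" "\<And>x. 0 \<le> a x" "integrable M (\<lambda>x. a x powr \<gamma>)" for a
  proof -
    have "integrable M (\<lambda>x. a x * ?p x)" "integrable M (\<lambda>x. a x * ?n x)"
      using prod[OF that, of ?p 1] prod[OF that, of ?n 1] ip "in" by auto
    then have "(LINT x|M. a x * ?p x) - (LINT x|M. a x * ?n x) = (LINT x|M. a x * ?p x - a x * ?n x)" by simp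
    also have "\<dots> = (LINT x|M. a x * h x)" by (rule Bochner_Integration.integral_cong) (auto simp: max_def)
    finally show ?thesis .
  qed
  ultimately show ?thesis using m nn ig mF nnF iFg by simp
qed

lemma powr_midpoint_le:
  fixes a b \<gamma> :: real
  assumes "0 \<le> a" "0 \<le> b" "1 < \<gamma>"
  shows "((a + b) / 2) powr \<gamma> \<le> (a powr \<gamma> + b powr \<gamma>) / 2"
proof -
  have half: "(c / 2) powr \<gamma> \<le> c powr \<gamma> / 2" if "0 \<le> c" for c :: real
  proof -
    have "(2::real) powr 1 \<le> 2 powr \<gamma>" using assms by (intro powr_mono) auto
    then have "c powr \<gamma> / 2 powr \<gamma> \<le> c powr \<gamma> / 2" by (intro frac_le) auto
    then show ?thesis using that by (simp add: powr_divide)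
  qed
  consider "a = 0" | "b = 0" | "0 < a" "0 < b" using assms by linarith
  then show ?thesis
  proof cases
    case 3
    then have "((1 - 1/2) *\<^sub>R a + (1/2) *\<^sub>R b) powr \<gamma> \<le> (1 - 1/2) * a powr \<gamma> + (1/2) * b powr \<gamma>"
      using powr_convex[of \<gamma>] assms by (intro convex_onD[of "{0<..}" "\<lambda>x. x powr \<gamma>"]) auto
    then show ?thesis by (simp add: add_divide_distrib)
  qed (use half[of a] half[of b] assms in \<open>auto simp: algebra_simps\<close>)
qed

text \<open>The subsequence fixes the limits of integrals over sets, the hull fixes a
  representative, and the two agree because hull elements of a late tail have integrals close to the
  same limits. The formula for \<open>F\<close> is exported so that pointwise symmetries of the hull
  elements survive.\<close>

lemma weak_compactness:
  fixes f :: "nat \<Rightarrow> 'a::euclidean_space \<Rightarrow> real"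
  assumes i: "\<And>n. integrable lebesgue (f n)" and nn: "\<And>n x. 0 \<le> f n x" and C: "\<And>n. (LINT x|lebesgue. f n x) \<le> C"
    and ig: "\<And>n. integrable lebesgue (\<lambda>x. f n x powr \<gamma>)" and Cg: "\<And>n. (LINT x|lebesgue. f n x powr \<gamma>) \<le> C"
    and \<gamma>: "1 < \<gamma>"
  obtains s g F where "strict_mono s" "\<And>n. mid_hull (\<lambda>i. f (s i)) n (g n)" "F = (\<lambda>x. max 0 (lim (\<lambda>n. g n x)))"
    "AE x in lebesgue. (\<lambda>n. g n x) \<longlonglongrightarrow> F x" "integrable lebesgue F" "integrable lebesgue (\<lambda>x. F x powr \<gamma>)"
    "(LINT x|lebesgue. F x powr \<gamma>) \<le> C"
    "\<And>h. h \<in> borel_measurable lebesgue \<Longrightarrow> integrable lebesgue (\<lambda>x. \<bar>h x\<bar> powr (\<gamma> / (\<gamma> - 1))) \<Longrightarrow>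
      (\<lambda>i. LINT x|lebesgue. f (s i) x * h x) \<longlonglongrightarrow> (LINT x|lebesgue. F x * h x)"
proof -
  obtain s where s: "strict_mono s" "\<And>E. E \<in> lmeasurable \<Longrightarrow> convergent (\<lambda>i. LINT x|lebesgue. f (s i) x * indicator E x)"
    by (rule subsequence_convergent_on_sets[of f C \<gamma>, OF assms]) (rule that, auto)
  have "\<exists>g. (\<forall>n. mid_hull (\<lambda>i. f (s i)) n (g n)) \<and> (AE x in lebesgue. convergent (\<lambda>n. g n x))"
    by (rule mid_hull_AE_convergent) (rule i nn C)+
  then obtain g where g: "\<And>n. mid_hull (\<lambda>i. f (s i)) n (g n)" "AE x in lebesgue. convergent (\<lambda>n. g n x)"
    by (elim exE conjE) (rule that, auto)
  have powr_mid: "(\<lambda>t. t powr \<gamma>) \<in> borel_measurable borel" "0 \<le> t powr \<gamma>"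
    "\<And>a b. 0 \<le> a \<Longrightarrow> 0 \<le> b \<Longrightarrow> ((a + b) / 2) powr \<gamma> \<le> (a powr \<gamma> + b powr \<gamma>) / 2" for t
    using powr_midpoint_le \<gamma> by auto
  \<comment> \<open>Where the hull elements diverge, \<open>lim\<close> has an unspecified value,
    but one that depends only on the sequence of values. Points with equal sequences therefore
    receive equal values of \<open>F\<close>.\<close>
  define F where "F = (\<lambda>x. max 0 (lim (\<lambda>n. g n x)))"
  note hg = mid_hull_integral_bound[where M = lebesgue, OF powr_mid i nn ig Cg g(1)]
  have mg[measurable]: "g n \<in> borel_measurable lebesgue" for n using hg[of n] by auto
  have mF[measurable]: "F \<in> borel_measurable lebesgue" unfolding F_def by measurable
  have lim: "AE x in lebesgue. (\<lambda>n. g n x) \<longlonglongrightarrow> F x"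
    using g(2)
  proof eventually_elim
    case (elim x)
    then have l: "(\<lambda>n. g n x) \<longlonglongrightarrow> lim (\<lambda>n. g n x)" by (simp add: convergent_LIMSEQ_iff)
    then have "0 \<le> lim (\<lambda>n. g n x)" by (rule LIMSEQ_le_const) (use hg in auto)
    then show ?case using l by (simp add: F_def)
  qed
  have nnF: "0 \<le> F x" for x by (simp add: F_def)
  have iF: "integrable lebesgue F"
    by (rule mid_hull_limit_bound(1)[where \<Phi> = "\<lambda>t. t" and N = 0, OF _ _ _ _ i nn i C g(1) lim mF]) auto
  have iFg: "integrable lebesgue (\<lambda>x. F x powr \<gamma>)" and CF: "(LINT x|lebesgue. F x powr \<gamma>) \<le> C"
    by (rule mid_hull_limit_bound[where \<Phi> = "\<lambda>t. t powr \<gamma>" and N = 0, OF powr_mid _ i nn ig Cg g(1) lim mF];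
        use \<gamma> in \<open>auto intro!: tendsto_powr'\<close>)+
  have conv: "(\<lambda>i. LINT x|lebesgue. f (s i) x * indicator E x) \<longlonglongrightarrow> (LINT x|lebesgue. F x * indicator E x)" if E: "E \<in> lmeasurable" for E
  proof -
    have Es: "E \<in> sets lebesgue" using E by auto
    have iE: "integrable lebesgue (\<lambda>x. h x * indicator E x)" if "integrable lebesgue h" for h :: "'a \<Rightarrow> real"
      using integrable_mult_indicator[OF Es that] by (simp add: mult.commute)
    obtain l where l: "(\<lambda>i. LINT x|lebesgue. f (s i) x * indicator E x) \<longlonglongrightarrow> l" using s(2)[OF E] by (auto simp: convergent_def)
    have "(\<lambda>n. LINT x|lebesgue. g n x * indicator E x) \<longlonglongrightarrow> l"
    proof (rule LIMSEQ_I)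
      fix e :: real assume "0 < e"
      then have "0 < e / 2" by simp
      from LIMSEQ_D[OF l this]
      obtain N where N: "\<And>n. N \<le> n \<Longrightarrow> \<bar>(LINT x|lebesgue. f (s n) x * indicator E x) - l\<bar> < e / 2" by auto
      \<comment> \<open>Lying within e/2 of the limit is preserved by midpoints, so the whole hull
        of the tail from \<open>N\<close> on satisfies it.\<close>
      have "\<bar>(LINT x|lebesgue. h x * indicator E x) - l\<bar> < e / 2" if "mid_hull (\<lambda>i. f (s i)) N h" for h
        using that
      proof (induction rule: mid_hull.induct)
        case (mid h k)
        have "(LINT x|lebesgue. (h x + k x) / 2 * indicator E x) = (LINT x|lebesgue. (h x * indicator E x + k x * indicator E x) / 2)"
          by (simp add: distrib_right)
        also have "\<dots> = ((LINT x|lebesgue. h x * indicator E x) + (LINT x|lebesgue. k x * indicator E x)) / 2"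
          using iE mid_hull_integral_bound[where M = lebesgue, OF powr_mid i nn ig Cg mid.hyps(1)]
            mid_hull_integral_bound[where M = lebesgue, OF powr_mid i nn ig Cg mid.hyps(2)] by simp
        finally have eq: "(LINT x|lebesgue. (h x + k x) / 2 * indicator E x) = ((LINT x|lebesgue. h x * indicator E x) + (LINT x|lebesgue. k x * indicator E x)) / 2" .
        have "\<bar>(a + b) / 2 - l\<bar> < e / 2" if "\<bar>a - l\<bar> < e / 2" "\<bar>b - l\<bar> < e / 2" for a b
          using that unfolding add_divide_distrib by linarith
        then show ?case unfolding eq using mid.IH by blast
      qed (use N in auto)
      then have half: "\<bar>(LINT x|lebesgue. g n x * indicator E x) - l\<bar> < e / 2" if "N \<le> n" for n
        using mid_hull_mono[OF g(1) that] by blast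
      have "norm ((LINT x|lebesgue. g n x * indicator E x) - l) < e" if "N \<le> n" for n
      proof -
        from \<open>0 < e\<close> have "e / 2 < e" by simp
        with half[OF that] show ?thesis unfolding real_norm_def by (rule less_trans)
      qed
      then show "\<exists>N. \<forall>n\<ge>N. norm ((LINT x|lebesgue. g n x * indicator E x) - l) < e" by blast
    qed
    moreover have "(\<lambda>n. LINT x|lebesgue. g n x * indicator E x) \<longlonglongrightarrow> (LINT x|lebesgue. F x * indicator E x)"
      by (rule tendsto_integral_finite_set[where C = C and \<gamma> = \<gamma>, OF _ _ _ _ iF nnF iFg CF \<gamma> lim E]) (use hg in auto)
    ultimately show ?thesis using l LIMSEQ_unique by blast
  qed
  show ?thesis
  proof (rule that[OF s(1) g(1) F_def lim iF iFg CF])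
    fix h :: "'a \<Rightarrow> real"
    assume h: "h \<in> borel_measurable lebesgue" "integrable lebesgue (\<lambda>x. \<bar>h x\<bar> powr (\<gamma> / (\<gamma> - 1)))"
    show "(\<lambda>i. LINT x|lebesgue. f (s i) x * h x) \<longlonglongrightarrow> (LINT x|lebesgue. F x * h x)"
      by (rule weak_convergence_extend[OF _ _ _ _ mF nnF iFg CF \<gamma> conv h]) (use i nn ig Cg in auto)
  qed
qed

section \<open>Internal energy and rotational energy\<close>

locale rotating_star =
  fixes M K \<gamma> :: real and L L' p p' :: "real \<Rightarrow> real"
  assumes M_pos: "M > 0"
    and L_deriv: "\<And>m. m \<in> {0..M} \<Longrightarrow> (L has_real_derivative L' m) (at m within {0..M})"
    and L_nonneg: "\<And>m. m \<in> {0..M} \<Longrightarrow> L m \<ge> 0"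
    and L'_nonneg: "\<And>m. m \<in> {0..M} \<Longrightarrow> L' m \<ge> 0"
    and L_scale: "\<And>a m. 0 < a \<Longrightarrow> a \<le> 1 \<Longrightarrow> m \<in> {0..M} \<Longrightarrow> L (a * m) \<ge> a powr (4/3) * L m"
    and p_deriv: "\<And>s. s \<in> {0..} \<Longrightarrow> (p has_real_derivative p' s) (at s within {0..})"
    and p_integrable: "set_integrable lebesgue {0..1} (\<lambda>s. p s / s\<^sup>2)"
    and p_growth: "((\<lambda>s. p s / s powr \<gamma>) \<longlongrightarrow> K) at_top"
    and p_nonneg: "\<And>s. s \<ge> 0 \<Longrightarrow> p s \<ge> 0"
    and p'_pos: "\<And>s. s > 0 \<Longrightarrow> p' s > 0"
    and K_pos: "0 < K" and \<gamma>_ge: "\<gamma> \<ge> 4/3"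
    and inf_neg: "inf_energy p L M < 0"
    and coercive: "\<exists>C1>0. \<exists>C2>0. \<forall>\<rho>\<in>admissible p L M.
           (LINT x|lebesgue. internal_energy p (\<rho> x) + 1/2 * rotation_density L \<rho> x)
             \<le> C1 * energy p L \<rho> + C2"
begin

section \<open>The equation of state: convexity and growth of the internal energy\<close>

lemma \<gamma>_gt_1: "1 < \<gamma>" using \<gamma>_ge by simp

lemma p_mono:
  assumes "0 \<le> s" "s \<le> t"
  shows "p s \<le> p t"
proof (cases "s = t")
  case False
  have "\<exists>x\<in>{s<..<t}. p t - p s = (t - s) * p' x"
  proof (rule mvt_simple[where f' = "\<lambda>x h. h * p' x"])
    show "(p has_derivative (\<lambda>h. h * p' x)) (at x within {s..t})" if "s \<le> x" "x \<le> t" for x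
      using has_field_derivative_subset[OF p_deriv[of x], of "{s..t}"] that assms
      by (auto simp: has_field_derivative_def mult_commute_abs)
  qed (use False assms in auto)
  then obtain x where x: "s < x" "p t - p s = (t - s) * p' x" by auto
  have "0 \<le> (t - s) * p' x" using p'_pos[of x] x assms by (intro mult_nonneg_nonneg) auto
  then show ?thesis using x by linarith
qed simp

lemma p_continuous: "continuous_on {0..} p"
  using p_deriv by (intro DERIV_continuous_on) auto

abbreviation "A \<equiv> internal_energy p"

text \<open>This is the internal energy per unit mass; the thermodynamic enthalpy is the slope of
  \<open>A\<close>, namely \<open>enthalpy a + p a / a\<close>.\<close>

definition enthalpy :: "real \<Rightarrow> real" where
  "enthalpy r = (LINT s:{0..r}|lebesgue. p s / s\<^sup>2)"

lemma A_eq: "A r = r * enthalpy r"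
  by (simp add: internal_energy_def enthalpy_def)

lemma p_integrable_Icc: "set_integrable lebesgue {0..r} (\<lambda>s. p s / s\<^sup>2)"
proof -
  have "(\<lambda>s. p s / s\<^sup>2) absolutely_integrable_on {1..max 1 r}"
    by (intro absolutely_integrable_continuous_real continuous_intros continuous_on_subset[OF p_continuous]) auto
  then have "set_integrable lebesgue ({0..1} \<union> {1..max 1 r}) (\<lambda>s. p s / s\<^sup>2)"
    using p_integrable by (intro set_integrable_Un) auto
  then show ?thesis by (rule set_integrable_subset) auto
qed

lemma enthalpy_integral: "enthalpy r = integral {0..r} (\<lambda>s. p s / s\<^sup>2)"
  unfolding enthalpy_def using set_lebesgue_integral_eq_integral(2)[OF p_integrable_Icc] by simp

lemma p_integrable_on: "(\<lambda>s. p s / s\<^sup>2) integrable_on {0..r}"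
  using set_lebesgue_integral_eq_integral(1)[OF p_integrable_Icc] by simp

lemma enthalpy_nonneg: "0 \<le> enthalpy r"
  unfolding enthalpy_integral using p_nonneg by (intro integral_nonneg p_integrable_on) auto

text \<open>The pressure is monotone, so it may be frozen at either end while 1/s^2 is integrated
  exactly.\<close>

lemma enthalpy_diff_bounds:
  assumes "0 < a" "a \<le> b"
  shows "p a * (1 / a - 1 / b) \<le> enthalpy b - enthalpy a" "enthalpy b - enthalpy a \<le> p b * (1 / a - 1 / b)"
proof -
  let ?f = "\<lambda>s. p s / s\<^sup>2"
  have c: "enthalpy a + integral {a..b} ?f = enthalpy b"
    unfolding enthalpy_integral using assms by (intro Henstock_Kurzweil_Integration.integral_combine p_integrable_on) auto
  have i: "?f integrable_on {a..b}"
    by (rule integrable_on_subinterval[OF p_integrable_on[of b]]) (use assms in auto)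
  have sq: "((\<lambda>s. c * (1 / s\<^sup>2)) has_integral c * (1 / a - 1 / b)) {a..b}" for c
  proof (rule has_integral_mult_right)
    have "((\<lambda>s. 1 / s\<^sup>2) has_integral (- 1 / b) - (- 1 / a)) {a..b}"
    proof (rule fundamental_theorem_of_calculus[OF assms(2)])
      show "((\<lambda>s. - 1 / s) has_vector_derivative 1 / x\<^sup>2) (at x within {a..b})" if "x \<in> {a..b}" for x
        using that assms unfolding has_real_derivative_iff_has_vector_derivative[symmetric]
        by (auto intro!: derivative_eq_intros simp: power2_eq_square)
    qed
    then show "((\<lambda>s. 1 / s\<^sup>2) has_integral 1 / a - 1 / b) {a..b}" by simp
  qed
  have "p a * (1 / a - 1 / b) \<le> integral {a..b} ?f"
  proof (rule has_integral_le[OF sq integrable_integral[OF i]])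
    show "p a * (1 / s\<^sup>2) \<le> ?f s" if "s \<in> {a..b}" for s
      using p_mono[of a s] that assms by (simp add: divide_right_mono)
  qed
  moreover have "integral {a..b} ?f \<le> p b * (1 / a - 1 / b)"
  proof (rule has_integral_le[OF integrable_integral[OF i] sq])
    show "?f s \<le> p b * (1 / s\<^sup>2)" if "s \<in> {a..b}" for s
      using p_mono[of s b] that assms by (simp add: divide_right_mono)
  qed
  ultimately show "p a * (1 / a - 1 / b) \<le> enthalpy b - enthalpy a" "enthalpy b - enthalpy a \<le> p b * (1 / a - 1 / b)"
    using c by linarith+
qed

lemma A_0 [simp]: "A 0 = 0" by (simp add: internal_energy_def)

text \<open>For negative \<open>r\<close> the interval of integration is empty and the value is 0,
  which makes \<open>A\<close> continuous and nonnegative on the whole line.\<close>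

lemma A_max: "A (max 0 r) = A r"
  by (cases "0 \<le> r") (auto simp: internal_energy_def max_def set_lebesgue_integral_def)

lemma A_nonneg: "0 \<le> A r"
  using A_max[of r] enthalpy_nonneg[of "max 0 r"] by (metis A_eq max.cobounded1 mult_nonneg_nonneg)

text \<open>After cancelling \<open>enthalpy a\<close>, the claim is the increment bound with the
  pressure frozen at \<open>a\<close>, multiplied by \<open>r\<close>. For \<open>r < a\<close> the
  upper bound is used with the ends exchanged. Only monotonicity of the pressure enters this
  comparison.\<close>

lemma A_supporting_line:
  assumes "0 < a" "0 \<le> r"
  shows "A a + (enthalpy a + p a / a) * (r - a) \<le> A r"
proof -
  have "p a / a * (r - a) \<le> r * (enthalpy r - enthalpy a)"
  proof (cases "r = 0")
    case True
    then show ?thesis using assms p_nonneg[of a] by simp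
  next
    case False
    have "p a * (1 / a - 1 / r) \<le> enthalpy r - enthalpy a"
    proof (cases "a \<le> r")
      case True
      then show ?thesis using enthalpy_diff_bounds(1) assms by blast
    next
      case F: False
      then have "enthalpy a - enthalpy r \<le> p a * (1 / r - 1 / a)"
        using enthalpy_diff_bounds(2)[of r a] assms False by auto
      then show ?thesis by (simp add: algebra_simps)
    qed
    then have "r * (p a * (1 / a - 1 / r)) \<le> r * (enthalpy r - enthalpy a)"
      by (rule mult_left_mono) (use assms in auto)
    moreover have "r * (p a * (1 / a - 1 / r)) = p a / a * (r - a)"
      using False assms by (simp add: field_simps)
    ultimately show ?thesis by simp
  qed
  then show ?thesis unfolding A_eq by (simp add: algebra_simps)
qed

lemma A_midpoint_le:
  assumes "0 \<le> a" "0 \<le> b"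
  shows "A ((a + b) / 2) \<le> (A a + A b) / 2"
proof (cases "a + b = 0")
  case True
  then show ?thesis using A_nonneg by simp
next
  case False
  define m where "m = (a + b) / 2"
  have m: "0 < m" using False assms by (simp add: m_def)
  have "A m + (enthalpy m + p m / m) * (a - m) \<le> A a" "A m + (enthalpy m + p m / m) * (b - m) \<le> A b"
    by (intro A_supporting_line m assms)+
  moreover have "(enthalpy m + p m / m) * (a - m) + (enthalpy m + p m / m) * (b - m) = 0"
    unfolding m_def distrib_left[symmetric] by (simp add: field_simps)
  ultimately have "2 * A m \<le> A a + A b" by linarith
  then show ?thesis unfolding m_def by simp
qed

lemma A_continuous: "continuous_on UNIV A"
proof -
  have "continuous_on {0..} A"
    unfolding continuous_on_eq_continuous_within
  proof
    fix x :: real assume x: "x \<in> {0..}"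
    have "continuous_on {0..x + 1} (\<lambda>r. r * enthalpy r)"
      unfolding enthalpy_integral
      by (intro continuous_intros indefinite_integral_continuous_1 p_integrable_on)
    then have "continuous (at x within {0..x + 1}) A"
      using x by (simp add: continuous_on_eq_continuous_within A_eq[abs_def])
    moreover have "at x within {0..x + 1} = at x within {0..}"
      by (rule at_within_nhd[of _ "{..<x + 1}"]) (use x in auto)
    ultimately show "continuous (at x within {0..}) A" by simp
  qed
  then have "continuous_on UNIV (\<lambda>r. A (max 0 r))"
    by (rule continuous_on_compose2) (auto intro!: continuous_intros)
  then show ?thesis by (simp add: A_max)
qed

lemma A_measurable [measurable]: "A \<in> borel_measurable borel"
  by (rule borel_measurable_continuous_onI[OF A_continuous])

text \<open>For large r the interval [r/2, r] alone contributes at least p(r/2)/r to the integral,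
  so \<open>A r\<close> is at least p(r/2), which the growth condition compares with r^\<gamma>. For
  bounded r the linear term takes over.\<close>

lemma powr_le_internal_energy: "\<exists>C>0. \<forall>r\<ge>0. r powr \<gamma> \<le> C * (A r + r)"
proof -
  have "eventually (\<lambda>s. K / 2 < p s / s powr \<gamma>) at_top"
    by (rule order_tendstoD(1)[OF p_growth]) (use K_pos in simp)
  then obtain s1 where s1: "\<And>s. s1 \<le> s \<Longrightarrow> K / 2 < p s / s powr \<gamma>"
    by (auto simp: eventually_at_top_linorder)
  define s0 where "s0 = max 1 s1"
  have s0: "0 < s0" by (simp add: s0_def)
  have ps: "K / 2 * s powr \<gamma> \<le> p s" if "s0 \<le> s" for s
    using s1[of s] that s0 by (simp add: s0_def field_simps)
  define C where "C = 4 * 2 powr \<gamma> / K + (2 * s0) powr (\<gamma> - 1)"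
  have C: "0 < C" using K_pos s0 by (auto simp: C_def intro!: add_pos_pos)
  have "r powr \<gamma> \<le> C * (A r + r)" if "0 \<le> r" for r
  proof (cases "r \<le> 2 * s0")
    case True
    have "r powr \<gamma> = r powr (\<gamma> - 1) * r" using that by (cases "r = 0") (auto simp: powr_diff)
    also have "\<dots> \<le> (2 * s0) powr (\<gamma> - 1) * (A r + r)"
      using True that \<gamma>_gt_1 A_nonneg[of r] by (intro mult_mono powr_mono2) auto
    also have "\<dots> \<le> C * (A r + r)"
      using K_pos that A_nonneg[of r] by (intro mult_right_mono) (auto simp: C_def)
    finally show ?thesis .
  next
    case False
    then have r: "0 < r" "s0 \<le> r / 2" using s0 by auto
    have "p (r / 2) * (1 / (r / 2) - 1 / r) \<le> enthalpy r - enthalpy (r / 2)"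
      by (rule enthalpy_diff_bounds) (use r in auto)
    moreover have "1 / (r / 2) - 1 / r = 1 / r" using r by (simp add: field_simps)
    ultimately have "p (r / 2) / r \<le> enthalpy r" using enthalpy_nonneg[of "r / 2"] by simp
    then have "p (r / 2) \<le> A r" unfolding A_eq using r by (simp add: field_simps)
    then have "K / 2 * (r / 2) powr \<gamma> \<le> A r" using ps[OF r(2)] by linarith
    then have "r powr \<gamma> \<le> 2 * 2 powr \<gamma> / K * A r" using K_pos r by (simp add: powr_divide field_simps)
    also have "\<dots> \<le> C * A r"
      using K_pos A_nonneg[of r] by (intro mult_right_mono) (auto simp: C_def field_simps add_increasing2)
    also have "\<dots> \<le> C * (A r + r)" using C r by (intro mult_left_mono) auto
    finally show ?thesis .
  qed
  then show ?thesis using C by blast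
qed

definition growth_const :: real where
  "growth_const = (SOME C. 0 < C \<and> (\<forall>r\<ge>0. r powr \<gamma> \<le> C * (A r + r)))"

lemma growth_const: "0 < growth_const" "0 \<le> r \<Longrightarrow> r powr \<gamma> \<le> growth_const * (A r + r)"
  using someI_ex[OF powr_le_internal_energy[unfolded Bex_def]] unfolding growth_const_def by blast+

lemma L_mono:
  assumes "0 \<le> s" "s \<le> t" "t \<le> M"
  shows "L s \<le> L t"
proof (cases "s = t")
  case False
  have "\<exists>x\<in>{s<..<t}. L t - L s = (t - s) * L' x"
  proof (rule mvt_simple[where f' = "\<lambda>x h. h * L' x"])
    show "(L has_derivative (\<lambda>h. h * L' x)) (at x within {s..t})" if "s \<le> x" "x \<le> t" for x
      using has_field_derivative_subset[OF L_deriv[of x], of "{s..t}"] that assms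
      by (auto simp: has_field_derivative_def mult_commute_abs)
  qed (use False assms in auto)
  then obtain x where x: "s < x" "x < t" "L t - L s = (t - s) * L' x" by auto
  have "0 \<le> (t - s) * L' x" using L'_nonneg[of x] x assms by (intro mult_nonneg_nonneg) auto
  then show ?thesis using x by linarith
qed simp

text \<open>\<open>L\<close> is controlled only on [0, M]. Clamping the argument yields a bounded
  continuous function on the line that agrees with \<open>L\<close> at every cylinder mass that
  occurs.\<close>

definition L_clamp :: "real \<Rightarrow> real" where
  "L_clamp m = L (max 0 (min M m))"

lemma L_clamp_continuous: "continuous_on UNIV L_clamp"
proof -
  have "continuous_on {0..M} L"
    using L_deriv by (intro DERIV_continuous_on) auto
  then show ?thesis unfolding L_clamp_def
    by (rule continuous_on_compose2) (use M_pos in \<open>auto intro!: continuous_intros\<close>)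
qed

lemma L_clamp_measurable [measurable]: "L_clamp \<in> borel_measurable borel"
  by (rule borel_measurable_continuous_onI[OF L_clamp_continuous])

lemma L_clamp_eq: "0 \<le> m \<Longrightarrow> m \<le> M \<Longrightarrow> L_clamp m = L m"
  by (simp add: L_clamp_def)

lemma L_clamp_bounds: "0 \<le> L_clamp m" "L_clamp m \<le> L M"
  using M_pos by (auto simp: L_clamp_def intro!: L_nonneg L_mono)

end

section \<open>Cylinder masses and configurations\<close>

lemma cyl_radius_continuous: "continuous_on UNIV cyl_radius"
  unfolding cyl_radius_def[abs_def] by (intro continuous_intros)

lemma cyl_radius_measurable [measurable]: "cyl_radius \<in> borel_measurable borel"
  by (rule borel_measurable_continuous_onI[OF cyl_radius_continuous])

lemma cyl_radius_nonneg: "0 \<le> cyl_radius x" by (simp add: cyl_radius_def)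

lemma cyl_radius_lebesgue_measurable [measurable]: "cyl_radius \<in> borel_measurable lebesgue"
  by (simp add: measurable_completion)

lemma cyl_set_measurable [measurable]: "{x. cyl_radius x < r} \<in> sets lebesgue"
proof -
  have "{x \<in> space lebesgue. cyl_radius x < r} \<in> sets lebesgue" by measurable
  then show ?thesis by simp
qed

lemma cyl_mass_integrable:
  fixes f :: "real^3 \<Rightarrow> real"
  assumes "integrable lebesgue f"
  shows "integrable lebesgue (\<lambda>x. indicator {x. cyl_radius x < r} x * f x)"
  using integrable_mult_indicator[OF cyl_set_measurable assms] by simp

lemma cyl_mass_bounds:
  fixes f :: "real^3 \<Rightarrow> real"
  assumes "integrable lebesgue f" "\<And>x. 0 \<le> f x"
  shows "0 \<le> cyl_mass f r" "cyl_mass f r \<le> (LINT x|lebesgue. f x)"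
  unfolding cyl_mass_def set_lebesgue_integral_def
   apply (rule integral_nonneg_AE, use assms in simp)
  by (rule integral_mono) (use cyl_mass_integrable[OF assms(1)] assms in \<open>auto simp: indicator_def\<close>)

lemma cyl_mass_mono:
  fixes f :: "real^3 \<Rightarrow> real"
  assumes "integrable lebesgue f" "\<And>x. 0 \<le> f x" "r \<le> s"
  shows "cyl_mass f r \<le> cyl_mass f s"
  unfolding cyl_mass_def set_lebesgue_integral_def
  by (rule integral_mono) (use cyl_mass_integrable[OF assms(1)] assms in \<open>auto simp: indicator_def\<close>)

lemma cyl_mass_mono_fun:
  fixes f g :: "real^3 \<Rightarrow> real"
  assumes "integrable lebesgue f" "integrable lebesgue g" "\<And>x. f x \<le> g x"
  shows "cyl_mass f r \<le> cyl_mass g r"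
  unfolding cyl_mass_def set_lebesgue_integral_def
  by (rule integral_mono) (use cyl_mass_integrable assms in \<open>auto simp: indicator_def\<close>)

lemma cyl_mass_measurable:
  fixes f :: "real^3 \<Rightarrow> real"
  assumes "integrable lebesgue f" "\<And>x. 0 \<le> f x"
  shows "cyl_mass f \<in> borel_measurable borel"
  by (rule borel_measurable_mono) (use cyl_mass_mono[OF assms] in \<open>auto simp: mono_def\<close>)

context rotating_star
begin

text \<open>Working class for the proof. The mass may be smaller than \<open>M\<close>, so that cut
  densities belong to it; internal and rotational energy are integrable separately, and the
  integrability of the gravitational term is a consequence.\<close>

definition config :: "(real^3 \<Rightarrow> real) \<Rightarrow> bool" where
  "config \<sigma> \<longleftrightarrow> axisymmetric \<sigma> \<and> (\<forall>x. 0 \<le> \<sigma> x) \<and> integrable lebesgue \<sigma> \<and> (LINT x|lebesgue. \<sigma> x) \<le> M \<and>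
     integrable lebesgue (\<lambda>x. A (\<sigma> x)) \<and> integrable lebesgue (rotation_density L \<sigma>)"

lemma rotation_density_eq:
  assumes "integrable lebesgue \<sigma>" "\<And>x. 0 \<le> \<sigma> x" "(LINT x|lebesgue. \<sigma> x) \<le> M"
  shows "rotation_density L \<sigma> x = \<sigma> x * L_clamp (cyl_mass \<sigma> (cyl_radius x)) / (cyl_radius x)\<^sup>2"
  unfolding rotation_density_def
  using cyl_mass_bounds[OF assms(1,2), of "cyl_radius x"] assms(3) by (subst L_clamp_eq) auto

lemma rotation_density_measurable:
  assumes "integrable lebesgue \<sigma>" "\<And>x. 0 \<le> \<sigma> x" "(LINT x|lebesgue. \<sigma> x) \<le> M"
  shows "rotation_density L \<sigma> \<in> borel_measurable lebesgue"
proof -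
  note [measurable] = cyl_mass_measurable[OF assms(1,2)] borel_measurable_integrable[OF assms(1)]
  have "(\<lambda>x. \<sigma> x * L_clamp (cyl_mass \<sigma> (cyl_radius x)) / (cyl_radius x)\<^sup>2) \<in> borel_measurable lebesgue"
    by measurable
  then show ?thesis using rotation_density_eq[OF assms] by (simp cong: measurable_cong)
qed

lemma rotation_density_nonneg:
  assumes "integrable lebesgue \<sigma>" "\<And>x. 0 \<le> \<sigma> x" "(LINT x|lebesgue. \<sigma> x) \<le> M"
  shows "0 \<le> rotation_density L \<sigma> x"
  unfolding rotation_density_eq[OF assms] using assms(2) L_clamp_bounds(1) by auto

text \<open>Measuring the cylinder mass with the larger density can only increase \<open>L\<close>.
  This makes rotational energy superadditive when a density is cut into pieces.\<close>

lemma rotation_density_mono: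
  assumes "integrable lebesgue \<sigma>" "\<And>x. 0 \<le> \<sigma> x" "\<And>x. \<sigma> x \<le> \<rho> x" "integrable lebesgue \<rho>" "(LINT x|lebesgue. \<rho> x) \<le> M"
  shows "rotation_density L \<sigma> x \<le> \<sigma> x * L (cyl_mass \<rho> (cyl_radius x)) / (cyl_radius x)\<^sup>2"
proof -
  have "\<And>x. 0 \<le> \<rho> x" using assms(2,3) order_trans by blast
  then have "L (cyl_mass \<sigma> (cyl_radius x)) \<le> L (cyl_mass \<rho> (cyl_radius x))"
    using cyl_mass_bounds[OF assms(1,2)] cyl_mass_bounds[OF assms(4)] assms(5)
    by (intro L_mono cyl_mass_mono_fun assms) (auto intro: order_trans[OF _ assms(5)])
  then show ?thesis unfolding rotation_density_def
    using assms(2) by (intro divide_right_mono mult_left_mono) auto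
qed

lemma configD:
  assumes "config \<sigma>"
  shows "axisymmetric \<sigma>" "0 \<le> \<sigma> x" "integrable lebesgue \<sigma>" "(LINT x|lebesgue. \<sigma> x) \<le> M"
    "integrable lebesgue (\<lambda>x. A (\<sigma> x))" "integrable lebesgue (rotation_density L \<sigma>)"
    "0 \<le> rotation_density L \<sigma> x"
  using assms rotation_density_nonneg[of \<sigma> x] by (auto simp: config_def)

lemma config_powr:
  assumes "config \<sigma>"
  shows "integrable lebesgue (\<lambda>x. \<sigma> x powr \<gamma>)"
    and "(LINT x|lebesgue. \<sigma> x powr \<gamma>) \<le> growth_const * ((LINT x|lebesgue. A (\<sigma> x)) + M)"
proof -
  note \<sigma> = configD[OF assms]
  note [measurable] = borel_measurable_integrable[OF \<sigma>(3)]
  have r: "integrable lebesgue (\<lambda>x. growth_const * (A (\<sigma> x) + \<sigma> x))" using \<sigma> by auto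
  show i: "integrable lebesgue (\<lambda>x. \<sigma> x powr \<gamma>)"
    by (rule integrable_AE_bound[OF r]) (use growth_const(2) \<sigma>(2) in auto)
  have "(LINT x|lebesgue. \<sigma> x powr \<gamma>) \<le> (LINT x|lebesgue. growth_const * (A (\<sigma> x) + \<sigma> x))"
    by (rule integral_mono[OF i r]) (use growth_const(2) \<sigma>(2) in auto)
  also have "\<dots> = growth_const * ((LINT x|lebesgue. A (\<sigma> x)) + (LINT x|lebesgue. \<sigma> x))" using \<sigma> by simp
  also have "\<dots> \<le> growth_const * ((LINT x|lebesgue. A (\<sigma> x)) + M)"
    using growth_const(1) \<sigma>(4) by (intro mult_left_mono) auto
  finally show "(LINT x|lebesgue. \<sigma> x powr \<gamma>) \<le> growth_const * ((LINT x|lebesgue. A (\<sigma> x)) + M)" .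
qed

lemma powr_four_thirds_le: "0 \<le> t \<Longrightarrow> t powr (4/3) \<le> t + t powr \<gamma>"
proof (cases "t \<le> 1")
  case True
  moreover assume "0 \<le> t"
  ultimately have "t powr (4/3) \<le> t powr 1" by (intro powr_mono') auto
  then show ?thesis using \<open>0 \<le> t\<close> by (simp add: add_increasing2)
next
  case False
  then have "t powr (4/3) \<le> t powr \<gamma>" using \<gamma>_ge by (intro powr_mono) auto
  then show ?thesis using False by linarith
qed

lemma config_star_density:
  assumes "config \<sigma>"
  shows "star_density \<sigma>" and "L43 \<sigma> \<le> M + growth_const * ((LINT x|lebesgue. A (\<sigma> x)) + M)"
proof -
  note \<sigma> = configD[OF assms]
  note [measurable] = borel_measurable_integrable[OF \<sigma>(3)]
  have r: "integrable lebesgue (\<lambda>x. \<sigma> x + \<sigma> x powr \<gamma>)" using \<sigma> config_powr[OF assms] by auto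
  have i: "integrable lebesgue (\<lambda>x. \<sigma> x powr (4/3))"
    by (rule integrable_AE_bound[OF r]) (use powr_four_thirds_le \<sigma>(2) in auto)
  then show "star_density \<sigma>" using \<sigma> by (auto simp: star_density_def)
  have "L43 \<sigma> \<le> (LINT x|lebesgue. \<sigma> x + \<sigma> x powr \<gamma>)"
    by (rule integral_mono[OF i r]) (use powr_four_thirds_le \<sigma>(2) in auto)
  also have "\<dots> = (LINT x|lebesgue. \<sigma> x) + (LINT x|lebesgue. \<sigma> x powr \<gamma>)" using \<sigma> config_powr(1)[OF assms] by simp
  finally show "L43 \<sigma> \<le> M + growth_const * ((LINT x|lebesgue. A (\<sigma> x)) + M)"
    using \<sigma>(4) config_powr(2)[OF assms] by linarith
qed

lemma config_energy:
  assumes "config \<sigma>"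
  shows "energy p L \<sigma> = (LINT x|lebesgue. A (\<sigma> x)) + 1/2 * (LINT x|lebesgue. rotation_density L \<sigma> x) - 1/2 * mutual_energy \<sigma> \<sigma>"
  unfolding energy_def
  using configD[OF assms] mutual_energy_potential[OF config_star_density(1)[OF assms] config_star_density(1)[OF assms]]
  by simp

lemma config_admissible:
  assumes "config \<sigma>" "(LINT x|lebesgue. \<sigma> x) = M"
  shows "\<sigma> \<in> admissible p L M"
  unfolding admissible_def
  using configD[OF assms(1)] assms(2) mutual_energy_potential(1)[OF config_star_density(1)[OF assms(1)] config_star_density(1)[OF assms(1)]]
  by auto

text \<open>Admissible densities may be negative on a null set. The positive part keeps exact axial
  symmetry and shares mass, potential and energies. Its three energy densities are nonnegative, so
  integrability of their sum yields integrability of internal and rotational energy.\<close>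

lemma admissible_positive_part:
  assumes "\<rho> \<in> admissible p L M"
  defines "\<sigma> \<equiv> \<lambda>x. max 0 (\<rho> x)"
  shows "AE x in lebesgue. \<rho> x = \<sigma> x" "config \<sigma>" "(LINT x|lebesgue. \<sigma> x) = M"
    "potential \<rho> = potential \<sigma>" "energy p L \<rho> = energy p L \<sigma>" "\<rho> \<in> borel_measurable lebesgue"
    "(LINT x|lebesgue. A (\<rho> x) + 1/2 * rotation_density L \<rho> x) =
      (LINT x|lebesgue. A (\<sigma> x)) + 1/2 * (LINT x|lebesgue. rotation_density L \<sigma> x)"
proof -
  from assms(1) have ax: "axisymmetric \<rho>" and nn: "AE x in lebesgue. 0 \<le> \<rho> x" and i: "integrable lebesgue \<rho>"
    and mass: "(LINT x|lebesgue. \<rho> x) = M"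
    and fin: "integrable lebesgue (\<lambda>x. A (\<rho> x) + rotation_density L \<rho> x + \<rho> x * potential \<rho> x)"
    by (auto simp: admissible_def)
  show m[measurable]: "\<rho> \<in> borel_measurable lebesgue" using i by auto
  have m\<sigma>[measurable]: "\<sigma> \<in> borel_measurable lebesgue" unfolding \<sigma>_def by measurable
  show eq: "AE x in lebesgue. \<rho> x = \<sigma> x" using nn by eventually_elim (simp add: \<sigma>_def)
  have i\<sigma>: "integrable lebesgue \<sigma>" unfolding \<sigma>_def using i by auto
  show mass\<sigma>: "(LINT x|lebesgue. \<sigma> x) = M"
    using mass integral_cong_AE[OF m m\<sigma> eq] by simp
  have \<sigma>0: "0 \<le> \<sigma> x" for x by (simp add: \<sigma>_def)
  show pot: "potential \<rho> = potential \<sigma>"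
  proof
    fix x show "potential \<rho> x = potential \<sigma> x"
      unfolding potential_def
    proof (rule integral_cong_AE)
      show "AE y in lebesgue. \<rho> y / norm (x - y) = \<sigma> y / norm (x - y)" using eq by eventually_elim simp
    qed measurable
  qed
  have cyl: "cyl_mass \<rho> = cyl_mass \<sigma>"
  proof
    fix r show "cyl_mass \<rho> r = cyl_mass \<sigma> r"
      unfolding cyl_mass_def set_lebesgue_integral_def
    proof (rule integral_cong_AE)
      show "AE x in lebesgue. indicat_real {x. cyl_radius x < r} x *\<^sub>R \<rho> x = indicat_real {x. cyl_radius x < r} x *\<^sub>R \<sigma> x"
        using eq by eventually_elim simp
    qed measurable
  qed
  have rot: "AE x in lebesgue. rotation_density L \<rho> x = rotation_density L \<sigma> x"
    using eq by eventually_elim (simp add: rotation_density_def cyl)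
  have m_rot[measurable]: "rotation_density L \<sigma> \<in> borel_measurable lebesgue"
    using mass\<sigma> by (intro rotation_density_measurable i\<sigma> \<sigma>0) simp
  have m_rot'[measurable]: "rotation_density L \<rho> \<in> borel_measurable lebesgue"
  proof -
    have "rotation_density L \<rho> = (\<lambda>x. \<rho> x * L_clamp (cyl_mass \<sigma> (cyl_radius x)) / (cyl_radius x)\<^sup>2)"
      using cyl_mass_bounds[OF i\<sigma> \<sigma>0] mass\<sigma> by (auto simp: rotation_density_def cyl L_clamp_eq)
    moreover note [measurable] = cyl_mass_measurable[OF i\<sigma> \<sigma>0]
    ultimately show ?thesis by simp
  qed
  note [measurable] = potential_measurable[OF m] potential_measurable[OF m\<sigma>]
  have rot0: "0 \<le> rotation_density L \<sigma> x" for x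
    using mass\<sigma> by (intro rotation_density_nonneg i\<sigma> \<sigma>0) simp
  have pot0: "0 \<le> potential \<sigma> x" for x
    unfolding potential_def using \<sigma>0 by (intro integral_nonneg_AE) auto
  have bound: "integrable lebesgue (\<lambda>x. A (\<sigma> x) + rotation_density L \<sigma> x + \<sigma> x * potential \<sigma> x)"
  proof (rule integrable_cong_AE_imp[OF fin])
    show "AE x in lebesgue. A (\<rho> x) + rotation_density L \<rho> x + \<rho> x * potential \<rho> x =
        A (\<sigma> x) + rotation_density L \<sigma> x + \<sigma> x * potential \<sigma> x"
      using eq rot by eventually_elim (simp add: pot)
  qed measurable
  have iA: "integrable lebesgue (\<lambda>x. A (\<sigma> x))"
    by (rule integrable_AE_bound[OF bound]) (use A_nonneg rot0 \<sigma>0 pot0 in \<open>auto intro!: AE_I2\<close>)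
  have iR: "integrable lebesgue (rotation_density L \<sigma>)"
    by (rule integrable_AE_bound[OF bound]) (use A_nonneg rot0 \<sigma>0 pot0 in \<open>auto intro!: AE_I2\<close>)
  have "axisymmetric \<sigma>"
  proof -
    obtain g where "\<And>x. \<rho> x = g (cyl_radius x) (x$3)" using ax by (auto simp: axisymmetric_def)
    then show ?thesis unfolding axisymmetric_def \<sigma>_def by (intro exI[of _ "\<lambda>r z. max 0 (g r z)"]) simp
  qed
  then show c: "config \<sigma>" using \<sigma>0 i\<sigma> mass\<sigma> iA iR by (simp add: config_def)
  show "energy p L \<rho> = energy p L \<sigma>"
    unfolding energy_def
  proof (rule integral_cong_AE)
    show "AE x in lebesgue. A (\<rho> x) + 1/2 * rotation_density L \<rho> x - 1/2 * (\<rho> x * potential \<rho> x) =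
        A (\<sigma> x) + 1/2 * rotation_density L \<sigma> x - 1/2 * (\<sigma> x * potential \<sigma> x)"
      using eq rot by eventually_elim (simp add: pot)
  qed measurable
  have "(LINT x|lebesgue. A (\<rho> x) + 1/2 * rotation_density L \<rho> x) = (LINT x|lebesgue. A (\<sigma> x) + 1/2 * rotation_density L \<sigma> x)"
  proof (rule integral_cong_AE)
    show "AE x in lebesgue. A (\<rho> x) + 1/2 * rotation_density L \<rho> x = A (\<sigma> x) + 1/2 * rotation_density L \<sigma> x"
      using eq rot by eventually_elim simp
  qed measurable
  also have "\<dots> = (LINT x|lebesgue. A (\<sigma> x)) + 1/2 * (LINT x|lebesgue. rotation_density L \<sigma> x)" using iA iR by simp
  finally show "(LINT x|lebesgue. A (\<rho> x) + 1/2 * rotation_density L \<rho> x) =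
      (LINT x|lebesgue. A (\<sigma> x)) + 1/2 * (LINT x|lebesgue. rotation_density L \<sigma> x)" .
qed

end

section \<open>Symmetries, scaling and the lower energy bound\<close>

text \<open>Invariance replaces the profile function, which is recovered by choosing a
  representative point for each pair of radius and height.\<close>

lemma axisymmetric_iff:
  "axisymmetric f \<longleftrightarrow> (\<forall>x y. cyl_radius x = cyl_radius y \<longrightarrow> x$3 = y$3 \<longrightarrow> f x = f y)"
proof
  assume r: "\<forall>x y. cyl_radius x = cyl_radius y \<longrightarrow> x$3 = y$3 \<longrightarrow> f x = f y"
  show "axisymmetric f"
    unfolding axisymmetric_def
  proof (intro exI allI)
    fix x
    let ?y = "SOME y. cyl_radius y = cyl_radius x \<and> y$3 = x$3"
    have "cyl_radius ?y = cyl_radius x \<and> ?y$3 = x$3" by (rule someI[of _ x]) simp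
    then show "f x = (\<lambda>r z. f (SOME y. cyl_radius y = r \<and> y$3 = z)) (cyl_radius x) (x$3)"
      using r[rule_format, of x ?y] by simp
  qed
qed (auto simp: axisymmetric_def)

lemma norm_cyl: "(norm x)\<^sup>2 = (cyl_radius x)\<^sup>2 + (x$3)\<^sup>2"
  by (simp add: cyl_radius_def power2_norm_eq_inner inner_vec_def sum_3) (simp add: power2_eq_square)

lemma axisymmetric_ball: "axisymmetric (indicator (ball 0 R))"
proof -
  have n: "norm x = norm y" if "cyl_radius x = cyl_radius y" "x$3 = y$3" for x y :: "real^3"
  proof -
    have "(norm x)\<^sup>2 = (norm y)\<^sup>2" unfolding norm_cyl that ..
    then show ?thesis by (rule power2_eq_imp_eq) simp_all
  qed
  have *: "indicator (ball 0 R) x = (indicator (ball 0 R) y :: real)" if "cyl_radius x = cyl_radius y" "x$3 = y$3" for x y :: "real^3"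
    by (simp only: indicator_def mem_ball dist_0_norm n[OF that])
  show ?thesis unfolding axisymmetric_iff by (intro allI impI) (rule *)
qed

lemma axisymmetric_compl: "axisymmetric (indicator S) \<Longrightarrow> axisymmetric (indicator (- S))"
  unfolding axisymmetric_iff by (metis (no_types, lifting) ComplD ComplI indicator_simps)

lemma axisymmetric_mult: "axisymmetric f \<Longrightarrow> axisymmetric g \<Longrightarrow> axisymmetric (\<lambda>x. f x * g x)"
  unfolding axisymmetric_iff by metis

section \<open>Rotations about the axis and mass far from it\<close>

definition axis_rotation :: "real \<Rightarrow> real^3 \<Rightarrow> real^3" where
  "axis_rotation \<theta> x = vector [cos \<theta> * x$1 - sin \<theta> * x$2, sin \<theta> * x$1 + cos \<theta> * x$2, x$3]"

lemma axis_rotation_nth [simp]: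
  "axis_rotation \<theta> x $ 1 = cos \<theta> * x$1 - sin \<theta> * x$2" "axis_rotation \<theta> x $ 2 = sin \<theta> * x$1 + cos \<theta> * x$2"
  "axis_rotation \<theta> x $ 3 = x$3"
  by (simp_all add: axis_rotation_def vector_3)

lemma rotation_inner_identity:
  fixes c s a b a' b' :: real
  assumes "c\<^sup>2 + s\<^sup>2 = 1"
  shows "(c * a - s * b) * (c * a' - s * b') + (s * a + c * b) * (s * a' + c * b') = a * a' + b * b'"
proof -
  have "(c * a - s * b) * (c * a' - s * b') + (s * a + c * b) * (s * a' + c * b') = (c\<^sup>2 + s\<^sup>2) * (a * a' + b * b')"
    by (simp add: algebra_simps power2_eq_square)
  then show ?thesis using assms by simp
qed

lemma rotation_difference_identity:
  fixes c s c' s' a b :: real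
  assumes "c\<^sup>2 + s\<^sup>2 = 1" "c'\<^sup>2 + s'\<^sup>2 = 1"
  shows "((c - c') * a - (s - s') * b)\<^sup>2 + ((s - s') * a + (c - c') * b)\<^sup>2 = 2 * (a\<^sup>2 + b\<^sup>2) * (1 - (c * c' + s * s'))"
proof -
  have "((c - c') * a - (s - s') * b)\<^sup>2 + ((s - s') * a + (c - c') * b)\<^sup>2 =
      ((c\<^sup>2 + s\<^sup>2) + (c'\<^sup>2 + s'\<^sup>2) - 2 * (c * c' + s * s')) * (a\<^sup>2 + b\<^sup>2)"
    by (simp add: algebra_simps power2_eq_square)
  then show ?thesis unfolding assms by (simp add: algebra_simps)
qed

lemma axis_rotation_orthogonal: "orthogonal_transformation (axis_rotation \<theta>)"
  unfolding orthogonal_transformation_def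
proof (intro conjI allI)
  show "linear (axis_rotation \<theta>)"
    by (rule linearI) (auto simp: vec_eq_iff forall_3 algebra_simps)
  show "axis_rotation \<theta> v \<bullet> axis_rotation \<theta> w = v \<bullet> w" for v w
    using rotation_inner_identity[of "cos \<theta>" "sin \<theta>" "v$1" "v$2" "w$1" "w$2"]
    by (simp add: inner_vec_def sum_3)
qed

lemma cyl_radius_axis_rotation: "cyl_radius (axis_rotation \<theta> x) = cyl_radius x"
  using rotation_inner_identity[of "cos \<theta>" "sin \<theta>" "x$1" "x$2" "x$1" "x$2"]
  by (simp add: cyl_radius_def power2_eq_square)

lemma norm_axis_rotation_diff: "(norm (axis_rotation \<theta> x - axis_rotation \<phi> x))\<^sup>2 = 2 * (cyl_radius x)\<^sup>2 * (1 - cos (\<theta> - \<phi>))"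
proof -
  have "(norm (axis_rotation \<theta> x - axis_rotation \<phi> x))\<^sup>2 =
     ((cos \<theta> - cos \<phi>) * x$1 - (sin \<theta> - sin \<phi>) * x$2)\<^sup>2 + ((sin \<theta> - sin \<phi>) * x$1 + (cos \<theta> - cos \<phi>) * x$2)\<^sup>2"
    by (simp add: power2_norm_eq_inner inner_vec_def sum_3) (simp add: power2_eq_square algebra_simps)
  also have "\<dots> = 2 * ((x$1)\<^sup>2 + (x$2)\<^sup>2) * (1 - (cos \<theta> * cos \<phi> + sin \<theta> * sin \<phi>))"
    by (rule rotation_difference_identity) simp_all
  also have "cos \<theta> * cos \<phi> + sin \<theta> * sin \<phi> = cos (\<theta> - \<phi>)" by (simp add: cos_diff)
  finally show ?thesis by (simp only: cyl_radius_def real_sqrt_pow2 sum_power2_ge_zero)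
qed

text \<open>Far from the axis, the copies of a ball rotated by the angles \<open>k / N\<close>, \<open>k < N\<close>, are disjoint and
  carry the same mass.\<close>

lemma axisymmetric_ball_mass_far:
  fixes f :: "real^3 \<Rightarrow> real"
  assumes ax: "axisymmetric f" and i: "integrable lebesgue f" and nn: "\<And>x. 0 \<le> f x"
    and "0 < N" and far: "2 * R\<^sup>2 / (1 - cos (1 / real N)) \<le> (cyl_radius x)\<^sup>2"
  shows "real N * (LINT y:ball x R|lebesgue. f y) \<le> (LINT y|lebesgue. f y)"
proof -
  note [measurable] = borel_measurable_integrable[OF i]
  define T where "T k = axis_rotation (real k / real N)" for k :: nat
  have T: "orthogonal_transformation (T k)" for k by (simp add: T_def axis_rotation_orthogonal)
  have fT: "f (T k y) = f y" for k y
    using ax unfolding axisymmetric_iff T_def by (metis cyl_radius_axis_rotation axis_rotation_nth(3))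
  have iB: "integrable lebesgue (\<lambda>y. indicator (ball z R) y * f y)" for z
    using integrable_mult_indicator[OF sets_lebesgue_ball i] by simp
  have mass: "(LINT y|lebesgue. indicator (ball (T k x) R) y * f y) = (LINT y|lebesgue. indicator (ball x R) y * f y)" for k
  proof -
    have "(LINT y|lebesgue. indicator (ball (T k x) R) y * f y) = (LINT y|lebesgue. indicator (ball (T k x) R) (T k y) * f (T k y))"
      by (rule integral_lebesgue_orthogonal(2)[OF T, symmetric]) measurable
    also have "\<dots> = (LINT y|lebesgue. indicator (ball x R) y * f y)"
    proof (rule Bochner_Integration.integral_cong[OF refl])
      fix y
      have "dist (T k x) (T k y) = dist x y" using T[unfolded orthogonal_transformation_isometry] by blast
      then show "indicator (ball (T k x) R) (T k y) * f (T k y) = indicator (ball x R) y * f y"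
        by (simp add: fT indicator_def)
    qed
    finally show ?thesis .
  qed
  have cN: "cos (1 / real N) < 1"
  proof -
    have "1 / real N \<le> 1" using \<open>0 < N\<close> by simp
    then have "1 / real N \<le> pi" using pi_gt3 by linarith
    then show ?thesis using cos_monotone_0_pi[of 0 "1 / real N"] \<open>0 < N\<close> by simp
  qed
  \<comment> \<open>All angles differ by less than 1, where the cosine decreases, so the smallest
    difference 1/N is the worst case. The hypothesis \<open>far\<close> is exactly what makes the
    squared distance of the centres at least 4 R^2.\<close>
  have sep: "2 * R \<le> norm (T j x - T k x)" if "j < k" "k < N" for j k
  proof -
    have b: "1 / real N \<le> real k / real N - real j / real N" "real k / real N - real j / real N \<le> 1"
      using that by (auto simp: field_simps)
    have "cos (real k / real N - real j / real N) \<le> cos (1 / real N)"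
      using b pi_gt3 \<open>0 < N\<close> by (intro cos_monotone_0_pi_le) auto
    then have "(cyl_radius x)\<^sup>2 * (1 - cos (1 / real N)) \<le> (cyl_radius x)\<^sup>2 * (1 - cos (real k / real N - real j / real N))"
      by (intro mult_left_mono) auto
    moreover have "2 * R\<^sup>2 \<le> (cyl_radius x)\<^sup>2 * (1 - cos (1 / real N))"
      using far cN by (simp add: divide_le_eq)
    ultimately have "(2 * R)\<^sup>2 \<le> (norm (T k x - T j x))\<^sup>2"
      unfolding T_def norm_axis_rotation_diff by (simp add: power_mult_distrib)
    then have "2 * R \<le> norm (T k x - T j x)" by (rule power2_le_imp_le) simp
    then show ?thesis by (simp add: norm_minus_commute)
  qed
  have disj: "(\<Sum>k<N. indicator (ball (T k x) R) y :: real) \<le> 1" for y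
  proof (cases "\<exists>k<N. y \<in> ball (T k x) R")
    case True
    then obtain k where k: "k < N" "y \<in> ball (T k x) R" by blast
    have "y \<notin> ball (T j x) R" if "j < N" "j \<noteq> k" for j
    proof
      assume "y \<in> ball (T j x) R"
      then have "dist (T j x) (T k x) < R + R"
        using k(2) by (intro dist_triangle_less_add[of _ y]) (auto simp: dist_commute)
      then show False using sep[of j k] sep[of k j] that k(1) by (cases "j < k") (auto simp: dist_norm norm_minus_commute)
    qed
    then have "(\<Sum>j<N. indicator (ball (T j x) R) y :: real) = (\<Sum>j\<in>{k}. 1)"
      using k by (intro sum.mono_neutral_cong_right) auto
    then show ?thesis by simp
  qed (auto simp: sum_nonneg intro!: sum_nonpos[THEN order_trans])
  have "real N * (LINT y:ball x R|lebesgue. f y) = (\<Sum>k<N. LINT y|lebesgue. indicator (ball (T k x) R) y * f y)"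
    by (simp add: mass set_lebesgue_integral_def)
  also have "\<dots> = (LINT y|lebesgue. (\<Sum>k<N. indicator (ball (T k x) R) y * f y))"
    by (rule Bochner_Integration.integral_sum[symmetric]) (rule iB)
  also have "\<dots> \<le> (LINT y|lebesgue. f y)"
  proof (rule integral_mono)
    show "integrable lebesgue (\<lambda>y. \<Sum>k<N. indicator (ball (T k x) R) y * f y)"
      by (intro Bochner_Integration.integrable_sum iB)
    show "(\<Sum>k<N. indicator (ball (T k x) R) y * f y) \<le> f y" for y
      using mult_right_mono[OF disj nn, of y y] by (simp flip: sum_distrib_right)
  qed (rule i)
  finally show ?thesis .
qed

section \<open>Vertical shifts and dilations\<close>

lemma potential_vshift:
  assumes [measurable]: "f \<in> borel_measurable lebesgue"
  shows "potential (vshift a f) x = potential f (x + a *\<^sub>R axis 3 1)"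
proof -
  have "(LINT y|lebesgue. f (y + a *\<^sub>R axis 3 1) / norm (x - y)) = (LINT y|lebesgue. (\<lambda>y. f y / norm ((x + a *\<^sub>R axis 3 1) - y)) (y + a *\<^sub>R axis 3 1))"
    by simp
  also have "\<dots> = (LINT y|lebesgue. f y / norm ((x + a *\<^sub>R axis 3 1) - y))"
    by (rule integral_lebesgue_translation(2)) measurable
  finally show ?thesis by (simp add: potential_def vshift_def)
qed

lemma cyl_radius_vshift: "cyl_radius (x + a *\<^sub>R axis 3 1) = cyl_radius x"
  by (simp add: cyl_radius_def axis_def)

lemma cyl_mass_vshift:
  assumes [measurable]: "f \<in> borel_measurable lebesgue"
  shows "cyl_mass (vshift a f) r = cyl_mass f r"
proof -
  have "(LINT y|lebesgue. (\<lambda>y. indicator {x. cyl_radius x < r} y * f y) (y + a *\<^sub>R axis 3 1)) = (LINT y|lebesgue. indicator {x. cyl_radius x < r} y * f y)"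
    by (rule integral_lebesgue_translation(2)) measurable
  then show ?thesis by (simp add: cyl_mass_def set_lebesgue_integral_def vshift_def indicator_def cyl_radius_vshift)
qed

context rotating_star
begin

lemma config_vshift:
  assumes c: "config \<sigma>"
  shows "config (vshift a \<sigma>)" "(LINT x|lebesgue. vshift a \<sigma> x) = (LINT x|lebesgue. \<sigma> x)"
    "energy p L (vshift a \<sigma>) = energy p L \<sigma>"
proof -
  note \<sigma> = configD[OF c]
  note [measurable] = borel_measurable_integrable[OF \<sigma>(3)] borel_measurable_integrable[OF \<sigma>(6)]
  let ?v = "a *\<^sub>R axis 3 1 :: real^3"
  have rot: "rotation_density L (vshift a \<sigma>) = (\<lambda>x. rotation_density L \<sigma> (x + ?v))"
    by (simp add: rotation_density_def fun_eq_iff cyl_mass_vshift cyl_radius_vshift) (simp add: vshift_def)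
  show int: "(LINT x|lebesgue. vshift a \<sigma> x) = (LINT x|lebesgue. \<sigma> x)"
    unfolding vshift_def by (rule integral_lebesgue_translation(2)) measurable
  have ax: "axisymmetric (vshift a \<sigma>)"
    using \<sigma>(1) unfolding axisymmetric_iff vshift_def by (simp add: cyl_radius_vshift)
  have iA: "integrable lebesgue (\<lambda>x. A (\<sigma> (x + ?v)))"
    using integral_lebesgue_translation(1)[of "\<lambda>x. A (\<sigma> x)" ?v] \<sigma>(5) by simp
  have i: "integrable lebesgue (\<lambda>x. \<sigma> (x + ?v))"
    using integral_lebesgue_translation(1)[of \<sigma> ?v] \<sigma>(3) by simp
  have iR: "integrable lebesgue (\<lambda>x. rotation_density L \<sigma> (x + ?v))"
    using integral_lebesgue_translation(1)[of "rotation_density L \<sigma>" ?v] \<sigma>(6) by simp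
  show "config (vshift a \<sigma>)"
    unfolding config_def rot using ax \<sigma> i iA iR int by (simp add: vshift_def[abs_def])
  have [measurable]: "potential \<sigma> \<in> borel_measurable lebesgue" by (rule potential_measurable) measurable
  have "energy p L (vshift a \<sigma>) = (LINT x|lebesgue. (\<lambda>x. A (\<sigma> x) + 1/2 * rotation_density L \<sigma> x - 1/2 * (\<sigma> x * potential \<sigma> x)) (x + ?v))"
    unfolding energy_def rot by (simp add: potential_vshift) (simp add: vshift_def)
  also have "\<dots> = energy p L \<sigma>" unfolding energy_def by (rule integral_lebesgue_translation(2)) measurable
  finally show "energy p L (vshift a \<sigma>) = energy p L \<sigma>" .
qed

definition inf_value :: real where
  "inf_value = real_of_ereal (inf_energy p L M)"

text \<open>The left side of the coercivity estimate is nonnegative, so energies are at least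
  -C2/C1. Negativity of the infimum excludes plus infinity, and with it an empty class.\<close>

lemma inf_value: "inf_energy p L M = ereal inf_value" "inf_value < 0" "\<rho> \<in> admissible p L M \<Longrightarrow> inf_value \<le> energy p L \<rho>"
proof -
  obtain C1 C2 where C: "0 < C1" "0 < C2" "\<And>\<rho>. \<rho> \<in> admissible p L M \<Longrightarrow>
    (LINT x|lebesgue. A (\<rho> x) + 1/2 * rotation_density L \<rho> x) \<le> C1 * energy p L \<rho> + C2"
    using coercive by blast
  have lb: "- (C2 / C1) \<le> energy p L \<rho>" if "\<rho> \<in> admissible p L M" for \<rho>
  proof -
    note \<sigma> = configD[OF admissible_positive_part(2)[OF that]]
    have "0 \<le> (LINT x|lebesgue. A (max 0 (\<rho> x)))" "0 \<le> (LINT x|lebesgue. rotation_density L (\<lambda>x. max 0 (\<rho> x)) x)"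
      using A_nonneg \<sigma>(7) by (intro integral_nonneg_AE; simp)+
    then have "0 \<le> C1 * energy p L \<rho> + C2"
      using C(3)[OF that] unfolding admissible_positive_part(7)[OF that] by linarith
    then show ?thesis using C by (simp add: field_simps)
  qed
  have "ereal (- (C2 / C1)) \<le> inf_energy p L M"
    unfolding inf_energy_def using lb by (intro INF_greatest) auto
  then show eq: "inf_energy p L M = ereal inf_value"
    using inf_neg unfolding inf_value_def by (cases "inf_energy p L M") auto
  show "inf_value < 0" using inf_neg unfolding eq by simp
  show "inf_value \<le> energy p L \<rho>" if "\<rho> \<in> admissible p L M"
  proof -
    have "inf_energy p L M \<le> ereal (energy p L \<rho>)" unfolding inf_energy_def by (rule INF_lower[OF that])
    then show ?thesis unfolding eq by simp
  qed
qed

text \<open>Mass and internal energy scale by b^3, mutual energy by b^5. The scaling hypothesis with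
  factor 1/b^3 gives L(b^3 m) \<le> b^4 L(m); with b^3 from the volume and b^-2 from the weight
  1/r^2, rotation scales by at most b^5. As \<open>A\<close> is nonnegative and b \<ge> 1, the
  factor b^3 may be raised to b^5.\<close>

lemma scaled_config:
  assumes c: "config \<sigma>" and b: "1 \<le> b" and mass: "b ^ 3 * (LINT x|lebesgue. \<sigma> x) = M"
  defines "v \<equiv> \<lambda>x. \<sigma> ((1 / b) *\<^sub>R x)"
  shows "v \<in> admissible p L M" "energy p L v \<le> b ^ 5 * energy p L \<sigma>"
proof -
  note \<sigma> = configD[OF c]
  note [measurable] = borel_measurable_integrable[OF \<sigma>(3)] borel_measurable_integrable[OF \<sigma>(6)]
  have [measurable]: "potential \<sigma> \<in> borel_measurable lebesgue" by (rule potential_measurable) measurable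
  have b0: "0 < b" "0 < 1 / b" using b by auto
  have sc: "(LINT x|lebesgue. f ((1 / b) *\<^sub>R x)) = b ^ 3 * (LINT x|lebesgue. f x)"
    "integrable lebesgue (\<lambda>x. f ((1 / b) *\<^sub>R x)) \<longleftrightarrow> integrable lebesgue f"
    if "f \<in> borel_measurable lebesgue" for f :: "real^3 \<Rightarrow> real"
    using integral_lebesgue_affine[OF b0(2) that, of 0] b0(1) by (simp_all add: divide_inverse power_inverse)
  have cr: "cyl_radius ((1 / b) *\<^sub>R x) = cyl_radius x / b" for x
  proof -
    have "cyl_radius ((1 / b) *\<^sub>R x) = sqrt (((x$1)\<^sup>2 + (x$2)\<^sup>2) / b\<^sup>2)"
      by (simp add: cyl_radius_def power_divide add_divide_distrib)
    then show ?thesis using b0 by (simp add: real_sqrt_divide cyl_radius_def)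
  qed
  have iv: "integrable lebesgue v" and mv: "(LINT x|lebesgue. v x) = M"
    unfolding v_def using sc[of \<sigma>] \<sigma>(3) mass by auto
  have v0: "0 \<le> v x" for x by (simp add: v_def \<sigma>(2))
  have iA: "integrable lebesgue (\<lambda>x. A (v x))" and EA: "(LINT x|lebesgue. A (v x)) = b ^ 3 * (LINT x|lebesgue. A (\<sigma> x))"
    unfolding v_def using sc[of "\<lambda>x. A (\<sigma> x)"] \<sigma>(5) by auto
  have cm: "cyl_mass v r = b ^ 3 * cyl_mass \<sigma> (r / b)" for r
  proof -
    have "cyl_mass v r = (LINT x|lebesgue. (\<lambda>y. indicator {x. cyl_radius x < r / b} y * \<sigma> y) ((1 / b) *\<^sub>R x))"
      unfolding cyl_mass_def set_lebesgue_integral_def v_def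
      by (rule Bochner_Integration.integral_cong) (use b0 in \<open>auto simp: indicator_def cr divide_strict_right_mono divide_less_cancel\<close>)
    also have "\<dots> = b ^ 3 * cyl_mass \<sigma> (r / b)" unfolding cyl_mass_def set_lebesgue_integral_def by (subst sc) auto
    finally show ?thesis .
  qed
  have rot_le: "rotation_density L v x \<le> b\<^sup>2 * rotation_density L \<sigma> ((1 / b) *\<^sub>R x)" for x
  proof -
    define m where "m = cyl_mass \<sigma> (cyl_radius x / b)"
    have m: "0 \<le> m" "b ^ 3 * m \<le> M"
      using cyl_mass_bounds[OF \<sigma>(3,2)] mass b0 unfolding m_def by (auto intro: order_trans[OF mult_left_mono])
    have "(1 / b ^ 3) powr (4/3) * L (b ^ 3 * m) \<le> L (1 / b ^ 3 * (b ^ 3 * m))"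
      using m b0 b by (intro L_scale) auto
    moreover have "(1 / b ^ 3) powr (4/3) = 1 / b ^ 4"
      using b0 by (simp add: powr_divide powr_powr flip: powr_realpow powr_numeral)
    ultimately have Lm: "L (b ^ 3 * m) \<le> b ^ 4 * L m" using b0 by (simp add: field_simps)
    have "rotation_density L v x = \<sigma> ((1 / b) *\<^sub>R x) * L (b ^ 3 * m) / (cyl_radius x)\<^sup>2"
      unfolding rotation_density_def cm m_def by (simp add: v_def)
    also have "\<dots> \<le> \<sigma> ((1 / b) *\<^sub>R x) * (b ^ 4 * L m) / (cyl_radius x)\<^sup>2"
      using Lm \<sigma>(2) by (intro divide_right_mono mult_left_mono) auto
    also have "\<dots> = b\<^sup>2 * rotation_density L \<sigma> ((1 / b) *\<^sub>R x)"
      using b0 by (simp add: rotation_density_def cr m_def power_divide eval_nat_numeral)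
    finally show ?thesis .
  qed
  have mrot: "rotation_density L v \<in> borel_measurable lebesgue" using mv by (intro rotation_density_measurable iv v0) auto
  have rot0: "0 \<le> rotation_density L v x" for x using mv by (intro rotation_density_nonneg iv v0) auto
  have ir: "integrable lebesgue (\<lambda>x. b\<^sup>2 * rotation_density L \<sigma> ((1 / b) *\<^sub>R x))"
    using sc(2)[of "rotation_density L \<sigma>"] \<sigma>(6) by auto
  have iR: "integrable lebesgue (rotation_density L v)"
    by (rule integrable_AE_bound[OF ir mrot]) (use rot_le rot0 in auto)
  have ER: "(LINT x|lebesgue. rotation_density L v x) \<le> b ^ 5 * (LINT x|lebesgue. rotation_density L \<sigma> x)"
  proof -
    have "(LINT x|lebesgue. rotation_density L v x) \<le> (LINT x|lebesgue. b\<^sup>2 * rotation_density L \<sigma> ((1 / b) *\<^sub>R x))"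
      by (rule integral_mono[OF iR ir rot_le])
    also have "\<dots> = b ^ 5 * (LINT x|lebesgue. rotation_density L \<sigma> x)"
      using sc(1)[of "rotation_density L \<sigma>"] by (simp add: eval_nat_numeral)
    finally show ?thesis .
  qed
  have "axisymmetric v"
    using \<sigma>(1) unfolding axisymmetric_iff v_def by (simp add: cr)
  then have cv: "config v" using v0 iv mv iA iR by (simp add: config_def)
  show "v \<in> admissible p L M" by (rule config_admissible[OF cv mv])
  have pot: "potential v x = b\<^sup>2 * potential \<sigma> ((1 / b) *\<^sub>R x)" for x
  proof -
    have "norm (x - y) = b * norm ((1 / b) *\<^sub>R x - (1 / b) *\<^sub>R y)" for y
      using b0 by (simp flip: scaleR_diff_right)
    then have "potential v x = (LINT y|lebesgue. (\<lambda>y. (1 / b) * (\<sigma> y / norm ((1 / b) *\<^sub>R x - y))) ((1 / b) *\<^sub>R y))"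
      unfolding potential_def v_def by simp
    also have "\<dots> = b ^ 3 * ((1 / b) * potential \<sigma> ((1 / b) *\<^sub>R x))"
      unfolding potential_def by (subst sc) (auto simp del: times_divide_eq_left times_divide_eq_right)
    finally show ?thesis using b0 by (simp add: eval_nat_numeral)
  qed
  have "mutual_energy v v = (LINT x|lebesgue. v x * potential v x)"
    by (rule mutual_energy_potential(2)[OF config_star_density(1)[OF cv] config_star_density(1)[OF cv], symmetric])
  also have "\<dots> = (LINT x|lebesgue. (\<lambda>x. b\<^sup>2 * (\<sigma> x * potential \<sigma> x)) ((1 / b) *\<^sub>R x))"
    unfolding pot by (simp add: v_def mult.left_commute)
  also have "\<dots> = b ^ 3 * (b\<^sup>2 * mutual_energy \<sigma> \<sigma>)"
    using mutual_energy_potential(2)[OF config_star_density(1)[OF c] config_star_density(1)[OF c]]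
    by (subst sc) auto
  finally have EM: "mutual_energy v v = b ^ 5 * mutual_energy \<sigma> \<sigma>" by (simp add: eval_nat_numeral)
  have "b ^ 3 * (LINT x|lebesgue. A (\<sigma> x)) \<le> b ^ 5 * (LINT x|lebesgue. A (\<sigma> x))"
    using b A_nonneg by (intro mult_right_mono power_increasing integral_nonneg_AE) auto
  then show "energy p L v \<le> b ^ 5 * energy p L \<sigma>"
    unfolding config_energy[OF cv] config_energy[OF c] EA EM using ER by (simp add: algebra_simps)
qed

text \<open>The stretching factor is the cube root of M/m, so its fifth power is (M/m)^(5/3). As the
  infimum is negative, a larger mass \<open>m'\<close> only weakens the bound; this slack admits
  approximate masses.\<close>

lemma energy_lower_bound:
  assumes c: "config \<sigma>" and m: "0 < (LINT x|lebesgue. \<sigma> x)" "(LINT x|lebesgue. \<sigma> x) \<le> m'"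
  shows "(m' / M) powr (5/3) * inf_value \<le> energy p L \<sigma>"
proof -
  define m where "m = (LINT x|lebesgue. \<sigma> x)"
  have m0: "0 < m" "m \<le> M" "m \<le> m'" using assms configD(4)[OF c] by (auto simp: m_def)
  define b where "b = (M / m) powr (1/3)"
  have b1: "1 \<le> b" using m0 M_pos by (auto simp: b_def intro!: ge_one_powr_ge_zero)
  have b3: "b ^ 3 = M / m" using m0 M_pos by (simp add: b_def powr_powr flip: powr_numeral)
  have b5: "b ^ 5 = (M / m) powr (5/3)" using m0 M_pos by (simp add: b_def powr_powr flip: powr_numeral)
  have "b ^ 3 * (LINT x|lebesgue. \<sigma> x) = M" using b3 m0 by (simp add: m_def[symmetric])
  note s = scaled_config[OF c b1 this]
  have "inf_value \<le> (M / m) powr (5/3) * energy p L \<sigma>"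
    using inf_value(3)[OF s(1)] s(2) b5 by simp
  then have "(m / M) powr (5/3) * inf_value \<le> (m / M) powr (5/3) * ((M / m) powr (5/3) * energy p L \<sigma>)"
    by (rule mult_left_mono) simp
  also have "\<dots> = energy p L \<sigma>" using m0 M_pos by (simp add: powr_divide)
  finally have "(m / M) powr (5/3) * inf_value \<le> energy p L \<sigma>" .
  moreover have "(m' / M) powr (5/3) * inf_value \<le> (m / M) powr (5/3) * inf_value"
    using m0 M_pos inf_value(2) by (intro mult_right_mono_neg powr_mono2 divide_right_mono) auto
  ultimately show ?thesis by linarith
qed

end

section \<open>Concentration and conservation of mass\<close>

lemma near_bound_le:
  assumes "L43 f \<le> N" "L43 g \<le> N" "0 \<le> \<delta>"
  shows "near_bound \<delta> f g \<le> sqrt \<delta> * ((1 + near_const) * (N * N + N + N))"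
proof -
  have "0 \<le> N" using L43_nonneg[of f] assms(1) by linarith
  then have "L43 f * L43 g + L43 f + L43 g \<le> N * N + N + N"
    by (intro add_mono mult_mono assms(1,2) L43_nonneg)
  then have "(1 + near_const) * (L43 f * L43 g + L43 f + L43 g) \<le> (1 + near_const) * (N * N + N + N)"
    using near_const_nonneg by (intro mult_left_mono) auto
  then show ?thesis
    unfolding near_bound_def mult.assoc by (rule mult_left_mono) (use assms(3) in simp)
qed

lemma integral_ball_tendsto:
  fixes f :: "real^3 \<Rightarrow> real"
  assumes i: "integrable lebesgue f"
  shows "(\<lambda>n. LINT x|lebesgue. f x * indicator (ball 0 (real n)) x) \<longlonglongrightarrow> (LINT x|lebesgue. f x)"
proof (rule integral_dominated_convergence[where w = "\<lambda>x. norm (f x)"])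
  show "AE x in lebesgue. (\<lambda>n. f x * indicator (ball 0 (real n)) x) \<longlonglongrightarrow> f x"
  proof (rule AE_I2)
    fix x :: "real^3"
    obtain n0 where "norm x < real n0" using reals_Archimedean2 by blast
    then have "eventually (\<lambda>n. f x * indicator (ball 0 (real n)) x = f x) sequentially"
      unfolding eventually_sequentially by (intro exI[of _ n0]) auto
    then show "(\<lambda>n. f x * indicator (ball 0 (real n)) x) \<longlonglongrightarrow> f x" by (rule tendsto_eventually)
  qed
qed (use i borel_measurable_integrable[OF i] in \<open>auto simp: indicator_def\<close>)

lemma integrable_mult_ball:
  fixes f :: "real^3 \<Rightarrow> real"
  assumes "integrable lebesgue f"
  shows "integrable lebesgue (\<lambda>x. f x * indicator (ball z R) x)"
  using integrable_mult_indicator[OF sets_lebesgue_ball assms] by (simp add: mult.commute)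

context rotating_star
begin

lemma config_restrict:
  assumes c: "config \<rho>" and S: "S \<in> sets lebesgue" "axisymmetric (indicator S)"
  shows "config (\<lambda>x. \<rho> x * indicator S x)"
proof -
  note \<rho> = configD[OF c]
  let ?\<sigma> = "\<lambda>x. \<rho> x * indicator S x"
  note [measurable] = borel_measurable_integrable[OF \<rho>(3)] S(1)
  have i: "integrable lebesgue ?\<sigma>" using integrable_mult_indicator[OF S(1) \<rho>(3)] by (simp add: mult.commute)
  have nn: "0 \<le> ?\<sigma> x" and le: "?\<sigma> x \<le> \<rho> x" for x using \<rho>(2)[of x] by (auto simp: indicator_def)
  have m: "(LINT x|lebesgue. ?\<sigma> x) \<le> M" using integral_mono[OF i \<rho>(3) le] \<rho>(4) by linarith
  have "A (?\<sigma> x) = A (\<rho> x) * indicator S x" for x by (simp add: indicator_def)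
  then have iA: "integrable lebesgue (\<lambda>x. A (?\<sigma> x))"
    using integrable_mult_indicator[OF S(1) \<rho>(5)] by (simp add: mult.commute)
  have rot: "rotation_density L ?\<sigma> x \<le> rotation_density L \<rho> x" for x
  proof -
    have L0: "0 \<le> L (cyl_mass \<rho> (cyl_radius x))"
      using cyl_mass_bounds[OF \<rho>(3,2)] \<rho>(4) by (intro L_nonneg) (auto intro: order_trans)
    have "rotation_density L ?\<sigma> x \<le> ?\<sigma> x * L (cyl_mass \<rho> (cyl_radius x)) / (cyl_radius x)\<^sup>2"
      by (rule rotation_density_mono[OF i nn le \<rho>(3,4)])
    also have "\<dots> \<le> rotation_density L \<rho> x"
      unfolding rotation_density_def using L0 le by (intro divide_right_mono mult_right_mono) auto
    finally show ?thesis .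
  qed
  have "integrable lebesgue (rotation_density L ?\<sigma>)"
    by (rule integrable_AE_bound[OF \<rho>(6) rotation_density_measurable[OF i nn m]])
      (use rot rotation_density_nonneg[OF i nn m] in auto)
  then show ?thesis unfolding config_def using axisymmetric_mult[OF \<rho>(1) S(2)] nn i m iA by blast
qed

text \<open>Cutting and dropping the shell only lowers internal and rotational energy, so the loss
  is gravitational. Ball against exterior costs at most M^2/(R2 - R1) by separation. The shell
  enters through \<open>mutual_energy \<rho>2 \<rho>13\<close> and
  \<open>mutual_energy \<rho>2 \<rho>\<close>; the first is at most the second, and the factor 1/2
  absorbs the doubling.\<close>

lemma energy_split:
  assumes c: "config \<rho>" and R: "R1 < R2"
  defines "\<rho>1 \<equiv> \<lambda>x. \<rho> x * indicator (ball 0 R1) x" and "\<rho>2 \<equiv> \<lambda>x. \<rho> x * indicator (ball 0 R2 - ball 0 R1) x"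
    and "\<rho>3 \<equiv> \<lambda>x. \<rho> x * indicator (- ball 0 R2) x"
  shows "config \<rho>1" "config \<rho>3" "star_density \<rho>2"
    "energy p L \<rho>1 + energy p L \<rho>3 - M\<^sup>2 / (R2 - R1) - mutual_energy \<rho>2 \<rho> \<le> energy p L \<rho>"
proof -
  note \<rho> = configD[OF c]
  note s = config_star_density(1)[OF c]
  note [measurable] = borel_measurable_integrable[OF \<rho>(3)]
  show c1: "config \<rho>1" unfolding \<rho>1_def by (rule config_restrict[OF c _ axisymmetric_ball]) measurable
  show c3: "config \<rho>3" unfolding \<rho>3_def by (rule config_restrict[OF c _ axisymmetric_compl[OF axisymmetric_ball]]) auto
  note s1 = config_star_density(1)[OF c1] and s3 = config_star_density(1)[OF c3]
  show s2: "star_density \<rho>2"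
    by (rule star_density_le[OF s]) (use \<rho>(2) in \<open>auto simp: \<rho>2_def indicator_def\<close>)
  define \<rho>13 where "\<rho>13 = (\<lambda>x. \<rho>1 x + \<rho>3 x)"
  have B: "x \<in> ball 0 R1 \<Longrightarrow> x \<in> ball 0 R2" for x :: "real^3" using R by auto
  have s13: "star_density \<rho>13"
  proof (rule star_density_le[OF s])
    show "\<rho>13 x \<le> \<rho> x" for x using \<rho>(2)[of x] B[of x] by (auto simp: \<rho>13_def \<rho>1_def \<rho>3_def indicator_def)
  qed (use \<rho>(2) in \<open>auto simp: \<rho>13_def \<rho>1_def \<rho>3_def indicator_def\<close>)
  have sum: "\<rho> = (\<lambda>x. \<rho>13 x + \<rho>2 x)"
    using B by (auto simp: \<rho>13_def \<rho>1_def \<rho>2_def \<rho>3_def indicator_def fun_eq_iff)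
  have "mutual_energy \<rho> \<rho> = mutual_energy \<rho>13 \<rho> + mutual_energy \<rho>2 \<rho>"
    using mutual_energy_add_left[OF s13 s2 s] sum by simp
  also have "mutual_energy \<rho>13 \<rho> = mutual_energy \<rho>13 \<rho>13 + mutual_energy \<rho>2 \<rho>13"
    using mutual_energy_add_left[OF s13 s2 s13] mutual_energy_commute[OF s13 s] sum by simp
  also have "mutual_energy \<rho>13 \<rho>13 = mutual_energy \<rho>1 \<rho>1 + mutual_energy \<rho>3 \<rho>3 + 2 * mutual_energy \<rho>1 \<rho>3"
  proof -
    have "mutual_energy \<rho>13 \<rho>13 = mutual_energy \<rho>1 \<rho>13 + mutual_energy \<rho>3 \<rho>13"
      unfolding \<rho>13_def by (rule mutual_energy_add_left[OF s1 s3 s13[unfolded \<rho>13_def]])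
    also have "mutual_energy \<rho>1 \<rho>13 = mutual_energy \<rho>1 \<rho>1 + mutual_energy \<rho>3 \<rho>1"
      using mutual_energy_add_left[OF s1 s3 s1] mutual_energy_commute[OF s1 s13] by (simp add: \<rho>13_def)
    also have "mutual_energy \<rho>3 \<rho>13 = mutual_energy \<rho>1 \<rho>3 + mutual_energy \<rho>3 \<rho>3"
      using mutual_energy_add_left[OF s1 s3 s3] mutual_energy_commute[OF s3 s13] by (simp add: \<rho>13_def)
    finally show ?thesis using mutual_energy_commute[OF s1 s3] by simp
  qed
  finally have ME: "mutual_energy \<rho> \<rho> = mutual_energy \<rho>1 \<rho>1 + mutual_energy \<rho>3 \<rho>3 + 2 * mutual_energy \<rho>1 \<rho>3
      + mutual_energy \<rho>2 \<rho>13 + mutual_energy \<rho>2 \<rho>" .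
  have me13: "mutual_energy \<rho>1 \<rho>3 \<le> M\<^sup>2 / (R2 - R1)"
  proof -
    have "mutual_energy \<rho>1 \<rho>3 \<le> (LINT x|lebesgue. \<rho>1 x) * (LINT x|lebesgue. \<rho>3 x) / (R2 - R1)"
    proof (rule mutual_energy_separated[OF s1 s3])
      fix x y assume "\<rho>1 x \<noteq> 0" "\<rho>3 y \<noteq> 0"
      then have "norm x < R1" "R2 \<le> norm y" by (auto simp: \<rho>1_def \<rho>3_def indicator_def split: if_splits)
      then show "R2 - R1 \<le> norm (x - y)" using norm_triangle_ineq2[of y x] by (simp add: norm_minus_commute)
    qed (use R in simp)
    also have "\<dots> \<le> M * M / (R2 - R1)"
      using R configD(2,4)[OF c1] configD(2,4)[OF c3] M_pos
      by (intro divide_right_mono mult_mono integral_nonneg_AE) auto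
    finally show ?thesis by (simp add: power2_eq_square)
  qed
  have me2: "mutual_energy \<rho>2 \<rho>13 \<le> mutual_energy \<rho>2 \<rho>"
  proof -
    have "mutual_energy \<rho>2 \<rho> = mutual_energy \<rho>13 \<rho>2 + mutual_energy \<rho>2 \<rho>2"
      using mutual_energy_add_left[OF s13 s2 s2] mutual_energy_commute[OF s2 s] sum by simp
    then show ?thesis using mutual_energy_nonneg[OF s2 s2] mutual_energy_commute[OF s13 s2] by simp
  qed
  have EA: "(LINT x|lebesgue. A (\<rho>1 x)) + (LINT x|lebesgue. A (\<rho>3 x)) \<le> (LINT x|lebesgue. A (\<rho> x))"
  proof -
    have "(LINT x|lebesgue. A (\<rho>1 x)) + (LINT x|lebesgue. A (\<rho>3 x)) = (LINT x|lebesgue. A (\<rho>1 x) + A (\<rho>3 x))"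
      using configD(5)[OF c1] configD(5)[OF c3] by simp
    also have "\<dots> \<le> (LINT x|lebesgue. A (\<rho> x))"
    proof (rule integral_mono)
      show "A (\<rho>1 x) + A (\<rho>3 x) \<le> A (\<rho> x)" for x
        using B[of x] A_nonneg[of "\<rho> x"] by (auto simp: \<rho>1_def \<rho>3_def indicator_def)
    qed (use configD(5)[OF c1] configD(5)[OF c3] \<rho> in auto)
    finally show ?thesis .
  qed
  have ER: "(LINT x|lebesgue. rotation_density L \<rho>1 x) + (LINT x|lebesgue. rotation_density L \<rho>3 x) \<le> (LINT x|lebesgue. rotation_density L \<rho> x)"
  proof -
    have "(LINT x|lebesgue. rotation_density L \<rho>1 x) + (LINT x|lebesgue. rotation_density L \<rho>3 x) =
        (LINT x|lebesgue. rotation_density L \<rho>1 x + rotation_density L \<rho>3 x)"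
      using configD(6)[OF c1] configD(6)[OF c3] by simp
    also have "\<dots> \<le> (LINT x|lebesgue. rotation_density L \<rho> x)"
    proof (rule integral_mono)
      fix x
      let ?l = "L (cyl_mass \<rho> (cyl_radius x))"
      have le: "\<rho>1 x \<le> \<rho> x" "\<rho>3 x \<le> \<rho> x" for x using \<rho>(2)[of x] by (auto simp: \<rho>1_def \<rho>3_def indicator_def)
      have l0: "0 \<le> ?l" using cyl_mass_bounds[OF \<rho>(3,2)] \<rho>(4) by (intro L_nonneg) (auto intro: order_trans)
      have "rotation_density L \<rho>1 x + rotation_density L \<rho>3 x \<le> \<rho>1 x * ?l / (cyl_radius x)\<^sup>2 + \<rho>3 x * ?l / (cyl_radius x)\<^sup>2"
        by (intro add_mono rotation_density_mono configD[OF c1] configD[OF c3] le \<rho>)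
      also have "\<dots> = (\<rho>1 x + \<rho>3 x) * ?l / (cyl_radius x)\<^sup>2" by (simp add: add_divide_distrib distrib_right)
      also have "\<dots> \<le> \<rho> x * ?l / (cyl_radius x)\<^sup>2"
      proof -
        have "\<rho>1 x + \<rho>3 x \<le> \<rho> x" using \<rho>(2)[of x] B[of x] by (auto simp: \<rho>1_def \<rho>3_def indicator_def)
        then show ?thesis using l0 by (intro divide_right_mono mult_right_mono) auto
      qed
      finally show "rotation_density L \<rho>1 x + rotation_density L \<rho>3 x \<le> rotation_density L \<rho> x"
        by (simp add: rotation_density_def)
    qed (use configD(6)[OF c1] configD(6)[OF c3] \<rho> in auto)
    finally show ?thesis .
  qed
  show "energy p L \<rho>1 + energy p L \<rho>3 - M\<^sup>2 / (R2 - R1) - mutual_energy \<rho>2 \<rho> \<le> energy p L \<rho>"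
    unfolding config_energy[OF c] config_energy[OF c1] config_energy[OF c3]
    using ME me13 me2 EA ER by argo
qed

text \<open>Near, middle and far part of the mutual energy are each tuned to d/4, so unless some
  ball of radius \<open>R\<close> carries more than \<open>\<eta>\<close>, their sum stays below d.
  Symmetry keeps its centre within \<open>r0\<close> of the axis, and radius R + r0 around the axis
  point of equal height covers it. No constant depends on \<open>\<sigma>\<close>.\<close>

lemma concentrated_ball:
  assumes "0 < d" "0 \<le> N"
  shows "\<exists>R>0. \<exists>\<eta>>0. \<forall>\<sigma>. config \<sigma> \<longrightarrow> L43 \<sigma> \<le> N \<longrightarrow> d \<le> mutual_energy \<sigma> \<sigma> \<longrightarrow>
    (\<exists>a. \<eta> \<le> (LINT x|lebesgue. vshift a \<sigma> x * indicator (ball 0 R) x))"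
proof -
  define C where "C = (1 + near_const) * (N * N + N + N) + 1"
  have C: "0 < C" using assms near_const_nonneg by (auto simp: C_def intro!: add_nonneg_pos mult_nonneg_nonneg)
  define \<delta> where "\<delta> = (d / (4 * C))\<^sup>2"
  have \<delta>: "0 < \<delta>" "sqrt \<delta> * C = d / 4" using assms C by (auto simp: \<delta>_def)
  define \<eta> where "\<eta> = \<delta> * d / (4 * M)"
  have \<eta>: "0 < \<eta>" "M * \<eta> / \<delta> = d / 4" using \<delta> assms M_pos by (auto simp: \<eta>_def field_simps)
  define R where "R = 4 * M\<^sup>2 / d"
  have R: "0 < R" "M\<^sup>2 / R = d / 4" using assms M_pos by (auto simp: R_def)
  \<comment> \<open>With more than M/\<eta> disjoint rotated copies of a ball of mass \<eta>, the
    total mass would be exceeded.\<close>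
  obtain n0 where n0: "M / \<eta> < real n0" using reals_Archimedean2 by blast
  define n where "n = Suc n0"
  have n: "0 < n" "M < real n * \<eta>" using n0 \<eta>(1) by (auto simp: n_def field_simps intro: less_trans)
  define r0 where "r0 = sqrt (2 * R\<^sup>2 / (1 - cos (1 / real n)))"
  have cn: "0 \<le> 1 - cos (1 / real n)" by simp
  have "\<exists>a. \<eta> \<le> (LINT x|lebesgue. vshift a \<sigma> x * indicator (ball 0 (R + r0)) x)"
    if c: "config \<sigma>" and N: "L43 \<sigma> \<le> N" and d: "d \<le> mutual_energy \<sigma> \<sigma>" for \<sigma>
  proof -
    note \<sigma> = configD[OF c] and s = config_star_density(1)[OF c]
    note [measurable] = borel_measurable_integrable[OF \<sigma>(3)]
    have "\<exists>x. \<eta> < (LINT y:ball x R|lebesgue. \<sigma> y)"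
    proof (rule ccontr)
      assume "\<not> ?thesis"
      then have le: "\<And>x. (LINT y:ball x R|lebesgue. \<sigma> y) \<le> \<eta>" by (simp add: not_less)
      let ?m = "LINT x|lebesgue. \<sigma> x"
      have m0: "0 \<le> ?m" using \<sigma>(2) by (intro integral_nonneg_AE) auto
      have "mutual_energy \<sigma> \<sigma> \<le> near_bound \<delta> \<sigma> \<sigma> + ?m * \<eta> / \<delta> + ?m * ?m / R"
        by (rule mutual_energy_split_middle[OF s s \<delta>(1) R(1) le])
      also have "near_bound \<delta> \<sigma> \<sigma> \<le> sqrt \<delta> * ((1 + near_const) * (N * N + N + N))"
        using \<delta> by (intro near_bound_le N) auto
      also have "\<dots> \<le> sqrt \<delta> * C" unfolding C_def using \<delta> by (intro mult_left_mono) auto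
      also have "?m * \<eta> / \<delta> \<le> M * \<eta> / \<delta>" using \<delta> \<eta> \<sigma>(4) by (intro divide_right_mono mult_right_mono) auto
      also have "?m * ?m / R \<le> M\<^sup>2 / R" using R \<sigma>(4) m0 unfolding power2_eq_square by (intro divide_right_mono mult_mono) auto
      finally show False using d \<delta>(2) \<eta>(2) R(2) \<open>0 < d\<close> by linarith
    qed
    then obtain x where x: "\<eta> < (LINT y:ball x R|lebesgue. \<sigma> y)" by blast
    have near: "cyl_radius x \<le> r0"
    proof (rule ccontr)
      assume "\<not> ?thesis"
      then have "r0\<^sup>2 \<le> (cyl_radius x)\<^sup>2" by (intro power_mono) (auto simp: r0_def)
      then have "2 * R\<^sup>2 / (1 - cos (1 / real n)) \<le> (cyl_radius x)\<^sup>2" using cn by (simp add: r0_def)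
      then have "real n * (LINT y:ball x R|lebesgue. \<sigma> y) \<le> (LINT y|lebesgue. \<sigma> y)"
        by (rule axisymmetric_ball_mass_far[OF \<sigma>(1,3,2) n(1)])
      moreover have "real n * \<eta> \<le> real n * (LINT y:ball x R|lebesgue. \<sigma> y)" using x by (intro mult_left_mono) auto
      ultimately show False using n(2) \<sigma>(4) by linarith
    qed
    let ?e = "(x$3) *\<^sub>R axis 3 1 :: real^3"
    have "(norm (x - ?e))\<^sup>2 = (cyl_radius x)\<^sup>2"
      by (simp add: norm_cyl) (simp add: cyl_radius_def axis_def)
    then have nx: "norm (x - ?e) = cyl_radius x" using cyl_radius_nonneg by (auto intro: power2_eq_imp_eq)
    have "(LINT y:ball x R|lebesgue. \<sigma> y) \<le> (LINT y|lebesgue. \<sigma> y * indicator (ball ?e (R + r0)) y)"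
      unfolding set_lebesgue_integral_def
    proof (rule integral_mono)
      show "integrable lebesgue (\<lambda>y. indicat_real (ball x R) y *\<^sub>R \<sigma> y)"
        using integrable_mult_ball[OF \<sigma>(3)] by (simp add: mult.commute)
      show "indicat_real (ball x R) y *\<^sub>R \<sigma> y \<le> \<sigma> y * indicator (ball ?e (R + r0)) y" for y
      proof (cases "y \<in> ball x R")
        case True
        have "dist ?e y \<le> dist ?e x + dist x y" by (rule dist_triangle)
        also have "dist ?e x \<le> r0" using nx near by (simp add: dist_norm norm_minus_commute)
        finally have "dist ?e y < r0 + R" using True by simp
        then show ?thesis by (simp add: add.commute indicator_def \<sigma>(2))
      qed (use \<sigma>(2) in auto)
    qed (rule integrable_mult_ball[OF \<sigma>(3)])
    also have "\<dots> = (LINT y|lebesgue. (\<lambda>y. \<sigma> y * indicator (ball ?e (R + r0)) y) (y + ?e))"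
      by (rule integral_lebesgue_translation(2)[symmetric]) measurable
    also have "\<dots> = (LINT y|lebesgue. vshift (x$3) \<sigma> y * indicator (ball 0 (R + r0)) y)"
      by (simp add: vshift_def indicator_def dist_norm)
    finally show ?thesis using x by (intro exI[of _ "x$3"]) linarith
  qed
  moreover have "0 < R + r0" using R(1) cn by (simp add: r0_def add_pos_nonneg)
  ultimately show ?thesis using \<eta>(1) by blast
qed

lemma powr_five_thirds_strict:
  fixes t :: real
  assumes "0 < t" "t < 1"
  shows "t powr (5/3) < t"
  using powr_less_mono'[of t 1 "5/3"] assms by simp

lemma mass_conserved:
  fixes F :: "real^3 \<Rightarrow> real"
  assumes c: "\<And>i. config (\<sigma> i)" and mass: "\<And>i. (LINT x|lebesgue. \<sigma> i x) = M"
    and en: "(\<lambda>i. energy p L (\<sigma> i)) \<longlonglongrightarrow> inf_value" and N: "\<And>i. L43 (\<sigma> i) \<le> N" "0 \<le> N"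
    and iF: "integrable lebesgue F" and nnF: "\<And>x. 0 \<le> F x"
    and weak: "\<And>R. (\<lambda>i. LINT x|lebesgue. \<sigma> i x * indicator (ball 0 R) x) \<longlonglongrightarrow> (LINT x|lebesgue. F x * indicator (ball 0 R) x)"
    and \<eta>: "0 < \<eta>" "\<And>i. \<eta> \<le> (LINT x|lebesgue. \<sigma> i x * indicator (ball 0 R0) x)"
  shows "(LINT x|lebesgue. F x) = M"
proof (rule ccontr)
  assume ne: "(LINT x|lebesgue. F x) \<noteq> M"
  define m where "m = (LINT x|lebesgue. F x)"
  define b where "b R = (LINT x|lebesgue. F x * indicator (ball 0 R) x)" for R
  define s where "s i R = (LINT x|lebesgue. \<sigma> i x * indicator (ball 0 R) x)" for i R
  have s_lim: "(\<lambda>i. s i R) \<longlonglongrightarrow> b R" for R unfolding s_def b_def by (rule weak)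
  have b_m: "b R \<le> m" for R
    unfolding b_def m_def by (rule integral_mono[OF integrable_mult_ball[OF iF] iF]) (use nnF in \<open>auto simp: indicator_def\<close>)
  have s_M: "s i R \<le> M" for i R
    unfolding s_def mass[of i, symmetric]
    by (rule integral_mono[OF integrable_mult_ball[OF configD(3)[OF c]] configD(3)[OF c]]) (use configD(2)[OF c] in \<open>auto simp: indicator_def\<close>)
  have b_mono: "b R \<le> b R'" if "R \<le> R'" for R R'
    unfolding b_def by (rule integral_mono[OF integrable_mult_ball[OF iF] integrable_mult_ball[OF iF]])
      (use that nnF in \<open>auto simp: indicator_def\<close>)
  have b_lim: "(\<lambda>n. b (real n)) \<longlonglongrightarrow> m" unfolding b_def m_def by (rule integral_ball_tendsto[OF iF])
  have "b R \<le> M" for R by (rule LIMSEQ_le_const2[OF s_lim]) (use s_M in auto)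
  then have "m \<le> M" by (intro LIMSEQ_le_const2[OF b_lim]) auto
  then have mM: "m < M" using ne by (simp add: m_def)
  have "\<eta> \<le> b R0" by (rule LIMSEQ_le_const[OF s_lim]) (use \<eta> in \<open>auto simp: s_def\<close>)
  then have m0: "0 < m" using b_m[of R0] \<eta>(1) by linarith
  define C where "C = (1 + near_const) * (N * N + N + N)"
  \<comment> \<open>The inner radius captures the limit mass up to \<epsilon>. Eventually both
    spheres enclose between m - \<epsilon> and m + \<epsilon>, so the shell carries at most 2
    \<epsilon> whatever its width \<open>d\<close>. The smallness conditions leave positive mass
    both inside and outside.\<close>
  have step: "inf_value * (((m + \<epsilon>) / M) powr (5/3) + ((M - m + \<epsilon>) / M) powr (5/3)) - M\<^sup>2 / d - (sqrt \<delta> * C + 2 * \<epsilon> * M / \<delta>) \<le> inf_value"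
    if pos: "0 < \<epsilon>" "0 < \<delta>" "0 < d" and small: "\<epsilon> < m" "\<epsilon> < M - m" for \<epsilon> \<delta> d
  proof -
    have "eventually (\<lambda>n. m - \<epsilon> < b (real n)) sequentially"
      by (rule order_tendstoD(1)[OF b_lim]) (use pos in simp)
    then obtain n where n: "m - \<epsilon> < b (real n)" by (auto simp: eventually_sequentially)
    define R1 R2 where "R1 = real n" and "R2 = R1 + d"
    have R: "R1 < R2" using pos by (simp add: R2_def)
    have bR: "m - \<epsilon> < b R1" "m - \<epsilon> < b R2" using n b_mono[of R1 R2] R by (auto simp: R1_def)
    have "eventually (\<lambda>i. m - \<epsilon> < s i R1 \<and> s i R1 < m + \<epsilon> \<and> m - \<epsilon> < s i R2 \<and> s i R2 < m + \<epsilon>) sequentially"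
      using order_tendstoD(1)[OF s_lim[of R1] bR(1)] order_tendstoD(1)[OF s_lim[of R2] bR(2)]
        order_tendstoD(2)[OF s_lim[of R1], of "m + \<epsilon>"] order_tendstoD(2)[OF s_lim[of R2], of "m + \<epsilon>"]
        b_m[of R1] b_m[of R2] pos(1) by (auto simp: eventually_conj_iff le_less_trans)
    then have "eventually (\<lambda>i. inf_value * (((m + \<epsilon>) / M) powr (5/3) + ((M - m + \<epsilon>) / M) powr (5/3)) - M\<^sup>2 / d - (sqrt \<delta> * C + 2 * \<epsilon> * M / \<delta>) \<le> energy p L (\<sigma> i)) sequentially"
    proof eventually_elim
      case (elim i)
      let ?\<rho>1 = "\<lambda>x. \<sigma> i x * indicator (ball 0 R1) x" and ?\<rho>2 = "\<lambda>x. \<sigma> i x * indicator (ball 0 R2 - ball 0 R1) x"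
        and ?\<rho>3 = "\<lambda>x. \<sigma> i x * indicator (- ball 0 R2) x"
      note i\<sigma> = configD(3)[OF c[of i]]
      note es = energy_split[OF c[of i] R]
      have m1: "(LINT x|lebesgue. ?\<rho>1 x) = s i R1" by (simp add: s_def)
      have m3: "(LINT x|lebesgue. ?\<rho>3 x) = M - s i R2"
      proof -
        have "(LINT x|lebesgue. ?\<rho>3 x) = (LINT x|lebesgue. \<sigma> i x - \<sigma> i x * indicator (ball 0 R2) x)"
          by (rule Bochner_Integration.integral_cong) (auto simp: indicator_def)
        then show ?thesis using i\<sigma> integrable_mult_ball[OF i\<sigma>] mass by (simp add: s_def)
      qed
      have m2: "(LINT x|lebesgue. ?\<rho>2 x) = s i R2 - s i R1"
      proof -
        have "(LINT x|lebesgue. ?\<rho>2 x) = (LINT x|lebesgue. \<sigma> i x * indicator (ball 0 R2) x - \<sigma> i x * indicator (ball 0 R1) x)"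
          by (rule Bochner_Integration.integral_cong) (use R in \<open>auto simp: indicator_def\<close>)
        then show ?thesis using integrable_mult_ball[OF i\<sigma>] by (simp add: s_def)
      qed
      have e1: "((m + \<epsilon>) / M) powr (5/3) * inf_value \<le> energy p L ?\<rho>1"
        by (rule energy_lower_bound[OF es(1)]) (use m1 elim small in auto)
      have e3: "((M - m + \<epsilon>) / M) powr (5/3) * inf_value \<le> energy p L ?\<rho>3"
        by (rule energy_lower_bound[OF es(2)]) (use m3 elim small in auto)
      have "mutual_energy ?\<rho>2 (\<sigma> i) \<le> near_bound \<delta> ?\<rho>2 (\<sigma> i) + (LINT x|lebesgue. ?\<rho>2 x) * (LINT x|lebesgue. \<sigma> i x) / \<delta>"
        by (rule mutual_energy_split[OF es(3) config_star_density(1)[OF c] pos(2)])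
      also have "near_bound \<delta> ?\<rho>2 (\<sigma> i) \<le> sqrt \<delta> * C"
        unfolding C_def
      proof (rule near_bound_le[OF _ N(1)])
        have "L43 ?\<rho>2 \<le> L43 (\<sigma> i)"
          by (rule integral_mono[OF star_densityD(4)[OF es(3)] star_densityD(4)[OF config_star_density(1)[OF c]]])
            (use configD(2)[OF c] in \<open>auto simp: indicator_def\<close>)
        then show "L43 ?\<rho>2 \<le> N" using N(1)[of i] by linarith
      qed (use pos in simp)
      also have "(LINT x|lebesgue. ?\<rho>2 x) * (LINT x|lebesgue. \<sigma> i x) / \<delta> \<le> 2 * \<epsilon> * M / \<delta>"
        unfolding m2 mass using elim pos M_pos by (intro divide_right_mono mult_right_mono) auto
      finally have e2: "mutual_energy ?\<rho>2 (\<sigma> i) \<le> sqrt \<delta> * C + 2 * \<epsilon> * M / \<delta>" by simp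
      have "R2 - R1 = d" by (simp add: R2_def)
      then show ?case using es(4) e1 e2 e3 by (simp add: distrib_left mult.commute)
    qed
    then show ?thesis by (intro LIMSEQ_le_const[OF en]) (auto simp: eventually_sequentially)
  qed
  define h where "h n = 1 / real (Suc n)" for n
  have h0: "h \<longlonglongrightarrow> 0" and hpos: "0 < h n" for n
    using LIMSEQ_inverse_real_of_nat by (auto simp: h_def[abs_def] inverse_eq_divide)
  \<comment> \<open>The choices are \<epsilon> = h^2, \<delta> = h and d = 1/h: \<epsilon> has to
    vanish faster than \<delta>, because the shell term is of order \<epsilon>/\<delta>.\<close>
  let ?X = "\<lambda>n. inf_value * (((m + (h n)\<^sup>2) / M) powr (5/3) + ((M - m + (h n)\<^sup>2) / M) powr (5/3)) - M\<^sup>2 * h n - (sqrt (h n) * C + 2 * h n * M)"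
  have "?X \<longlonglongrightarrow> inf_value * (((m + 0\<^sup>2) / M) powr (5/3) + ((M - m + 0\<^sup>2) / M) powr (5/3)) - M\<^sup>2 * 0 - (sqrt 0 * C + 2 * 0 * M)"
    using m0 mM M_pos by (intro tendsto_intros h0) auto
  moreover have "eventually (\<lambda>n. ?X n \<le> inf_value) sequentially"
  proof -
    have "(\<lambda>n. (h n)\<^sup>2) \<longlonglongrightarrow> 0\<^sup>2" by (intro tendsto_intros h0)
    then have "eventually (\<lambda>n. (h n)\<^sup>2 < min m (M - m)) sequentially"
      by (rule order_tendstoD(2)) (use m0 mM in auto)
    then show ?thesis
    proof eventually_elim
      case (elim n)
      have "inf_value * (((m + (h n)\<^sup>2) / M) powr (5/3) + ((M - m + (h n)\<^sup>2) / M) powr (5/3)) - M\<^sup>2 / (1 / h n)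
          - (sqrt (h n) * C + 2 * (h n)\<^sup>2 * M / h n) \<le> inf_value"
        using hpos[of n] elim by (intro step) auto
      moreover have "2 * (h n)\<^sup>2 * M / h n = 2 * h n * M" using hpos[of n] by (simp add: power2_eq_square)
      ultimately show ?case by simp
    qed
  qed
  ultimately have "inf_value * ((m / M) powr (5/3) + ((M - m) / M) powr (5/3)) \<le> inf_value"
    by (intro LIMSEQ_le_const2[of ?X]) (auto simp: eventually_sequentially)
  moreover have "(m / M) powr (5/3) + ((M - m) / M) powr (5/3) < m / M + (M - m) / M"
    using m0 mM M_pos by (intro add_strict_mono powr_five_thirds_strict) auto
  moreover have "m / M + (M - m) / M = 1" using M_pos by (simp add: field_simps)
  ultimately have "inf_value * 1 < inf_value * ((m / M) powr (5/3) + ((M - m) / M) powr (5/3)) \<and> inf_value * ((m / M) powr (5/3) + ((M - m) / M) powr (5/3)) \<le> inf_value"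
    using inf_value(2) by (intro conjI mult_strict_left_mono_neg) auto
  then show False by linarith
qed

end

section \<open>Convergence of energies along tight weak limits\<close>

text \<open>With its singularity removed the kernel is bounded by 1/\<delta> and can serve as a
  bounded test function. The sharp cut is harmless, since tests need only be measurable.\<close>

definition far_potential :: "real \<Rightarrow> (real^3 \<Rightarrow> real) \<Rightarrow> real^3 \<Rightarrow> real" where
  "far_potential \<delta> g x = (LINT y|lebesgue. g y * (indicator (- ball 0 \<delta>) (x - y) / norm (x - y)))"

lemma far_kernel_bound:
  fixes w :: "real^3"
  assumes "0 < \<delta>"
  shows "0 \<le> indicator (- ball 0 \<delta>) w / norm w" "indicator (- ball 0 \<delta>) w / norm w \<le> 1 / \<delta>"
  using assms by (auto simp: indicator_def intro!: frac_le)

lemma indicator_compl_ball_diff_measurable [measurable]: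
  "(\<lambda>z::(real^3) \<times> (real^3). indicator (- ball 0 r) (fst z - snd z) :: real) \<in> borel_measurable (lebesgue \<Otimes>\<^sub>M lebesgue)"
  by (rule measurable_compose[where g = "indicator (- ball 0 r)" and N = borel]) (auto intro!: borel_measurable_indicator)

lemma far_kernel_measurable [measurable]:
  "(\<lambda>y. indicator (- ball 0 r) (x - y) / norm (x - y :: real^3)) \<in> borel_measurable lebesgue"
proof -
  have "(\<lambda>y. indicator (- ball 0 r) (x - y) :: real) \<in> borel_measurable lebesgue"
    by (rule measurable_compose[where g = "indicator (- ball 0 r)" and N = borel]) (auto intro!: borel_measurable_indicator)
  then show ?thesis by measurable
qed

lemma far_potential_measurable:
  assumes [measurable]: "g \<in> borel_measurable lebesgue"
  shows "far_potential \<delta> g \<in> borel_measurable lebesgue"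
  unfolding far_potential_def[abs_def] by measurable

lemma far_potential_bound:
  assumes i: "integrable lebesgue g" and nn: "\<And>x. 0 \<le> g x" and "0 < \<delta>" and C: "(LINT x|lebesgue. g x) \<le> C"
  shows "\<bar>far_potential \<delta> g x\<bar> \<le> C / \<delta>"
proof -
  note [measurable] = borel_measurable_integrable[OF i]
  note k = far_kernel_bound[OF \<open>0 < \<delta>\<close>]
  have le: "g y * (indicator (- ball 0 \<delta>) (x - y) / norm (x - y)) \<le> g y * (1 / \<delta>)" for y
    by (rule mult_left_mono[OF k(2) nn])
  have ir: "integrable lebesgue (\<lambda>y. g y * (1 / \<delta>))" using i by (rule integrable_mult_left)
  have il: "integrable lebesgue (\<lambda>y. g y * (indicator (- ball 0 \<delta>) (x - y) / norm (x - y)))"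
  proof (rule integrable_AE_bound[OF ir])
    show "AE y in lebesgue. norm (g y * (indicator (- ball 0 \<delta>) (x - y) / norm (x - y))) \<le> g y * (1 / \<delta>)"
      using le nn k(1) by (intro AE_I2) (simp only: real_norm_def abs_mult abs_of_nonneg)
  qed measurable
  have "far_potential \<delta> g x \<le> (LINT y|lebesgue. g y * (1 / \<delta>))"
    unfolding far_potential_def by (rule integral_mono[OF il ir le])
  also have "\<dots> = (LINT y|lebesgue. g y) / \<delta>" by simp
  also have "\<dots> \<le> C / \<delta>" using C \<open>0 < \<delta>\<close> by (intro divide_right_mono) auto
  finally have "far_potential \<delta> g x \<le> C / \<delta>" .
  moreover have "0 \<le> far_potential \<delta> g x"
    unfolding far_potential_def using nn k(1) by (intro integral_nonneg_AE AE_I2 mult_nonneg_nonneg)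
  ultimately show ?thesis by simp
qed

lemma mutual_energy_far:
  assumes f: "star_density f" and g: "star_density g" and "0 < \<delta>"
  shows "0 \<le> mutual_energy f g - (LINT x|lebesgue. f x * far_potential \<delta> g x)"
    "mutual_energy f g - (LINT x|lebesgue. f x * far_potential \<delta> g x) \<le> near_bound \<delta> f g"
proof -
  note [measurable] = star_densityD(1)[OF f] star_densityD(1)[OF g]
  note nn = star_densityD(2)[OF f] star_densityD(2)[OF g]
  let ?q = "\<lambda>z. f (fst z) * g (snd z) * (indicator (ball 0 \<delta>) (fst z - snd z) / norm (fst z - snd z))"
  let ?r = "\<lambda>z. f (fst z) * (g (snd z) * (indicator (- ball 0 \<delta>) (fst z - snd z) / norm (fst z - snd z)))"
  note me = integrable_mutual_energy[OF f g]
  have eq: "f (fst z) * g (snd z) / norm (fst z - snd z) = ?q z + ?r z" for z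
    by (simp add: indicator_def)
  have q: "integrable lebesgue2 ?q" by (rule near_part(1)[OF assms])
  have r: "integrable lebesgue2 ?r"
  proof (rule integrable_AE_bound[OF me])
    have "norm (?r z) \<le> f (fst z) * g (snd z) / norm (fst z - snd z)" for z
      using nn by (simp add: abs_mult indicator_def)
    then show "AE z in lebesgue2. norm (?r z) \<le> f (fst z) * g (snd z) / norm (fst z - snd z)" by simp
  qed measurable
  have "mutual_energy f g = integral\<^sup>L lebesgue2 ?q + integral\<^sup>L lebesgue2 ?r"
    unfolding mutual_energy_def eq using q r by (rule Bochner_Integration.integral_add)
  moreover have "integral\<^sup>L lebesgue2 ?r = (LINT x|lebesgue. f x * far_potential \<delta> g x)"
    unfolding lebesgue2.integral_fst'[OF r, symmetric] far_potential_def fst_conv snd_conv integral_mult_right_zero ..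
  moreover have "0 \<le> integral\<^sup>L lebesgue2 ?q" using nn by (intro integral_nonneg_AE) auto
  ultimately show "0 \<le> mutual_energy f g - (LINT x|lebesgue. f x * far_potential \<delta> g x)"
    "mutual_energy f g - (LINT x|lebesgue. f x * far_potential \<delta> g x) \<le> near_bound \<delta> f g"
    using near_part(2)[OF assms] by linarith+
qed

text \<open>One constant \<open>C\<close> serves for all bounds, so that the near estimates are the
  same for the sequence, its limit and pairs of sequences.\<close>

locale tight_weak_limit =
  fixes \<gamma> C :: real and f :: "nat \<Rightarrow> real^3 \<Rightarrow> real" and F :: "real^3 \<Rightarrow> real"
  assumes \<gamma>1: "1 < \<gamma>"
    and f_star: "\<And>n. star_density (f n)" and f_mass: "\<And>n. (LINT x|lebesgue. f n x) \<le> C"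
    and f_powr: "\<And>n. integrable lebesgue (\<lambda>x. f n x powr \<gamma>)" "\<And>n. (LINT x|lebesgue. f n x powr \<gamma>) \<le> C"
    and f_L43: "\<And>n. L43 (f n) \<le> C"
    and F_star: "star_density F" and F_mass: "(LINT x|lebesgue. F x) \<le> C" and F_L43: "L43 F \<le> C"
    and tight: "\<And>\<epsilon>. 0 < \<epsilon> \<Longrightarrow> \<exists>R. \<forall>n. (LINT x|lebesgue. f n x * indicator (- ball 0 R) x) \<le> \<epsilon>"
    and weak: "\<And>h. h \<in> borel_measurable lebesgue \<Longrightarrow> integrable lebesgue (\<lambda>x. \<bar>h x\<bar> powr (\<gamma> / (\<gamma> - 1))) \<Longrightarrow>
      (\<lambda>n. LINT x|lebesgue. f n x * h x) \<longlonglongrightarrow> (LINT x|lebesgue. F x * h x)"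
begin

lemma C_nonneg: "0 \<le> C" using order_trans[OF L43_nonneg F_L43] .

lemma integrable_mult_bounded:
  fixes g h :: "real^3 \<Rightarrow> real"
  assumes "integrable lebesgue g" "h \<in> borel_measurable lebesgue" "\<And>x. \<bar>h x\<bar> \<le> B"
  shows "integrable lebesgue (\<lambda>x. g x * h x)"
proof (rule integrable_AE_bound)
  note [measurable] = borel_measurable_integrable[OF assms(1)] assms(2)
  show "integrable lebesgue (\<lambda>x. \<bar>g x\<bar> * B)" using assms(1) by auto
  show "AE x in lebesgue. norm (g x * h x) \<le> \<bar>g x\<bar> * B"
    using assms(3) by (intro AE_I2) (simp add: abs_mult mult_left_mono)
qed (use assms(2) borel_measurable_integrable[OF assms(1)] in measurable)

lemma tail_estimate:
  fixes g h :: "real^3 \<Rightarrow> real"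
  assumes g: "integrable lebesgue g" "\<And>x. 0 \<le> g x" and h: "h \<in> borel_measurable lebesgue" "\<And>x. \<bar>h x\<bar> \<le> B"
  shows "\<bar>(LINT x|lebesgue. g x * h x) - (LINT x|lebesgue. g x * (h x * indicator (ball 0 R) x))\<bar>
    \<le> B * (LINT x|lebesgue. g x * indicator (- ball 0 R) x)"
proof -
  note [measurable] = borel_measurable_integrable[OF g(1)] h(1)
  have h': "(\<lambda>x. h x * indicator (ball 0 R) x) \<in> borel_measurable lebesgue" "\<bar>h x * indicator (ball 0 R) x\<bar> \<le> B" for x
    using h(2)[of x] by (measurable, auto simp: indicator_def)
  have c: "(\<lambda>x::real^3. indicator (- ball 0 R) x :: real) \<in> borel_measurable lebesgue" by auto
  have "(LINT x|lebesgue. g x * h x) - (LINT x|lebesgue. g x * (h x * indicator (ball 0 R) x)) =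
      (LINT x|lebesgue. g x * h x - g x * (h x * indicator (ball 0 R) x))"
    by (rule Bochner_Integration.integral_diff[symmetric])
      (rule integrable_mult_bounded[OF g(1) h], rule integrable_mult_bounded[OF g(1) h'])
  also have "\<bar>\<dots>\<bar> \<le> (LINT x|lebesgue. \<bar>g x * h x - g x * (h x * indicator (ball 0 R) x)\<bar>)"
    using integral_norm_bound[of lebesgue "\<lambda>x. g x * h x - g x * (h x * indicator (ball 0 R) x)"] by simp
  also have "\<dots> \<le> (LINT x|lebesgue. B * (g x * indicator (- ball 0 R) x))"
  proof (rule integral_mono)
    show "integrable lebesgue (\<lambda>x. \<bar>g x * h x - g x * (h x * indicator (ball 0 R) x)\<bar>)"
      by (intro integrable_abs Bochner_Integration.integrable_diff)
        (rule integrable_mult_bounded[OF g(1) h], rule integrable_mult_bounded[OF g(1) h'])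
    show "integrable lebesgue (\<lambda>x. B * (g x * indicator (- ball 0 R) x))"
      by (intro integrable_mult_right integrable_mult_bounded[OF g(1) c, where B = 1]) (auto simp: indicator_def)
    show "\<bar>g x * h x - g x * (h x * indicator (ball 0 R) x)\<bar> \<le> B * (g x * indicator (- ball 0 R) x)" for x
      using mult_right_mono[OF h(2) g(2), of x x] g(2)[of x] by (auto simp: indicator_def abs_mult mult.commute)
  qed
  finally show ?thesis by simp
qed

text \<open>Tightness gives a radius for the sequence, integrability one for the limit; tails
  decrease with the radius, so the larger one serves both.\<close>

lemma common_tail:
  assumes "0 < \<epsilon>"
  obtains R where "\<And>n. (LINT x|lebesgue. f n x * indicator (- ball 0 R) x) \<le> \<epsilon>"
    "(LINT x|lebesgue. F x * indicator (- ball 0 R) x) \<le> \<epsilon>"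
proof -
  obtain R1 where R1: "\<And>n. (LINT x|lebesgue. f n x * indicator (- ball 0 R1) x) \<le> \<epsilon>" using tight[OF assms] by blast
  have tail_mono: "(LINT x|lebesgue. g x * indicator (- ball 0 R') x) \<le> (LINT x|lebesgue. g x * indicator (- ball 0 R) x)"
    if g: "star_density g" and "R \<le> R'" for g and R R' :: real
  proof -
    have c: "(\<lambda>x::real^3. indicator (- ball 0 R) x :: real) \<in> borel_measurable lebesgue" for R by auto
    have ti: "integrable lebesgue (\<lambda>x. g x * indicator (- ball 0 R) x)" for R
      by (rule integrable_mult_bounded[OF star_densityD(3)[OF g] c, where B = 1]) (auto simp: indicator_def)
    show ?thesis
      by (rule integral_mono[OF ti ti]) (use that star_densityD(2)[OF g] in \<open>auto simp: indicator_def\<close>)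
  qed
  have "eventually (\<lambda>n. (LINT x|lebesgue. F x) - \<epsilon> < (LINT x|lebesgue. F x * indicator (ball 0 (real n)) x)) sequentially"
    by (rule order_tendstoD(1)[OF integral_ball_tendsto[OF star_densityD(3)[OF F_star]]]) (use assms in simp)
  then obtain k where k: "(LINT x|lebesgue. F x) - \<epsilon> < (LINT x|lebesgue. F x * indicator (ball 0 (real k)) x)"
    by (auto simp: eventually_sequentially)
  have "(LINT x|lebesgue. F x * indicator (- ball 0 (real k)) x) = (LINT x|lebesgue. F x - F x * indicator (ball 0 (real k)) x)"
    by (rule Bochner_Integration.integral_cong) (auto simp: indicator_def)
  also have "\<dots> = (LINT x|lebesgue. F x) - (LINT x|lebesgue. F x * indicator (ball 0 (real k)) x)"
    by (rule Bochner_Integration.integral_diff) (rule star_densityD(3)[OF F_star], rule integrable_mult_ball[OF star_densityD(3)[OF F_star]])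
  finally have "(LINT x|lebesgue. F x * indicator (- ball 0 (real k)) x) \<le> \<epsilon>" using k by linarith
  then have "(LINT x|lebesgue. F x * indicator (- ball 0 (max R1 (real k))) x) \<le> \<epsilon>"
    using tail_mono[OF F_star, of "real k" "max R1 (real k)"] by simp
  moreover have "(LINT x|lebesgue. f n x * indicator (- ball 0 (max R1 (real k))) x) \<le> \<epsilon>" for n
    using tail_mono[OF f_star, of R1 "max R1 (real k)" n] R1[of n] by simp
  ultimately show ?thesis using that by blast
qed

text \<open>Truncated kernels and indicators of infinite cylinders need not lie in the dual space of
  L^\<gamma>. Cutting them at a radius beyond which all tails are small brings them there.\<close>

lemma weak_bounded:
  assumes h: "h \<in> borel_measurable lebesgue" "\<And>x. \<bar>h x\<bar> \<le> B"
  shows "(\<lambda>n. LINT x|lebesgue. f n x * h x) \<longlonglongrightarrow> (LINT x|lebesgue. F x * h x)"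
proof (rule LIMSEQ_I)
  fix \<epsilon> :: real assume "0 < \<epsilon>"
  note [measurable] = h(1)
  have B0: "0 \<le> B" using h(2)[of 0] by linarith
  have "0 < \<epsilon> / (4 * (B + 1))" using \<open>0 < \<epsilon>\<close> B0 by simp
  then obtain R where R: "\<And>n. (LINT x|lebesgue. f n x * indicator (- ball 0 R) x) \<le> \<epsilon> / (4 * (B + 1))"
    "(LINT x|lebesgue. F x * indicator (- ball 0 R) x) \<le> \<epsilon> / (4 * (B + 1))" using common_tail by blast
  have small: "B * t \<le> \<epsilon> / 4" if "t \<le> \<epsilon> / (4 * (B + 1))" for t
  proof -
    have "B * t \<le> B * (\<epsilon> / (4 * (B + 1)))" using that B0 by (rule mult_left_mono)
    also have "\<dots> \<le> \<epsilon> / 4" using B0 \<open>0 < \<epsilon>\<close> by (simp add: field_simps)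
    finally show ?thesis .
  qed
  let ?h = "\<lambda>x. h x * indicator (ball 0 R) x"
  have "(\<lambda>n. LINT x|lebesgue. f n x * ?h x) \<longlonglongrightarrow> (LINT x|lebesgue. F x * ?h x)"
  proof (rule weak)
    show "integrable lebesgue (\<lambda>x. \<bar>?h x\<bar> powr (\<gamma> / (\<gamma> - 1)))"
    proof (rule integrable_AE_bound)
      show "integrable lebesgue (\<lambda>x::real^3. B powr (\<gamma> / (\<gamma> - 1)) * indicator (ball 0 R) x)"
        by (intro integrable_mult_right) (simp add: lmeasurable_iff_integrable[symmetric])
      show "AE x in lebesgue. norm (\<bar>?h x\<bar> powr (\<gamma> / (\<gamma> - 1))) \<le> B powr (\<gamma> / (\<gamma> - 1)) * indicator (ball 0 R) x"
        using h(2) \<gamma>1 by (intro AE_I2) (auto simp: indicator_def intro!: powr_mono2)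
    qed measurable
  qed measurable
  then have "eventually (\<lambda>n. dist (LINT x|lebesgue. f n x * ?h x) (LINT x|lebesgue. F x * ?h x) < \<epsilon> / 4) sequentially"
    by (rule tendstoD) (use \<open>0 < \<epsilon>\<close> in simp)
  then obtain n0 where n0: "\<And>n. n0 \<le> n \<Longrightarrow> \<bar>(LINT x|lebesgue. f n x * ?h x) - (LINT x|lebesgue. F x * ?h x)\<bar> < \<epsilon> / 4"
    by (auto simp: eventually_sequentially dist_real_def)
  have "norm ((LINT x|lebesgue. f n x * h x) - (LINT x|lebesgue. F x * h x)) < \<epsilon>" if "n0 \<le> n" for n
    using tail_estimate[OF star_densityD(3,2)[OF f_star] h, of n R] tail_estimate[OF star_densityD(3,2)[OF F_star] h, of R]
      small[OF R(1)[of n]] small[OF R(2)] n0[OF that] \<open>0 < \<epsilon>\<close> unfolding real_norm_def by linarith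
  then show "\<exists>n0. \<forall>n\<ge>n0. norm ((LINT x|lebesgue. f n x * h x) - (LINT x|lebesgue. F x * h x)) < \<epsilon>" by blast
qed

text \<open>A weakly convergent factor against a pointwise convergent one. On a ball the densities
  are split at height \<open>l\<close>: the low part is handled by dominated convergence of the
  tests, the high part by the \<gamma> bound. Outside the ball tightness takes over.\<close>

lemma weak_bounded_varying:
  assumes h: "\<And>n. h n \<in> borel_measurable lebesgue" "\<And>n x. \<bar>h n x\<bar> \<le> B"
    and H: "H \<in> borel_measurable lebesgue" "\<And>x. \<bar>H x\<bar> \<le> B" and lim: "\<And>x. (\<lambda>n. h n x) \<longlonglongrightarrow> H x"
  shows "(\<lambda>n. LINT x|lebesgue. f n x * h n x) \<longlonglongrightarrow> (LINT x|lebesgue. F x * H x)"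
proof -
  note [measurable] = h(1) H(1) star_densityD(1)[OF f_star]
  note fn = star_densityD(2)[OF f_star]
  have B0: "0 \<le> B" using H(2)[of 0] by linarith
  have dB: "\<bar>h n x - H x\<bar> \<le> 2 * B" for n x using h(2)[of n x] H(2)[of x] by linarith
  have "(\<lambda>n. LINT x|lebesgue. f n x * (h n x - H x)) \<longlonglongrightarrow> 0"
  proof (rule LIMSEQ_I)
    fix \<epsilon> :: real assume "0 < \<epsilon>"
    have "0 < \<epsilon> / (8 * (B + 1))" using \<open>0 < \<epsilon>\<close> B0 by simp
    then obtain R where R: "\<And>n. (LINT x|lebesgue. f n x * indicator (- ball 0 R) x) \<le> \<epsilon> / (8 * (B + 1))" using common_tail by blast
    obtain l where l: "0 < l" "l powr (1 - \<gamma>) * (2 * B * C) < \<epsilon> / 4"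
      using threshold_small[OF \<gamma>1, of "2 * B * C" "\<epsilon> / 4"] B0 C_nonneg \<open>0 < \<epsilon>\<close> by auto
    let ?d = "\<lambda>n x. indicator (ball 0 R) x * \<bar>h n x - H x\<bar>"
    have ib: "integrable lebesgue (\<lambda>x::real^3. indicator (ball 0 R) x * (2 * B))"
      by (intro integrable_mult_left) (simp add: lmeasurable_iff_integrable[symmetric])
    have "(\<lambda>n. LINT x|lebesgue. ?d n x) \<longlonglongrightarrow> (LINT x|(lebesgue :: (real^3) measure). 0 :: real)"
    proof (rule integral_dominated_convergence[OF _ _ ib])
      show "AE x in lebesgue. (\<lambda>n. ?d n x) \<longlonglongrightarrow> 0"
      proof (rule AE_I2)
        fix x
        have "(\<lambda>n. ?d n x) \<longlonglongrightarrow> indicator (ball 0 R) x * \<bar>H x - H x\<bar>" by (intro tendsto_intros lim)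
        then show "(\<lambda>n. ?d n x) \<longlonglongrightarrow> 0" by simp
      qed
      show "AE x in lebesgue. norm (?d n x) \<le> indicator (ball 0 R) x * (2 * B)" for n
        using dB[of n] by (intro AE_I2) (auto simp: indicator_def)
    qed measurable
    then have "(\<lambda>n. l * (LINT x|lebesgue. ?d n x)) \<longlonglongrightarrow> l * 0" by (intro tendsto_intros) simp
    then have "eventually (\<lambda>n. l * (LINT x|lebesgue. ?d n x) < \<epsilon> / 4) sequentially"
      by (rule order_tendstoD(2)) (use \<open>0 < \<epsilon>\<close> in simp)
    then obtain n0 where n0: "\<And>n. n0 \<le> n \<Longrightarrow> l * (LINT x|lebesgue. ?d n x) < \<epsilon> / 4"
      by (auto simp: eventually_sequentially)
    have "norm ((LINT x|lebesgue. f n x * (h n x - H x)) - 0) < \<epsilon>" if "n0 \<le> n" for n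
    proof -
      let ?b = "\<lambda>x. l * ?d n x + l powr (1 - \<gamma>) * (2 * B) * f n x powr \<gamma> + 2 * B * (f n x * indicator (- ball 0 R) x)"
      have id: "integrable lebesgue (?d n)"
        by (rule integrable_AE_bound[OF ib]) (use dB[of n] in \<open>auto simp: indicator_def\<close>)
      have c: "(\<lambda>x::real^3. indicator (- ball 0 R) x :: real) \<in> borel_measurable lebesgue" by auto
      have it: "integrable lebesgue (\<lambda>x. f n x * indicator (- ball 0 R) x)"
        by (rule integrable_mult_bounded[OF star_densityD(3)[OF f_star] c, where B = 1]) (auto simp: indicator_def)
      have im: "integrable lebesgue (\<lambda>x. f n x * (h n x - H x))"
        by (rule integrable_mult_bounded[OF star_densityD(3)[OF f_star] _ dB]) measurable
      have ib': "integrable lebesgue ?b" using id it f_powr(1) by (intro Bochner_Integration.integrable_add integrable_mult_right)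
      have le: "\<bar>f n x * (h n x - H x)\<bar> \<le> ?b x" for x
      proof (cases "x \<in> ball 0 R")
        case True
        have "f n x \<le> l + l powr (1 - \<gamma>) * f n x powr \<gamma>"
          using le_threshold_powr[OF fn l(1) \<gamma>1, of n x] by linarith
        then have "f n x * \<bar>h n x - H x\<bar> \<le> (l + l powr (1 - \<gamma>) * f n x powr \<gamma>) * \<bar>h n x - H x\<bar>"
          by (rule mult_right_mono) simp
        also have "\<dots> = l * \<bar>h n x - H x\<bar> + l powr (1 - \<gamma>) * f n x powr \<gamma> * \<bar>h n x - H x\<bar>" by (simp add: distrib_right)
        also have "\<dots> \<le> l * \<bar>h n x - H x\<bar> + l powr (1 - \<gamma>) * f n x powr \<gamma> * (2 * B)"
          using dB by (intro add_left_mono mult_left_mono) auto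
        finally show ?thesis using True fn[of n x] by (simp add: abs_mult mult_ac)
      next
        case False
        have "f n x * \<bar>h n x - H x\<bar> \<le> f n x * (2 * B)" using dB fn by (intro mult_left_mono) auto
        moreover have "0 \<le> l powr (1 - \<gamma>) * (2 * B) * f n x powr \<gamma>" using B0 by auto
        ultimately show ?thesis using False fn[of n x] by (simp add: abs_mult mult_ac)
      qed
      have "\<bar>LINT x|lebesgue. f n x * (h n x - H x)\<bar> \<le> (LINT x|lebesgue. \<bar>f n x * (h n x - H x)\<bar>)"
        using integral_norm_bound[of lebesgue "\<lambda>x. f n x * (h n x - H x)"] by simp
      also have "\<dots> \<le> (LINT x|lebesgue. ?b x)" by (rule integral_mono[OF integrable_abs[OF im] ib' le])
      also have "\<dots> = l * (LINT x|lebesgue. ?d n x) + l powr (1 - \<gamma>) * (2 * B) * (LINT x|lebesgue. f n x powr \<gamma>)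
          + 2 * B * (LINT x|lebesgue. f n x * indicator (- ball 0 R) x)"
        using id it f_powr(1)[of n] by (simp only: Bochner_Integration.integral_add Bochner_Integration.integrable_add integrable_mult_right integral_mult_right_zero)
      also have "l powr (1 - \<gamma>) * (2 * B) * (LINT x|lebesgue. f n x powr \<gamma>) \<le> l powr (1 - \<gamma>) * (2 * B) * C"
        using B0 f_powr(2) by (intro mult_left_mono) auto
      also have "2 * B * (LINT x|lebesgue. f n x * indicator (- ball 0 R) x) \<le> 2 * B * (\<epsilon> / (8 * (B + 1)))"
        using B0 R by (intro mult_left_mono) auto
      also have "2 * B * (\<epsilon> / (8 * (B + 1))) \<le> \<epsilon> / 4" using B0 \<open>0 < \<epsilon>\<close> by (simp add: field_simps)
      finally show ?thesis using n0[OF that] l(2) \<open>0 < \<epsilon>\<close> by (simp add: mult.assoc)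
    qed
    then show "\<exists>n0. \<forall>n\<ge>n0. norm ((LINT x|lebesgue. f n x * (h n x - H x)) - 0) < \<epsilon>" by blast
  qed
  from tendsto_add[OF this weak_bounded[OF H]]
  have "(\<lambda>n. (LINT x|lebesgue. f n x * (h n x - H x)) + (LINT x|lebesgue. f n x * H x)) \<longlonglongrightarrow> (LINT x|lebesgue. F x * H x)" by simp
  moreover have "(LINT x|lebesgue. f n x * (h n x - H x)) + (LINT x|lebesgue. f n x * H x) = (LINT x|lebesgue. f n x * h n x)" for n
  proof -
    have 1: "integrable lebesgue (\<lambda>x. f n x * (h n x - H x))"
      by (rule integrable_mult_bounded[OF star_densityD(3)[OF f_star] _ dB]) measurable
    have 2: "integrable lebesgue (\<lambda>x. f n x * H x)"
      by (rule integrable_mult_bounded[OF star_densityD(3)[OF f_star] H])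
    show ?thesis unfolding Bochner_Integration.integral_add[OF 1 2, symmetric]
      by (rule Bochner_Integration.integral_cong) (auto simp: algebra_simps)
  qed
  ultimately show ?thesis by simp
qed

end

text \<open>Removing pairs closer than \<delta> costs at most \<epsilon>/4 for the sequence and for
  the limit. The truncated potentials of \<open>g n\<close> converge pointwise, being pairings with
  bounded kernels, and are then paired with the weakly convergent \<open>f n\<close>. Two sequences
  are allowed because the fields need cross terms with the limit.\<close>

lemma mutual_energy_tendsto:
  assumes f: "tight_weak_limit \<gamma> C f F" and g: "tight_weak_limit \<gamma> C g G"
  shows "(\<lambda>n. mutual_energy (f n) (g n)) \<longlonglongrightarrow> mutual_energy F G"
proof (rule LIMSEQ_I)
  fix \<epsilon> :: real assume "0 < \<epsilon>"
  interpret f: tight_weak_limit \<gamma> C f F by (rule f)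
  interpret g: tight_weak_limit \<gamma> C g G by (rule g)
  define D where "D = (1 + near_const) * (C * C + C + C) + 1"
  have D: "0 < D" using f.C_nonneg near_const_nonneg by (auto simp: D_def intro!: add_nonneg_pos mult_nonneg_nonneg)
  define \<delta> where "\<delta> = (\<epsilon> / (4 * D))\<^sup>2"
  have \<delta>: "0 < \<delta>" "sqrt \<delta> * D = \<epsilon> / 4" using D \<open>0 < \<epsilon>\<close> by (auto simp: \<delta>_def)
  have nb: "near_bound \<delta> u v \<le> \<epsilon> / 4" if "L43 u \<le> C" "L43 v \<le> C" for u v
  proof -
    have "near_bound \<delta> u v \<le> sqrt \<delta> * ((1 + near_const) * (C * C + C + C))"
      using that \<delta> by (intro near_bound_le) auto
    also have "\<dots> \<le> sqrt \<delta> * D" unfolding D_def using \<delta> by (intro mult_left_mono) auto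
    finally show ?thesis using \<delta> by simp
  qed
  have "(\<lambda>n. LINT x|lebesgue. f n x * far_potential \<delta> (g n) x) \<longlonglongrightarrow> (LINT x|lebesgue. F x * far_potential \<delta> G x)"
  proof (rule f.weak_bounded_varying)
    show "far_potential \<delta> (g n) \<in> borel_measurable lebesgue" for n
      by (rule far_potential_measurable[OF star_densityD(1)[OF g.f_star]])
    show "far_potential \<delta> G \<in> borel_measurable lebesgue" by (rule far_potential_measurable[OF star_densityD(1)[OF g.F_star]])
    show "\<bar>far_potential \<delta> (g n) x\<bar> \<le> C / \<delta>" for n x
      by (rule far_potential_bound[OF star_densityD(3,2)[OF g.f_star] \<delta>(1) g.f_mass])
    show "\<bar>far_potential \<delta> G x\<bar> \<le> C / \<delta>" for x
      by (rule far_potential_bound[OF star_densityD(3,2)[OF g.F_star] \<delta>(1) g.F_mass])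
    show "(\<lambda>n. far_potential \<delta> (g n) x) \<longlonglongrightarrow> far_potential \<delta> G x" for x
      unfolding far_potential_def
      by (rule g.weak_bounded[where B = "1 / \<delta>"]) (use far_kernel_bound[OF \<delta>(1)] in \<open>auto simp del: divide_eq_0_iff\<close>)
  qed
  then have "eventually (\<lambda>n. dist (LINT x|lebesgue. f n x * far_potential \<delta> (g n) x) (LINT x|lebesgue. F x * far_potential \<delta> G x) < \<epsilon> / 4) sequentially"
    by (rule tendstoD) (use \<open>0 < \<epsilon>\<close> in simp)
  then obtain n0 where n0: "\<And>n. n0 \<le> n \<Longrightarrow> \<bar>(LINT x|lebesgue. f n x * far_potential \<delta> (g n) x) - (LINT x|lebesgue. F x * far_potential \<delta> G x)\<bar> < \<epsilon> / 4"
    by (auto simp: eventually_sequentially dist_real_def)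
  have "norm (mutual_energy (f n) (g n) - mutual_energy F G) < \<epsilon>" if "n0 \<le> n" for n
    using mutual_energy_far[OF f.f_star g.f_star \<delta>(1), of n n] mutual_energy_far[OF f.F_star g.F_star \<delta>(1)]
      nb[OF f.f_L43 g.f_L43, of n n] nb[OF f.F_L43 g.F_L43] n0[OF that] \<open>0 < \<epsilon>\<close> unfolding real_norm_def by linarith
  then show "\<exists>n0. \<forall>n\<ge>n0. norm (mutual_energy (f n) (g n) - mutual_energy F G) < \<epsilon>" by blast
qed

section \<open>Passage to the limit\<close>

lemma mid_hull_axisymmetric:
  assumes "\<And>i. axisymmetric (f i)" "mid_hull f n g"
  shows "axisymmetric g"
  using assms(2)
proof (induction rule: mid_hull.induct)
  case (mid g h)
  then show ?case unfolding axisymmetric_iff by metis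
qed (rule assms(1))

context rotating_star
begin

text \<open>Hull elements of a late tail use only densities whose internal energy is below \<alpha>
  + \<epsilon>. Convexity and Fatou keep this bound, and \<epsilon> is arbitrary.\<close>

lemma internal_energy_lower_semicontinuous:
  assumes c: "\<And>i. config (\<sigma> i)" and \<alpha>: "(\<lambda>i. LINT x|lebesgue. A (\<sigma> i x)) \<longlonglongrightarrow> \<alpha>"
    and g: "\<And>n. mid_hull \<sigma> n (g n)" and lim: "AE x in lebesgue. (\<lambda>n. g n x) \<longlonglongrightarrow> F x"
    and F: "F \<in> borel_measurable lebesgue"
  shows "integrable lebesgue (\<lambda>x. A (F x))" "(LINT x|lebesgue. A (F x)) \<le> \<alpha>"
proof -
  have bound: "integrable lebesgue (\<lambda>x. A (F x)) \<and> (LINT x|lebesgue. A (F x)) \<le> \<alpha> + \<epsilon>" if "0 < \<epsilon>" for \<epsilon>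
  proof -
    have "eventually (\<lambda>i. (LINT x|lebesgue. A (\<sigma> i x)) < \<alpha> + \<epsilon>) sequentially"
      by (rule order_tendstoD(2)[OF \<alpha>]) (use that in simp)
    then obtain N where N': "\<And>i. N \<le> i \<Longrightarrow> (LINT x|lebesgue. A (\<sigma> i x)) < \<alpha> + \<epsilon>"
      by (auto simp: eventually_sequentially)
    have N: "(LINT x|lebesgue. A (\<sigma> i x)) \<le> \<alpha> + \<epsilon>" if "N \<le> i" for i using N'[OF that] by simp
    have cont: "(\<lambda>n. A (u n)) \<longlonglongrightarrow> A l" if "u \<longlonglongrightarrow> l" for u l
      using isCont_tendsto_compose[OF _ that, of A] A_continuous by (simp add: continuous_on_eq_continuous_at)
    show ?thesis
      using mid_hull_limit_bound[OF A_measurable A_nonneg A_midpoint_le cont configD(3,2,5)[OF c] N g lim F] by blast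
  qed
  show "integrable lebesgue (\<lambda>x. A (F x))" using bound[of 1] by simp
  show "(LINT x|lebesgue. A (F x)) \<le> \<alpha>" by (rule field_le_epsilon) (use bound in blast)
qed

text \<open>The weight 1/r^2 is unbounded near the axis, so it is cut off at radius 1/(k+1) before
  the weak limit and restored by Fatou. Cylinder masses converge because indicators are bounded
  tests, and they enter through the continuous \<open>L_clamp\<close>.\<close>

lemma rotation_lower_semicontinuous:
  assumes tw: "tight_weak_limit \<gamma> C \<sigma> F" and c: "\<And>i. config (\<sigma> i)"
    and \<beta>: "(\<lambda>i. LINT x|lebesgue. rotation_density L (\<sigma> i) x) \<longlonglongrightarrow> \<beta>" and FM: "(LINT x|lebesgue. F x) \<le> M"
  shows "integrable lebesgue (rotation_density L F)" "(LINT x|lebesgue. rotation_density L F x) \<le> \<beta>"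
proof -
  interpret tight_weak_limit \<gamma> C \<sigma> F by (rule tw)
  note iF = star_densityD(3)[OF F_star] and nnF = star_densityD(2)[OF F_star]
  have i\<sigma>: "integrable lebesgue (\<sigma> n)" and nn\<sigma>: "0 \<le> \<sigma> n x" and M\<sigma>: "(LINT x|lebesgue. \<sigma> n x) \<le> M" for n x
    using configD(2,3,4)[OF c] by auto
  have cm: "(\<lambda>n. cyl_mass (\<sigma> n) r) \<longlonglongrightarrow> cyl_mass F r" for r
  proof -
    have "(\<lambda>n. LINT x|lebesgue. \<sigma> n x * indicator {x. cyl_radius x < r} x) \<longlonglongrightarrow> (LINT x|lebesgue. F x * indicator {x. cyl_radius x < r} x)"
      by (rule weak_bounded[where B = 1]) (auto simp: indicator_def)
    then show ?thesis by (simp add: cyl_mass_def set_lebesgue_integral_def mult.commute)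
  qed
  define w where "w k x = (if 1 / real (Suc k) \<le> cyl_radius x then 1 / (cyl_radius x)\<^sup>2 else 0)" for k x
  have mw[measurable]: "w k \<in> borel_measurable lebesgue" for k unfolding w_def[abs_def] by measurable
  have w0: "0 \<le> w k x" for k x by (simp add: w_def)
  have wle: "w k x \<le> 1 / (cyl_radius x)\<^sup>2" for k x by (simp add: w_def)
  have wb: "w k x \<le> (real (Suc k))\<^sup>2" for k x
  proof (cases "1 / real (Suc k) \<le> cyl_radius x")
    case True
    then have "(1 / real (Suc k))\<^sup>2 \<le> (cyl_radius x)\<^sup>2" by (intro power_mono) auto
    then have "1 / (cyl_radius x)\<^sup>2 \<le> 1 / (1 / real (Suc k))\<^sup>2" by (intro frac_le) auto
    then show ?thesis using True by (simp add: w_def power_divide)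
  qed (simp add: w_def)
  let ?h = "\<lambda>k G x. L_clamp (cyl_mass G (cyl_radius x)) * w k x"
  have hb: "\<bar>?h k G x\<bar> \<le> L M * (real (Suc k))\<^sup>2" for k G x
  proof -
    have "\<bar>?h k G x\<bar> = ?h k G x" using L_clamp_bounds(1) w0 by simp
    also have "\<dots> \<le> L M * (real (Suc k))\<^sup>2"
      using L_clamp_bounds order_trans[OF L_clamp_bounds] w0 wb by (intro mult_mono) auto
    finally show ?thesis .
  qed
  have mh: "?h k G \<in> borel_measurable lebesgue" if "integrable lebesgue G" "\<And>x. 0 \<le> G x" for k G
  proof -
    note [measurable] = cyl_mass_measurable[OF that]
    show ?thesis by measurable
  qed
  have lim: "(\<lambda>n. LINT x|lebesgue. \<sigma> n x * ?h k (\<sigma> n) x) \<longlonglongrightarrow> (LINT x|lebesgue. F x * ?h k F x)" for k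
  proof (rule weak_bounded_varying[OF mh[OF i\<sigma> nn\<sigma>] hb mh[OF iF nnF] hb])
    fix x
    have "isCont L_clamp (cyl_mass F (cyl_radius x))" using L_clamp_continuous by (simp add: continuous_on_eq_continuous_at)
    then have "(\<lambda>n. L_clamp (cyl_mass (\<sigma> n) (cyl_radius x))) \<longlonglongrightarrow> L_clamp (cyl_mass F (cyl_radius x))"
      by (rule isCont_tendsto_compose[OF _ cm])
    then show "(\<lambda>n. ?h k (\<sigma> n) x) \<longlonglongrightarrow> ?h k F x" by (intro tendsto_mult tendsto_const)
  qed
  have k\<beta>: "(LINT x|lebesgue. F x * ?h k F x) \<le> \<beta>" for k
  proof (rule LIMSEQ_le[OF lim \<beta>], intro exI allI impI)
    fix n
    show "(LINT x|lebesgue. \<sigma> n x * ?h k (\<sigma> n) x) \<le> (LINT x|lebesgue. rotation_density L (\<sigma> n) x)"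
    proof (rule integral_mono)
      show "integrable lebesgue (\<lambda>x. \<sigma> n x * ?h k (\<sigma> n) x)"
        by (rule integrable_mult_bounded[OF i\<sigma> mh[OF i\<sigma> nn\<sigma>] hb])
      show "integrable lebesgue (rotation_density L (\<sigma> n))" by (rule configD(6)[OF c])
      show "\<sigma> n x * ?h k (\<sigma> n) x \<le> rotation_density L (\<sigma> n) x" for x
      proof -
        have "\<sigma> n x * L_clamp (cyl_mass (\<sigma> n) (cyl_radius x)) * w k x \<le> \<sigma> n x * L_clamp (cyl_mass (\<sigma> n) (cyl_radius x)) * (1 / (cyl_radius x)\<^sup>2)"
          using nn\<sigma> L_clamp_bounds wle by (intro mult_left_mono) auto
        then show ?thesis unfolding rotation_density_eq[OF i\<sigma> nn\<sigma> M\<sigma>] by (simp add: mult.assoc)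
      qed
    qed
  qed
  have conv: "AE x in lebesgue. (\<lambda>k. F x * ?h k F x) \<longlonglongrightarrow> rotation_density L F x"
  proof (rule AE_I2)
    fix x :: "real^3"
    have "(\<lambda>k. w k x) \<longlonglongrightarrow> 1 / (cyl_radius x)\<^sup>2"
    \<comment> \<open>On the axis both the truncated weight and 1/0 are 0.\<close>
    proof (cases "cyl_radius x = 0")
      case True
      then show ?thesis by (simp add: w_def)
    next
      case False
      then have "0 < cyl_radius x" using cyl_radius_nonneg[of x] by simp
      then obtain k0 where k0: "inverse (real (Suc k0)) < cyl_radius x" using reals_Archimedean by blast
      have "w k x = 1 / (cyl_radius x)\<^sup>2" if "k0 \<le> k" for k
      proof -
        have "1 / real (Suc k) \<le> 1 / real (Suc k0)" using that by (intro frac_le) auto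
        then show ?thesis using k0 by (simp add: w_def inverse_eq_divide)
      qed
      then show ?thesis by (intro tendsto_eventually) (auto simp: eventually_sequentially)
    qed
    then have "(\<lambda>k. F x * ?h k F x) \<longlonglongrightarrow> F x * (L_clamp (cyl_mass F (cyl_radius x)) * (1 / (cyl_radius x)\<^sup>2))"
      by (intro tendsto_mult tendsto_const)
    then show "(\<lambda>k. F x * ?h k F x) \<longlonglongrightarrow> rotation_density L F x"
      by (simp add: rotation_density_eq[OF iF nnF FM])
  qed
  have "integrable lebesgue (\<lambda>x. F x * ?h k F x)" for k by (rule integrable_mult_bounded[OF iF mh[OF iF nnF] hb])
  moreover have "AE x in lebesgue. 0 \<le> F x * ?h k F x" for k using nnF L_clamp_bounds(1) w0 by simp
  ultimately show "integrable lebesgue (rotation_density L F)" "(LINT x|lebesgue. rotation_density L F x) \<le> \<beta>"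
    using Fatou_integral_bound[OF _ _ k\<beta> conv rotation_density_measurable[OF iF nnF FM]] by blast+
qed

lemma coercive_bounds:
  "\<exists>C. \<forall>\<sigma>. config \<sigma> \<longrightarrow> (LINT x|lebesgue. \<sigma> x) = M \<longrightarrow> energy p L \<sigma> \<le> B \<longrightarrow>
    (LINT x|lebesgue. A (\<sigma> x)) \<le> C \<and> (LINT x|lebesgue. rotation_density L \<sigma> x) \<le> C \<and>
    (LINT x|lebesgue. \<sigma> x powr \<gamma>) \<le> C \<and> L43 \<sigma> \<le> C \<and> M \<le> C"
proof -
  obtain C1 C2 where C: "0 < C1" "0 < C2" "\<And>\<rho>. \<rho> \<in> admissible p L M \<Longrightarrow>
    (LINT x|lebesgue. A (\<rho> x) + 1/2 * rotation_density L \<rho> x) \<le> C1 * energy p L \<rho> + C2"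
    using coercive by blast
  define K1 where "K1 = \<bar>C1 * B + C2\<bar>"
  define C where "C = 2 * K1 + M + growth_const * (K1 + M)"
  have "(LINT x|lebesgue. A (\<sigma> x)) \<le> C \<and> (LINT x|lebesgue. rotation_density L \<sigma> x) \<le> C \<and>
    (LINT x|lebesgue. \<sigma> x powr \<gamma>) \<le> C \<and> L43 \<sigma> \<le> C \<and> M \<le> C"
    if c: "config \<sigma>" and m: "(LINT x|lebesgue. \<sigma> x) = M" and B: "energy p L \<sigma> \<le> B" for \<sigma>
  proof -
    note \<sigma> = configD[OF c]
    let ?a = "LINT x|lebesgue. A (\<sigma> x)" and ?r = "LINT x|lebesgue. rotation_density L \<sigma> x"
    have pos: "0 \<le> ?a" "0 \<le> ?r" using A_nonneg \<sigma>(7) by (intro integral_nonneg_AE; simp)+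
    have "(LINT x|lebesgue. A (\<sigma> x) + 1/2 * rotation_density L \<sigma> x) \<le> C1 * energy p L \<sigma> + C2"
      by (rule C(3)[OF config_admissible[OF c m]])
    moreover have "(LINT x|lebesgue. A (\<sigma> x) + 1/2 * rotation_density L \<sigma> x) = ?a + 1/2 * ?r" using \<sigma>(5,6) by simp
    moreover have "C1 * energy p L \<sigma> \<le> C1 * B" using B C(1) by simp
    ultimately have b: "?a + 1/2 * ?r \<le> K1" by (simp add: K1_def)
    have "growth_const * (?a + M) \<le> growth_const * (K1 + M)"
      using growth_const(1) b pos by (intro mult_left_mono) auto
    moreover have "0 \<le> growth_const * (K1 + M)" "0 \<le> K1" using growth_const(1) M_pos by (auto simp: K1_def)
    ultimately show ?thesis
      using config_powr(2)[OF c] config_star_density(2)[OF c] b pos M_pos by (simp add: C_def)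
  qed
  then show ?thesis by blast
qed

lemma minimizing_subsequence:
  assumes c: "\<And>i. config (\<sigma> i)" and mass: "\<And>i. (LINT x|lebesgue. \<sigma> i x) = M"
    and en: "(\<lambda>i. energy p L (\<sigma> i)) \<longlonglongrightarrow> inf_value"
  obtains a s F C where "strict_mono s" "config F" "(LINT x|lebesgue. F x) = M" "energy p L F \<le> inf_value"
    "tight_weak_limit \<gamma> C (\<lambda>i. vshift (a i) (\<sigma> (s i))) F" "integrable lebesgue (\<lambda>x. F x powr \<gamma>)"
    "(LINT x|lebesgue. F x powr \<gamma>) \<le> C"
proof -
  have "Bseq (\<lambda>i. energy p L (\<sigma> i))" using en convergentI convergent_imp_Bseq by blast
  then obtain B where B: "\<And>i. \<bar>energy p L (\<sigma> i)\<bar> \<le> B" by (auto simp: Bseq_def)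
  obtain C where C: "\<And>\<sigma>. config \<sigma> \<Longrightarrow> (LINT x|lebesgue. \<sigma> x) = M \<Longrightarrow> energy p L \<sigma> \<le> B \<Longrightarrow>
    (LINT x|lebesgue. A (\<sigma> x)) \<le> C \<and> (LINT x|lebesgue. rotation_density L \<sigma> x) \<le> C \<and>
    (LINT x|lebesgue. \<sigma> x powr \<gamma>) \<le> C \<and> L43 \<sigma> \<le> C \<and> M \<le> C" using coercive_bounds[of B] by blast
  have bounds: "(LINT x|lebesgue. A (\<tau> x)) \<le> C" "(LINT x|lebesgue. rotation_density L \<tau> x) \<le> C"
    "(LINT x|lebesgue. \<tau> x powr \<gamma>) \<le> C" "L43 \<tau> \<le> C" "M \<le> C"
    if "config \<tau>" "(LINT x|lebesgue. \<tau> x) = M" "energy p L \<tau> = energy p L (\<sigma> i)" for \<tau> i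
    using C[OF that(1,2)] that(3) B[of i] by auto
  have MC: "M \<le> C" using bounds(5)[OF c mass refl] .
  \<comment> \<open>Once the energy is below half the infimum, the mutual energy is at least
    \<open>- inf_value\<close>, because the other two terms are nonnegative. This lower bound is
    what excludes vanishing.\<close>
  have "eventually (\<lambda>i. energy p L (\<sigma> i) < inf_value / 2) sequentially"
    by (rule order_tendstoD(2)[OF en]) (use inf_value(2) in simp)
  then obtain i0 where i0: "\<And>i. i0 \<le> i \<Longrightarrow> energy p L (\<sigma> i) < inf_value / 2" by (auto simp: eventually_sequentially)
  have d: "- inf_value \<le> mutual_energy (\<sigma> (i + i0)) (\<sigma> (i + i0))" for i
  proof -
    have "0 \<le> (LINT x|lebesgue. A (\<sigma> (i + i0) x))" "0 \<le> (LINT x|lebesgue. rotation_density L (\<sigma> (i + i0)) x)"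
      using A_nonneg configD(7)[OF c] by (intro integral_nonneg_AE; simp)+
    then show ?thesis using i0[of "i + i0"] unfolding config_energy[OF c] by simp
  qed
  obtain R0 \<eta> where R0: "0 < R0" "0 < \<eta>" "\<And>\<tau>. config \<tau> \<Longrightarrow> L43 \<tau> \<le> C \<Longrightarrow> - inf_value \<le> mutual_energy \<tau> \<tau> \<Longrightarrow>
    \<exists>a. \<eta> \<le> (LINT x|lebesgue. vshift a \<tau> x * indicator (ball 0 R0) x)"
    using concentrated_ball[of "- inf_value" C] inf_value(2) MC M_pos by auto
  have "\<forall>i. \<exists>a. \<eta> \<le> (LINT x|lebesgue. vshift a (\<sigma> (i + i0)) x * indicator (ball 0 R0) x)"
    using R0(3)[OF c bounds(4)[OF c mass refl] d] by blast
  then obtain a where a: "\<And>i. \<eta> \<le> (LINT x|lebesgue. vshift (a i) (\<sigma> (i + i0)) x * indicator (ball 0 R0) x)" by metis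
  define \<sigma>1 where "\<sigma>1 i = vshift (a i) (\<sigma> (i + i0))" for i
  note shift = config_vshift[OF c]
  have c1: "config (\<sigma>1 i)" and m1: "(LINT x|lebesgue. \<sigma>1 i x) = M" and e1: "energy p L (\<sigma>1 i) = energy p L (\<sigma> (i + i0))" for i
    unfolding \<sigma>1_def using shift mass by auto
  have en1: "(\<lambda>i. energy p L (\<sigma>1 i)) \<longlonglongrightarrow> inf_value" unfolding e1 using en by (rule LIMSEQ_ignore_initial_segment)
  have bd: "bounded (range (\<lambda>i. LINT x|lebesgue. A (\<sigma>1 (r i) x)))" "bounded (range (\<lambda>i. LINT x|lebesgue. rotation_density L (\<sigma>1 (r i)) x))" for r :: "nat \<Rightarrow> nat"
  proof -
    have "0 \<le> (LINT x|lebesgue. A (\<sigma>1 i x))" "0 \<le> (LINT x|lebesgue. rotation_density L (\<sigma>1 i) x)" for i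
      using A_nonneg configD(7)[OF c1] by (intro integral_nonneg_AE; simp)+
    then show "bounded (range (\<lambda>i. LINT x|lebesgue. A (\<sigma>1 (r i) x)))" "bounded (range (\<lambda>i. LINT x|lebesgue. rotation_density L (\<sigma>1 (r i)) x))"
      unfolding bounded_iff using bounds(1,2)[OF c1 m1 e1] by (intro exI[of _ C]; simp)+
  qed
  \<comment> \<open>Internal and rotational energy are made to converge separately, so that each can
    be compared with its own value at the limit.\<close>
  obtain \<alpha> r1 where r1: "strict_mono (r1 :: nat \<Rightarrow> nat)" "((\<lambda>i. LINT x|lebesgue. A (\<sigma>1 i x)) \<circ> r1) \<longlonglongrightarrow> \<alpha>"
    using bounded_imp_convergent_subsequence[OF bd(1)[of id]] by auto
  obtain \<beta> r2 where r2: "strict_mono (r2 :: nat \<Rightarrow> nat)" "((\<lambda>i. LINT x|lebesgue. rotation_density L (\<sigma>1 (r1 i)) x) \<circ> r2) \<longlonglongrightarrow> \<beta>"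
    using bounded_imp_convergent_subsequence[OF bd(2)[of r1]] by auto
  define r where "r = r1 \<circ> r2"
  have r: "strict_mono r" unfolding r_def using r1(1) r2(1) by (rule strict_mono_o)
  have \<alpha>: "(\<lambda>i. LINT x|lebesgue. A (\<sigma>1 (r i) x)) \<longlonglongrightarrow> \<alpha>"
    using LIMSEQ_subseq_LIMSEQ[OF r1(2) r2(1)] by (simp add: r_def comp_def)
  have \<beta>: "(\<lambda>i. LINT x|lebesgue. rotation_density L (\<sigma>1 (r i)) x) \<longlonglongrightarrow> \<beta>"
    using r2(2) by (simp add: r_def comp_def)
  note c2 = c1[of "r i" for i]
  obtain s g F where s: "strict_mono s" and g: "\<And>n. mid_hull (\<lambda>i. \<sigma>1 (r (s i))) n (g n)" and F: "F = (\<lambda>x. max 0 (lim (\<lambda>n. g n x)))"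
    and lim: "AE x in lebesgue. (\<lambda>n. g n x) \<longlonglongrightarrow> F x" and iF: "integrable lebesgue F" and iFg: "integrable lebesgue (\<lambda>x. F x powr \<gamma>)"
    and CFg: "(LINT x|lebesgue. F x powr \<gamma>) \<le> C"
    and weak: "\<And>h. h \<in> borel_measurable lebesgue \<Longrightarrow> integrable lebesgue (\<lambda>x. \<bar>h x\<bar> powr (\<gamma> / (\<gamma> - 1))) \<Longrightarrow>
      (\<lambda>i. LINT x|lebesgue. \<sigma>1 (r (s i)) x * h x) \<longlonglongrightarrow> (LINT x|lebesgue. F x * h x)"
  proof (rule weak_compactness[of "\<lambda>i. \<sigma>1 (r i)" C \<gamma>])
    show "(LINT x|lebesgue. \<sigma>1 (r n) x) \<le> C" for n using m1 MC by simp
  qed (use configD(2,3)[OF c1] config_powr(1)[OF c1] bounds(3)[OF c1 m1 e1] \<gamma>_gt_1 in blast)+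
  define \<tau> where "\<tau> i = \<sigma>1 (r (s i))" for i
  have c\<tau>: "config (\<tau> i)" and m\<tau>: "(LINT x|lebesgue. \<tau> i x) = M" and L\<tau>: "L43 (\<tau> i) \<le> C"
    and p\<tau>: "(LINT x|lebesgue. \<tau> i x powr \<gamma>) \<le> C" for i
    unfolding \<tau>_def using c1 m1 bounds(3,4)[OF c1 m1 e1] by auto
  have rs: "strict_mono (\<lambda>i. r (s i))" using strict_mono_o[OF r s] by (simp add: comp_def)
  have en\<tau>: "(\<lambda>i. energy p L (\<tau> i)) \<longlonglongrightarrow> inf_value"
    using LIMSEQ_subseq_LIMSEQ[OF en1 rs] by (simp add: \<tau>_def comp_def)
  have \<alpha>\<tau>: "(\<lambda>i. LINT x|lebesgue. A (\<tau> i x)) \<longlonglongrightarrow> \<alpha>" and \<beta>\<tau>: "(\<lambda>i. LINT x|lebesgue. rotation_density L (\<tau> i) x) \<longlonglongrightarrow> \<beta>"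
    using LIMSEQ_subseq_LIMSEQ[OF \<alpha> s] LIMSEQ_subseq_LIMSEQ[OF \<beta> s] by (simp_all add: \<tau>_def comp_def)
  have g\<tau>: "\<And>n. mid_hull \<tau> n (g n)" using g by (simp add: \<tau>_def[abs_def])
  have nnF: "0 \<le> F x" for x by (simp add: F)
  note mF = borel_measurable_integrable[OF iF]
  have weak_ball: "(\<lambda>i. LINT x|lebesgue. \<tau> i x * indicator (ball 0 R) x) \<longlonglongrightarrow> (LINT x|lebesgue. F x * indicator (ball 0 R) x)" for R
    unfolding \<tau>_def
  proof (rule weak)
    have "(\<lambda>x::real^3. \<bar>indicator (ball 0 R) x\<bar> powr (\<gamma> / (\<gamma> - 1))) = (indicator (ball 0 R) :: _ \<Rightarrow> real)"
      using \<gamma>_gt_1 by (auto simp: indicator_def fun_eq_iff)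
    then show "integrable lebesgue (\<lambda>x::real^3. \<bar>indicator (ball 0 R) x\<bar> powr (\<gamma> / (\<gamma> - 1)))"
      by (simp add: lmeasurable_iff_integrable[symmetric])
  qed measurable
  have FM: "(LINT x|lebesgue. F x) = M"
    by (rule mass_conserved[OF c\<tau> m\<tau> en\<tau> L\<tau> _ iF nnF weak_ball R0(2)])
      (use MC M_pos a in \<open>auto simp: \<tau>_def \<sigma>1_def\<close>)
  have iA: "integrable lebesgue (\<lambda>x. A (F x))" and EA: "(LINT x|lebesgue. A (F x)) \<le> \<alpha>"
    using internal_energy_lower_semicontinuous[OF c\<tau> \<alpha>\<tau> g\<tau> lim mF] by auto
  have m43: "(\<lambda>t::real. t powr (4/3)) \<in> borel_measurable borel" by measurable
  have mid43: "((a + b) / 2) powr (4/3) \<le> (a powr (4/3) + b powr (4/3)) / 2" if "0 \<le> a" "0 \<le> b" for a b :: real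
    by (rule powr_midpoint_le[OF that]) simp
  have L43F: "integrable lebesgue (\<lambda>x. F x powr (4/3))" "L43 F \<le> C"
    by (rule mid_hull_limit_bound[where \<Phi> = "\<lambda>t. t powr (4/3)" and N = 0, OF m43 powr_ge_zero mid43 _ configD(3,2)[OF c\<tau>]
          star_densityD(4)[OF config_star_density(1)[OF c\<tau>]] L\<tau> g\<tau> lim mF];
        auto intro!: tendsto_powr')+
  have sF: "star_density F" using mF nnF iF L43F by (simp add: star_density_def)
  \<comment> \<open>As no mass is lost, a radius good for the limit works for all late members. The
    finitely many early ones are integrable, and a maximum over their radii settles them.\<close>
  have tail: "\<exists>R. \<forall>n. (LINT x|lebesgue. \<tau> n x * indicator (- ball 0 R) x) \<le> \<epsilon>" if "0 < \<epsilon>" for \<epsilon>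
  proof -
    let ?s = "\<lambda>n R. LINT x|lebesgue. \<tau> n x * indicator (ball 0 R) x"
    have tail_eq: "(LINT x|lebesgue. \<tau> n x * indicator (- ball 0 R) x) = M - ?s n R" for n R
    proof -
      have "(LINT x|lebesgue. \<tau> n x * indicator (- ball 0 R) x) = (LINT x|lebesgue. \<tau> n x - \<tau> n x * indicator (ball 0 R) x)"
        by (rule Bochner_Integration.integral_cong) (auto simp: indicator_def)
      then show ?thesis using configD(3)[OF c\<tau>] integrable_mult_ball[OF configD(3)[OF c\<tau>]] m\<tau> by simp
    qed
    have s_mono: "?s n R \<le> ?s n R'" if "R \<le> R'" for n R R'
      by (rule integral_mono[OF integrable_mult_ball[OF configD(3)[OF c\<tau>]] integrable_mult_ball[OF configD(3)[OF c\<tau>]]])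
        (use that configD(2)[OF c\<tau>] in \<open>auto simp: indicator_def\<close>)
    have ev: "\<exists>k::nat. (LINT x|lebesgue. G x) - \<epsilon> < (LINT x|lebesgue. G x * indicator (ball 0 (real k)) x)"
      if "integrable lebesgue G" for G :: "real^3 \<Rightarrow> real"
    proof -
      have "eventually (\<lambda>k. (LINT x|lebesgue. G x) - \<epsilon> < (LINT x|lebesgue. G x * indicator (ball 0 (real k)) x)) sequentially"
        by (rule order_tendstoD(1)[OF integral_ball_tendsto[OF that]]) (use \<open>0 < \<epsilon>\<close> in simp)
      then show ?thesis by (auto simp: eventually_sequentially)
    qed
    obtain k where k: "M - \<epsilon> < (LINT x|lebesgue. F x * indicator (ball 0 (real k)) x)" using ev[OF iF] FM by auto
    have "eventually (\<lambda>n. M - \<epsilon> < ?s n (real k)) sequentially" by (rule order_tendstoD(1)[OF weak_ball k])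
    then obtain n0 where n0: "\<And>n. n0 \<le> n \<Longrightarrow> M - \<epsilon> < ?s n (real k)" by (auto simp: eventually_sequentially)
    have "\<forall>n. \<exists>k::nat. M - \<epsilon> < ?s n (real k)" using ev[OF configD(3)[OF c\<tau>]] m\<tau> by simp
    then obtain K where K: "\<And>n. M - \<epsilon> < ?s n (real (K n))" by metis
    define R where "R = real (Max (insert k (K ` {..<n0})))"
    have "M - \<epsilon> < ?s n R" for n
    proof (cases "n0 \<le> n")
      case True
      have "real k \<le> R" unfolding R_def by (intro of_nat_mono Max_ge) auto
      then show ?thesis using n0[OF True] s_mono[of "real k" R n] by linarith
    next
      case False
      then have "real (K n) \<le> R" unfolding R_def by (intro of_nat_mono Max_ge) auto
      then show ?thesis using K[of n] s_mono[of "real (K n)" R n] by linarith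
    qed
    then have "(LINT x|lebesgue. \<tau> n x * indicator (- ball 0 R) x) \<le> \<epsilon>" for n
      unfolding tail_eq by (simp add: less_imp_le algebra_simps)
    then show ?thesis by blast
  qed
  have tw: "tight_weak_limit \<gamma> C \<tau> F"
  proof
    show "star_density (\<tau> n)" for n by (rule config_star_density(1)[OF c\<tau>])
    show "(\<lambda>n. LINT x|lebesgue. \<tau> n x * h x) \<longlonglongrightarrow> (LINT x|lebesgue. F x * h x)"
      if "h \<in> borel_measurable lebesgue" "integrable lebesgue (\<lambda>x. \<bar>h x\<bar> powr (\<gamma> / (\<gamma> - 1)))" for h
      using weak[OF that] by (simp add: \<tau>_def)
  qed (use \<gamma>_gt_1 m\<tau> MC config_powr(1)[OF c\<tau>] p\<tau> L\<tau> sF FM L43F tail in auto)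
  have rot: "integrable lebesgue (rotation_density L F)" "(LINT x|lebesgue. rotation_density L F x) \<le> \<beta>"
    using rotation_lower_semicontinuous[OF tw c\<tau> \<beta>\<tau>] FM by auto
  have ax: "axisymmetric F"
  proof -
    have "axisymmetric (g n)" for n by (rule mid_hull_axisymmetric[OF configD(1)[OF c\<tau>] g\<tau>])
    then have gg: "g n x = g n y" if "cyl_radius x = cyl_radius y" "x$3 = y$3" for n x y
      using that unfolding axisymmetric_iff by blast
    show ?thesis unfolding axisymmetric_iff
    proof (intro allI impI)
      fix x y :: "real^3" assume "cyl_radius x = cyl_radius y" "x$3 = y$3"
      then have "(\<lambda>n. g n x) = (\<lambda>n. g n y)" by (intro ext gg)
      then show "F x = F y" by (simp add: F)
    qed
  qed
  have cF: "config F" unfolding config_def using ax nnF iF FM iA rot by simp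
  \<comment> \<open>The limit of the energies has the mutual energy of \<open>F\<close> itself as
    its gravitational part, so the two semicontinuity inequalities put the energy of
    \<open>F\<close> at or below the infimum.\<close>
  have "(\<lambda>i. energy p L (\<tau> i)) \<longlonglongrightarrow> \<alpha> + 1/2 * \<beta> - 1/2 * mutual_energy F F"
    unfolding config_energy[OF c\<tau>] by (intro tendsto_intros \<alpha>\<tau> \<beta>\<tau> mutual_energy_tendsto[OF tw tw])
  then have "inf_value = \<alpha> + 1/2 * \<beta> - 1/2 * mutual_energy F F" using en\<tau> LIMSEQ_unique by blast
  then have "energy p L F \<le> inf_value" unfolding config_energy[OF cF] using EA rot(2) by linarith
  moreover have "strict_mono (\<lambda>i. r (s i) + i0)" using rs by (simp add: strict_mono_def)
  moreover have "tight_weak_limit \<gamma> C (\<lambda>i. vshift (a (r (s i))) (\<sigma> (r (s i) + i0))) F"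
    using tw by (simp add: \<tau>_def[abs_def] \<sigma>1_def)
  ultimately show ?thesis using that[of "\<lambda>i. r (s i) + i0" F C "\<lambda>i. a (r (s i))"] cF FM iFg CFg by blast
qed

end

section \<open>Convergence of the fields and return to the given sequence\<close>

lemma norm_powr_two: "norm (x::'a::real_inner) powr 2 = x \<bullet> x"
  by (cases "x = 0") (auto simp: power2_norm_eq_inner powr_numeral)

text \<open>The constant sequence is the partner of the shifted one in the cross term of the squared
  distance between the fields.\<close>

lemma (in tight_weak_limit) tight_weak_limit_const:
  assumes "integrable lebesgue (\<lambda>x. F x powr \<gamma>)" "(LINT x|lebesgue. F x powr \<gamma>) \<le> C"
  shows "tight_weak_limit \<gamma> C (\<lambda>_. F) F"
proof
  show "\<exists>R. \<forall>n::nat. (LINT x|lebesgue. F x * indicator (- ball 0 R) x) \<le> \<epsilon>" if "0 < \<epsilon>" for \<epsilon>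
    using common_tail[OF that] by blast
qed (use assms \<gamma>1 F_star F_mass F_L43 in auto)

context rotating_star
begin

lemma minimizing_sequence_limit:
  assumes min: "minimizing_sequence p L M \<rho>"
  shows "\<exists>(a :: nat \<Rightarrow> real) (s :: nat \<Rightarrow> nat) \<rho>'. strict_mono s \<and> \<rho>' \<in> admissible p L M \<and>
      (let T = (\<lambda>i. vshift (a i) (\<rho> (s i))) in
        (\<forall>\<epsilon>>0. \<exists>R>0. \<forall>i. (LINT x:{x. norm x \<ge> R}|lebesgue. T i x) \<le> \<epsilon>) \<and>
        weakly_converges_Lp \<gamma> T \<rho>' \<and>
        (\<exists>G G'. (\<forall>i. weak_gradient (potential (T i)) (G i)) \<and>
           weak_gradient (potential \<rho>') G' \<and> strongly_converges_L2 G G') \<and>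
        energy_minimizer p L M \<rho>')"
proof -
  have adm: "\<rho> i \<in> admissible p L M" for i using min by (simp add: minimizing_sequence_def)
  define \<sigma> where "\<sigma> i x = max 0 (\<rho> i x)" for i x
  have \<sigma>_eta: "(\<lambda>x. max 0 (\<rho> i x)) = \<sigma> i" for i by (simp add: \<sigma>_def fun_eq_iff)
  note pos = admissible_positive_part[OF adm, unfolded \<sigma>_eta]
  have "(\<lambda>i. ereal (energy p L (\<rho> i))) \<longlonglongrightarrow> ereal inf_value"
    using min unfolding minimizing_sequence_def inf_value(1) by blast
  then have en: "(\<lambda>i. energy p L (\<sigma> i)) \<longlonglongrightarrow> inf_value"
    unfolding lim_ereal pos(5) .
  obtain a s F C where s: "strict_mono s" and cF: "config F" and FM: "(LINT x|lebesgue. F x) = M" and EF: "energy p L F \<le> inf_value"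
    and tw: "tight_weak_limit \<gamma> C (\<lambda>i. vshift (a i) (\<sigma> (s i))) F" and Fp: "integrable lebesgue (\<lambda>x. F x powr \<gamma>)" "(LINT x|lebesgue. F x powr \<gamma>) \<le> C"
    by (rule minimizing_subsequence[OF pos(2,3) en])
  define \<tau> where "\<tau> i = vshift (a i) (\<sigma> (s i))" for i
  define T where "T i = vshift (a i) (\<rho> (s i))" for i
  interpret tw: tight_weak_limit \<gamma> C \<tau> F using tw by (simp add: \<tau>_def[abs_def])
  note twc = tw.tight_weak_limit_const[OF Fp]
  have aF: "F \<in> admissible p L M" by (rule config_admissible[OF cF FM])
  have mT[measurable]: "T i \<in> borel_measurable lebesgue" for i
    unfolding T_def vshift_def by (rule measurable_compose[OF translation_measurable_lebesgue pos(6)])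
  note m\<tau>[measurable] = star_densityD(1)[OF tw.f_star]
  have eq: "AE x in lebesgue. T i x = \<tau> i x" for i
    unfolding T_def \<tau>_def vshift_def using AE_lebesgue_affine[of 1, OF _ pos(1)] by (simp add: \<sigma>_def)
  \<comment> \<open>Potentials are integrals and hence agree at every point, although the densities
    agree only almost everywhere; a weak gradient for one therefore serves for the other.\<close>
  have pot: "potential (T i) = potential (\<tau> i)" for i
    unfolding T_def \<tau>_def fun_eq_iff
    using borel_measurable_integrable[OF configD(3)[OF pos(2)]] by (simp add: potential_vshift pos(4) pos(6))
  have tight: "\<exists>R>0. \<forall>i. (LINT x:{x. norm x \<ge> R}|lebesgue. T i x) \<le> \<epsilon>" if \<epsilon>: "0 < \<epsilon>" for \<epsilon>
  proof -
    obtain R where R: "\<And>n. (LINT x|lebesgue. \<tau> n x * indicator (- ball 0 R) x) \<le> \<epsilon>" using tw.common_tail[OF \<epsilon>] by blast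
    have c[measurable]: "- ball (0::real^3) r \<in> sets lebesgue" for r by auto
    have ti: "integrable lebesgue (\<lambda>x. \<tau> i x * indicator (- ball 0 r) x)" for i r
      using integrable_mult_indicator[OF c star_densityD(3)[OF tw.f_star]] by (simp add: mult.commute)
    have "(LINT x:{x. norm x \<ge> max R 1}|lebesgue. T i x) \<le> \<epsilon>" for i
    proof -
      have set: "{x::real^3. max R 1 \<le> norm x} = - ball 0 (max R 1)" by auto
      have "(LINT x:{x. norm x \<ge> max R 1}|lebesgue. T i x) = (LINT x|lebesgue. \<tau> i x * indicator (- ball 0 (max R 1)) x)"
        unfolding set_lebesgue_integral_def set
      proof (rule integral_cong_AE)
        show "AE x in lebesgue. indicat_real (- ball 0 (max R 1)) x *\<^sub>R T i x = \<tau> i x * indicator (- ball 0 (max R 1)) x"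
          using eq[of i] by eventually_elim simp
      qed measurable
      also have "\<dots> \<le> (LINT x|lebesgue. \<tau> i x * indicator (- ball 0 R) x)"
        by (rule integral_mono[OF ti ti]) (use star_densityD(2)[OF tw.f_star] in \<open>auto simp: indicator_def\<close>)
      finally show ?thesis using R[of i] by linarith
    qed
    then show ?thesis by (intro exI[of _ "max R 1"]) auto
  qed
  have weak: "weakly_converges_Lp \<gamma> T F"
    unfolding weakly_converges_Lp_def
  proof (intro conjI allI impI)
    show "in_Lp \<gamma> (T i)" for i
      unfolding in_Lp_def
    proof
      show "integrable lebesgue (\<lambda>x. norm (T i x) powr \<gamma>)"
      proof (rule integrable_cong_AE_imp[OF tw.f_powr(1)])
        show "AE x in lebesgue. \<tau> i x powr \<gamma> = norm (T i x) powr \<gamma>"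
          using eq[of i] by eventually_elim (simp add: star_densityD(2)[OF tw.f_star])
      qed measurable
    qed measurable
    show "in_Lp \<gamma> F" using Fp(1) star_densityD(1,2)[OF tw.F_star] by (simp add: in_Lp_def)
    fix h :: "real^3 \<Rightarrow> real" assume h: "in_Lp (\<gamma> / (\<gamma> - 1)) h"
    then have [measurable]: "h \<in> borel_measurable lebesgue" by (simp add: in_Lp_def)
    have "(LINT x|lebesgue. T i x * h x) = (LINT x|lebesgue. \<tau> i x * h x)" for i
    proof (rule integral_cong_AE)
      show "AE x in lebesgue. T i x * h x = \<tau> i x * h x" using eq[of i] by eventually_elim simp
    qed measurable
    then show "(\<lambda>i. LINT x|lebesgue. T i x * h x) \<longlonglongrightarrow> (LINT x|lebesgue. F x * h x)"
      using tw.weak[of h] h by (simp add: in_Lp_def)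
  qed
  have grad: "strongly_converges_L2 (\<lambda>i. gravity (\<tau> i)) (gravity F)"
    unfolding strongly_converges_L2_def
  proof (intro conjI allI)
    have Lp: "in_Lp 2 (gravity f)" if "star_density f" for f
      using gravity_inner(1)[OF that that] gravity_measurable[OF star_densityD(1)[OF that]]
      by (simp add: in_Lp_def norm_powr_two)
    show "in_Lp 2 (gravity (\<tau> i))" for i by (rule Lp[OF tw.f_star])
    show "in_Lp 2 (gravity F)" by (rule Lp[OF tw.F_star])
    \<comment> \<open>Expanding the square expresses the L^2 distance through mutual energies, whose
      limits cancel with weights 1, -2 and 1.\<close>
    have "(LINT x|lebesgue. (norm (gravity (\<tau> i) x - gravity F x))\<^sup>2) =
        gravity_const * (mutual_energy (\<tau> i) (\<tau> i) - 2 * mutual_energy (\<tau> i) F + mutual_energy F F)" for i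
    proof -
      have "(norm (gravity (\<tau> i) x - gravity F x))\<^sup>2 =
          gravity (\<tau> i) x \<bullet> gravity (\<tau> i) x - 2 * (gravity (\<tau> i) x \<bullet> gravity F x) + gravity F x \<bullet> gravity F x" for x
        by (simp add: power2_norm_eq_inner inner_diff_left inner_diff_right inner_commute)
      then have "(LINT x|lebesgue. (norm (gravity (\<tau> i) x - gravity F x))\<^sup>2) =
          (LINT x|lebesgue. gravity (\<tau> i) x \<bullet> gravity (\<tau> i) x - 2 * (gravity (\<tau> i) x \<bullet> gravity F x) + gravity F x \<bullet> gravity F x)"
        by (simp only:)
      also have "\<dots> = gravity_const * mutual_energy (\<tau> i) (\<tau> i) - 2 * (gravity_const * mutual_energy (\<tau> i) F) + gravity_const * mutual_energy F F"
        using gravity_inner[OF tw.f_star tw.f_star, of i i] gravity_inner[OF tw.f_star tw.F_star, of i] gravity_inner[OF tw.F_star tw.F_star]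
        by simp
      finally show ?thesis by (simp add: algebra_simps)
    qed
    moreover have "(\<lambda>i. gravity_const * (mutual_energy (\<tau> i) (\<tau> i) - 2 * mutual_energy (\<tau> i) F + mutual_energy F F)) \<longlonglongrightarrow>
        gravity_const * (mutual_energy F F - 2 * mutual_energy F F + mutual_energy F F)"
      by (intro tendsto_intros mutual_energy_tendsto[OF tw.tight_weak_limit_axioms tw.tight_weak_limit_axioms]
          mutual_energy_tendsto[OF tw.tight_weak_limit_axioms twc])
    ultimately show "(\<lambda>i. LINT x|lebesgue. (norm (gravity (\<tau> i) x - gravity F x))\<^sup>2) \<longlonglongrightarrow> 0" by simp
  qed
  have "\<forall>i. weak_gradient (potential (T i)) (gravity (\<tau> i))"
    unfolding pot using weak_gradient_potential[OF tw.f_star] by blast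
  moreover have "weak_gradient (potential F) (gravity F)" by (rule weak_gradient_potential[OF tw.F_star])
  ultimately have "\<exists>G G'. (\<forall>i. weak_gradient (potential (T i)) (G i)) \<and> weak_gradient (potential F) G' \<and> strongly_converges_L2 G G'"
    using grad by (intro exI conjI)
  moreover have "energy_minimizer p L M F"
    unfolding energy_minimizer_def using aF EF inf_value(3) order_trans by blast
  ultimately show ?thesis
    using s aF tight weak by (intro exI[of _ a] exI[of _ s] exI[of _ F]) (simp add: T_def[abs_def])
qed

end

theorem theorem3p1:
  fixes M K \<gamma> :: real and L L' p p' :: "real \<Rightarrow> real"
  assumes "M > 0"
    and "\<And>m. m \<in> {0..M} \<Longrightarrow> (L has_real_derivative L' m) (at m within {0..M})"
    and "continuous_on {0..M} L'"
    and "L 0 = 0"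
    and "\<And>m. m \<in> {0..M} \<Longrightarrow> L m \<ge> 0"
    and "\<And>m. m \<in> {0..M} \<Longrightarrow> L' m \<ge> 0"
    and "\<And>a m. 0 < a \<Longrightarrow> a \<le> 1 \<Longrightarrow> m \<in> {0..M} \<Longrightarrow> L (a * m) \<ge> a powr (4/3) * L m"
    and "\<And>s. s \<in> {0..} \<Longrightarrow> (p has_real_derivative p' s) (at s within {0..})"
    and "continuous_on {0..} p'"
    and "set_integrable lebesgue {0..1} (\<lambda>s. p s / s\<^sup>2)"
    and "((\<lambda>s. p s / s powr \<gamma>) \<longlongrightarrow> K) at_top"
    and "\<And>s. s \<ge> 0 \<Longrightarrow> p s \<ge> 0"
    and "\<And>s. s > 0 \<Longrightarrow> p' s > 0"
    and "0 < K" and "\<gamma> \<ge> 4/3"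
    and "inf_energy p L M < 0"
    and "\<exists>C1>0. \<exists>C2>0. \<forall>\<rho>\<in>admissible p L M.
           (LINT x|lebesgue. internal_energy p (\<rho> x) + 1/2 * rotation_density L \<rho> x)
             \<le> C1 * energy p L \<rho> + C2"
  shows "\<forall>\<rho>. minimizing_sequence p L M \<rho> \<longrightarrow>
    (\<exists>(a :: nat \<Rightarrow> real) (s :: nat \<Rightarrow> nat) \<rho>'. strict_mono s \<and> \<rho>' \<in> admissible p L M \<and>
      (let T = (\<lambda>i. vshift (a i) (\<rho> (s i))) in
        (\<forall>\<epsilon>>0. \<exists>R>0. \<forall>i. (LINT x:{x. norm x \<ge> R}|lebesgue. T i x) \<le> \<epsilon>) \<and>
        weakly_converges_Lp \<gamma> T \<rho>' \<and>
        (\<exists>G G'. (\<forall>i. weak_gradient (potential (T i)) (G i)) \<and>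
           weak_gradient (potential \<rho>') G' \<and> strongly_converges_L2 G G') \<and>
        energy_minimizer p L M \<rho>'))"
proof -
  interpret rotating_star M K \<gamma> L L' p p'
    by (unfold_locales; fact assms)
  show ?thesis using minimizing_sequence_limit by blast
qed

end
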